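(* Let $\varepsilon>0$ be a constant, let $c=(1+\varepsilon)n$ and let $p=\frac{\log n+\log\log n+\omega(1)}{n}$. Then a random graph $G\sim \mathcal G_c(n,p)$ contains, with probability $1-o(1)$ as $n\to\infty$, a rainbow Hamilton cycle.
   Context: $\mathcal G_c(n,p)$ denotes the probability space of edge-colored graphs on vertex set $[n]=\{1,\dots,n\}$ obtained by including each pair of vertices as an edge independently with probability $p$, and then assigning to each chosen edge a color from $[c]$ uniformly and independently at random. A subgraph is rainbow if all its edges have distinct colors. Asymptotic notation refers to $n\to\infty$. *)

theory Defs
  imports "HOL-Probability.Probability"
begin

definition pairs :: "nat \<Rightarrow> nat set set" where
  "pairs n = {{i, j} | i j. i \<in> {1..n} \<and> j \<in> {1..n} \<and> i \<noteq> j}"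

text \<open>An edge-coloured graph on [n] is a map from pairs to colour options:
  None = non-edge, Some k = edge with colour k.\<close>
type_synonym cgraph = "nat set \<Rightarrow> nat option"

definition edge_pmf :: "real \<Rightarrow> nat \<Rightarrow> nat option pmf" where
  "edge_pmf p c = do { b \<leftarrow> bernoulli_pmf p;
                       if b then map_pmf Some (pmf_of_set {1..c}) else return_pmf None }"

definition Gc :: "nat \<Rightarrow> nat \<Rightarrow> real \<Rightarrow> cgraph pmf" where
  "Gc n c p = Pi_pmf (pairs n) None (\<lambda>_. edge_pmf p c)"

definition has_rainbow_ham_cycle :: "nat \<Rightarrow> cgraph \<Rightarrow> bool" where
  "has_rainbow_ham_cycle n G \<longleftrightarrow>
     (\<exists>vs. distinct vs \<and> set vs = {1..n} \<and> length vs \<ge> 3 \<and>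
        (\<forall>k < length vs. G {vs ! k, vs ! ((k + 1) mod length vs)} \<noteq> None) \<and>
        inj_on (\<lambda>k. G {vs ! k, vs ! ((k + 1) mod length vs)}) {..<length vs})"

end

theory Submission
  imports Defs "HOL-Real_Asymp.Real_Asymp"
begin

text \<open>The proof exposes the random coloured graph in two rounds.  A first graph \<open>T\<close> of density
\<open>p1 = min p (2 ln n / n) - O(1/n)\<close> still has minimum degree 2.  Its edges are split at random into revealed ones, whose
colours are exposed, and hidden ones.  McDiarmid's coupling trades the colours of all hidden edges
(and of the second round) for an independent thinning with survival probability
\<open>\<epsilon> / (1 + \<epsilon>)\<close>: of the \<open>(1 + \<epsilon>) n\<close> colours at most \<open>n\<close> are forbidden by the rest of a Hamilton cycle.
The few vertices of low degree in the thinned graph, or with few revealed edges, are served by revealed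
edges instead; there are so few of these that keeping the first occurrence of every colour loses almost nothing.
The union of the surviving hidden edges and of this rainbow set is an expander, so by Posa's rotations
it has quadratically many boosters unless it is Hamiltonian, and the second round, which has only linearly
many edges, supplies enough of them.\<close>

text \<open>Thinning cannot be applied to all edges: near the threshold some vertices have degree
  two or little more, and losing each of their edges with constant probability would be fatal. The
  colours at such vertices must be seen instead. But which vertices are poor after thinning is known
  only once the survival bits are, whereas the coupling needs the set of hidden edges to be fixed
  before those bits are drawn. This is why half of the first-round edges, chosen at random, are set
  aside in advance: the hidden set then depends on the types alone, and a vertex outside
  \<open>low1\<close> that turns out poor still has at least \<open>D\<close> edges with visible
  colours. The cap \<open>2 ln n / n\<close> on the first-round density keeps all degrees below a
  power of \<open>ln n\<close>, so that few poor vertices mean few visible edges in use and hence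
  few colour clashes. If \<open>p\<close> is larger, the surplus falls to the second round, of which
  only a thinned density \<open>2000 / n\<close> is ever used.\<close>

abbreviation prob :: "'a pmf \<Rightarrow> 'a set \<Rightarrow> real" where
  "prob M \<equiv> measure_pmf.prob M"

section \<open>Random subsets\<close>

definition rsub :: "'a set \<Rightarrow> real \<Rightarrow> 'a set pmf" where
  "rsub P \<theta> = map_pmf (\<lambda>f. {e \<in> P. f e}) (Pi_pmf P False (\<lambda>_. bernoulli_pmf \<theta>))"

lemma map_bernoulli_prob: "map_pmf h M = bernoulli_pmf (prob M {x. h x})"
proof (rule pmf_eqI)
  fix b :: bool
  have "prob M {x. h x} \<in> {0..1}" by simp
  moreover have "prob M {x. \<not> h x} = 1 - prob M {x. h x}"
    using measure_pmf.prob_compl[of "{x. h x}" M] by (simp add: Compl_eq_Diff_UNIV[symmetric] Collect_neg_eq)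
  ultimately show "pmf (map_pmf h M) b = pmf (bernoulli_pmf (prob M {x. h x})) b"
    by (cases b) (auto simp: pmf_map vimage_def)
qed

text \<open>A Boolean test applied coordinatewise to independent coordinates gives independent bits.
  Events about the typed graphs \<open>T\<close>, \<open>U\<close> and \<open>H\<close> reach the
  estimates on \<open>rsub\<close> this way.\<close>

lemma rsub_of_Pi:
  assumes "finite P" "\<And>e. e \<in> P \<Longrightarrow> prob (st e) {x. h x} = \<theta>"
  shows "map_pmf (\<lambda>\<omega>. {e \<in> P. h (\<omega> e)}) (Pi_pmf P d st) = rsub P \<theta>"
proof -
  have "rsub P \<theta> = map_pmf (\<lambda>f. {e \<in> P. f e}) (Pi_pmf P False (\<lambda>e. bind_pmf (st e) (\<lambda>x. return_pmf (h x))))"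
    unfolding rsub_def using assms(2)
    by (intro arg_cong[where f = "map_pmf _"] Pi_pmf_cong)
      (simp_all flip: map_pmf_def add: map_bernoulli_prob)
  also have "\<dots> = map_pmf (\<lambda>f. {e \<in> P. f e}) (Pi_pmf P d st \<bind> (\<lambda>f. return_pmf (\<lambda>x. if x \<in> P then h (f x) else False)))"
    using assms(1) by (subst Pi_pmf_bind[where d' = d]) auto
  also have "\<dots> = map_pmf (\<lambda>\<omega>. {e \<in> P. h (\<omega> e)}) (Pi_pmf P d st)"
    by (simp add: map_pmf_def bind_assoc_pmf bind_return_pmf cong: conj_cong)
  finally show ?thesis ..
qed

lemma set_rsub: "finite P \<Longrightarrow> X \<in> set_pmf (rsub P \<theta>) \<Longrightarrow> X \<subseteq> P"
  unfolding rsub_def by auto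

text \<open>Markov's inequality for a product of weights, whose expectation factorises by
  independence. Weight 0 forces an element in or out of the set; other weights give exponential
  moments. The tail estimates for \<open>rsub\<close> are all built on it.\<close>

lemma rsub_prob_le:
  assumes P: "finite P" and \<theta>: "0 \<le> \<theta>" "\<theta> \<le> 1" and K: "K > 0"
    and ab: "\<And>e. e \<in> P \<Longrightarrow> 0 \<le> a e \<and> 0 \<le> b e"
    and A: "\<And>X. X \<in> A \<Longrightarrow> X \<subseteq> P \<Longrightarrow> K \<le> (\<Prod>e\<in>P. if e \<in> X then a e else b e)"
  shows "prob (rsub P \<theta>) A \<le> (\<Prod>e\<in>P. \<theta> * a e + (1 - \<theta>) * b e) / K"
proof -
  let ?M = "Pi_pmf P False (\<lambda>_. bernoulli_pmf \<theta>)"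
  let ?g = "\<lambda>f. (\<Prod>e\<in>P. (\<lambda>z. if z then a e else b e) (f e))"
  have fin: "finite (set_pmf ?M)"
    by (rule finite_subset[OF set_Pi_pmf_subset'[OF P]]) (use P in auto)
  have int: "integrable (measure_pmf ?M) u" for u :: "('a \<Rightarrow> bool) \<Rightarrow> real"
    by (rule integrable_measure_pmf_finite[OF fin])
  have "prob (rsub P \<theta>) A * K = measure_pmf.expectation ?M (\<lambda>f. indicator A {e \<in> P. f e} * K)"
  proof -
    have "measure_pmf.expectation ?M (\<lambda>f. indicator {f. {e \<in> P. f e} \<in> A} f) = prob ?M {f. {e \<in> P. f e} \<in> A}"
      by simp
    then show ?thesis unfolding rsub_def by (simp add: vimage_def indicator_def)
  qed
  also have "\<dots> \<le> measure_pmf.expectation ?M ?g"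
  proof (rule integral_mono[OF int int])
    fix f
    have *: "?g f = (\<Prod>e\<in>P. if e \<in> {e \<in> P. f e} then a e else b e)" by (rule prod.cong) auto
    have "?g f \<ge> 0" using ab by (intro prod_nonneg) auto
    moreover have "K \<le> ?g f" if h: "{e \<in> P. f e} \<in> A"
    proof -
      have "{e \<in> P. f e} \<subseteq> P" by auto
      from A[OF h this] show ?thesis by (simp only: *)
    qed
    ultimately show "indicator A {e \<in> P. f e} * K \<le> ?g f"
      by (cases "{e \<in> P. f e} \<in> A") simp_all
  qed
  also have "\<dots> = (\<Prod>e\<in>P. measure_pmf.expectation (bernoulli_pmf \<theta>) (\<lambda>z. if z then a e else b e))"
    using ab by (intro expectation_prod_Pi_pmf[OF P] integrable_measure_pmf_finite) auto
  also have "\<dots> = (\<Prod>e\<in>P. \<theta> * a e + (1 - \<theta>) * b e)"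
    using \<theta> by (intro prod.cong refl) simp
  finally show ?thesis using K by (simp add: field_simps)
qed

text \<open>An exponential-moment bound, with weight \<open>y\<close> for each element of \<open>A\<close>.\<close>
lemma rsub_prob_weight_le:
  assumes P: "finite P" and \<theta>: "0 \<le> \<theta>" "\<theta> \<le> 1" and y: "y > 0"
    and sub: "F \<subseteq> P" "B \<subseteq> P" "A \<subseteq> P" and disj: "F \<inter> B = {}" "F \<inter> A = {}" "A \<inter> B = {}"
    and K: "K > 0" and ev: "\<And>X. X \<in> Ev \<Longrightarrow> X \<subseteq> P \<Longrightarrow> F \<subseteq> X \<and> X \<inter> B = {} \<and> K \<le> y ^ card (X \<inter> A)"
  shows "prob (rsub P \<theta>) Ev \<le> \<theta> ^ card F * (1 - \<theta>) ^ card B * (1 - \<theta> + \<theta> * y) ^ card A / K"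
proof -
  define a where "a e = (if e \<in> B then 0 else if e \<in> A then y else 1)" for e
  define b where "b e = (if e \<in> F then 0 else 1 :: real)" for e
  have fin: "finite F" "finite B" "finite A" using sub P by (auto intro: finite_subset)
  have "prob (rsub P \<theta>) Ev \<le> (\<Prod>e\<in>P. \<theta> * a e + (1 - \<theta>) * b e) / K"
  proof (rule rsub_prob_le[OF P \<theta> K])
    fix X assume X: "X \<in> Ev" "X \<subseteq> P"
    note e = ev[OF X]
    have "(\<Prod>e\<in>P. if e \<in> X then a e else b e) = (\<Prod>e\<in>P. if e \<in> X \<inter> A then y else 1)"
      using e disj by (intro prod.cong refl) (auto simp: a_def b_def)
    also have "\<dots> = y ^ card (X \<inter> A)"
    proof -
      have "P \<inter> {e. e \<in> X \<inter> A} = X \<inter> A" using sub by auto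
      then show ?thesis using P by (simp only: prod.If_cases) simp
    qed
    finally show "K \<le> (\<Prod>e\<in>P. if e \<in> X then a e else b e)" using e by simp
  qed (use y in \<open>auto simp: a_def b_def\<close>)
  also have "(\<Prod>e\<in>P. \<theta> * a e + (1 - \<theta>) * b e) =
      (\<Prod>e\<in>P. (if e \<in> F then \<theta> else 1) * (if e \<in> B then 1 - \<theta> else 1) * (if e \<in> A then 1 - \<theta> + \<theta> * y else 1))"
    using disj by (intro prod.cong refl) (auto simp: a_def b_def)
  also have "\<dots> = \<theta> ^ card F * (1 - \<theta>) ^ card B * (1 - \<theta> + \<theta> * y) ^ card A"
    using sub P by (simp add: prod.distrib prod.If_cases Int_absorb1)
  finally show ?thesis by (simp add: divide_right_mono)
qed

lemma rsub_forced:
  assumes "finite P" "0 \<le> \<theta>" "\<theta> \<le> 1" "F \<subseteq> P" "B \<subseteq> P" "F \<inter> B = {}"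
  shows "prob (rsub P \<theta>) {X. F \<subseteq> X \<and> X \<inter> B = {}} \<le> \<theta> ^ card F * (1 - \<theta>) ^ card B"
  using rsub_prob_weight_le[of P \<theta> 1 F B "{}" 1 "{X. F \<subseteq> X \<and> X \<inter> B = {}}"] assms by auto

text \<open>Chernoff's lower tail with a free parameter. Later \<open>y = 1 / ln n\<close>: the
  factor \<open>(1 / y) ^ k\<close> is then only a power of \<open>ln n\<close>, and the exponent
  loses only a bounded amount.\<close>

lemma rsub_few:
  assumes "finite P" "0 \<le> \<theta>" "\<theta> \<le> 1" "0 < y" "y \<le> 1" "A \<subseteq> P"
  shows "prob (rsub P \<theta>) {X. card (X \<inter> A) < k} \<le> (1 / y) ^ k * exp (- \<theta> * (1 - y) * card A)"
proof -
  have "prob (rsub P \<theta>) {X. card (X \<inter> A) < k} \<le> (1 - \<theta> + \<theta> * y) ^ card A / y ^ k"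
    using rsub_prob_weight_le[OF assms(1-4), of "{}" "{}" A "y ^ k" "{X. card (X \<inter> A) < k}"] assms
    by (simp add: power_decreasing)
  also have "(1 - \<theta> + \<theta> * y) ^ card A \<le> exp (- \<theta> * (1 - y)) ^ card A"
    using assms exp_ge_add_one_self[of "- \<theta> * (1 - y)"]
    by (intro power_mono) (auto simp: algebra_simps intro: order_trans[of \<theta> 1])
  finally show ?thesis using assms by (simp add: divide_simps exp_of_nat_mult[symmetric] mult_ac)
qed

lemma rsub_many:
  assumes "finite P" "0 \<le> \<theta>" "\<theta> \<le> 1" "1 \<le> z" "A \<subseteq> P"
  shows "prob (rsub P \<theta>) {X. k \<le> card (X \<inter> A)} \<le> exp (\<theta> * z * card A) / z ^ k"
proof -
  have "prob (rsub P \<theta>) {X. k \<le> card (X \<inter> A)} \<le> (1 - \<theta> + \<theta> * z) ^ card A / z ^ k"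
    using rsub_prob_weight_le[OF assms(1-3), of z "{}" "{}" A "z ^ k" "{X. k \<le> card (X \<inter> A)}"] assms
    by (simp add: power_increasing)
  also have "(1 - \<theta> + \<theta> * z) ^ card A \<le> exp (\<theta> * z) ^ card A"
    using assms exp_ge_add_one_self[of "\<theta> * z"] mult_nonneg_nonneg[of \<theta> z]
    by (intro power_mono) linarith+
  finally show ?thesis using assms by (simp add: divide_right_mono exp_of_nat_mult[symmetric] mult_ac)
qed

section \<open>Union bounds over small sets\<close>

lemma prob_ex_le_sum:
  assumes "finite I"
  shows "prob M {\<omega>. \<exists>i\<in>I. Q i \<omega>} \<le> (\<Sum>i\<in>I. prob M {\<omega>. Q i \<omega>})"
proof -
  have "{\<omega>. \<exists>i\<in>I. Q i \<omega>} = (\<Union>i\<in>I. {\<omega>. Q i \<omega>})" by auto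
  then show ?thesis using measure_pmf.finite_measure_subadditive_finite[OF assms, of "\<lambda>i. {\<omega>. Q i \<omega>}" M] by simp
qed

text \<open>The truncation to \<open>card F \<le> k\<close> is paid for by the factor
  \<open>y ^ card F / y ^ k\<close>, which is at least 1; the sum over all subsets is then a
  binomial expansion. With \<open>q = 1\<close> and \<open>y = k / card N\<close> this is the
  familiar bound \<open>(e * card N / k) ^ k\<close> on the number of small subsets.\<close>

lemma sum_Pow_small_le:
  fixes q y :: real
  assumes N: "finite N" and y: "0 < y" "y \<le> 1" and q: "0 \<le> q"
  shows "(\<Sum>F | F \<subseteq> N \<and> card F \<le> k. q ^ card F) \<le> exp (q * y * card N) / y ^ k"
proof -
  have "(\<Sum>F | F \<subseteq> N \<and> card F \<le> k. q ^ card F) \<le> (\<Sum>F | F \<subseteq> N \<and> card F \<le> k. (q * y) ^ card F / y ^ k)"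
  proof (rule sum_mono)
    fix F assume F: "F \<in> {F. F \<subseteq> N \<and> card F \<le> k}"
    have "y ^ k \<le> y ^ card F" using F y by (intro power_decreasing) auto
    then have "q ^ card F * y ^ k \<le> q ^ card F * y ^ card F" using q by (intro mult_left_mono) auto
    then show "q ^ card F \<le> (q * y) ^ card F / y ^ k" using y by (simp add: field_simps power_mult_distrib)
  qed
  also have "\<dots> \<le> (\<Sum>F\<in>Pow N. (q * y) ^ card F / y ^ k)"
    using N q y by (intro sum_mono2) auto
  also have "\<dots> = (\<Sum>F\<in>Pow N. (q * y) ^ card F) / y ^ k" by (simp add: sum_divide_distrib)
  also have "(\<Sum>F\<in>Pow N. (q * y) ^ card F) = (1 + q * y) ^ card N"
  proof -
    have "(\<Prod>e\<in>N. (1 + q * y)) = (\<Sum>F\<in>Pow N. prod (\<lambda>_. q * y) F)"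
      using prod_add[OF N, of "\<lambda>_. q * y" "\<lambda>_. 1"] by (simp add: add.commute)
    then show ?thesis by simp
  qed
  also have "\<dots> \<le> exp (q * y) ^ card N" using q y by (intro power_mono) auto
  finally show ?thesis using y by (simp add: divide_right_mono exp_of_nat_mult[symmetric] mult_ac)
qed

lemma card_small_subsets_le:
  fixes y :: real
  assumes "finite N" "0 < y" "y \<le> 1"
  shows "real (card {F. F \<subseteq> N \<and> card F \<le> k}) \<le> exp (y * card N) / y ^ k"
  using sum_Pow_small_le[OF assms, of 1 k] by simp

section \<open>Rotations and boosters\<close>

definition is_path :: "'a set set \<Rightarrow> 'a list \<Rightarrow> bool" where
  "is_path E p \<longleftrightarrow> p \<noteq> [] \<and> distinct p \<and> successively (\<lambda>a b. {a, b} \<in> E) p"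

definition ham :: "'a set \<Rightarrow> 'a set set \<Rightarrow> bool" where
  "ham V E \<longleftrightarrow> (\<exists>p. is_path E p \<and> set p = V \<and> length p \<ge> 3 \<and> {last p, hd p} \<in> E)"

definition nbh :: "'a set set \<Rightarrow> 'a set \<Rightarrow> 'a set" where
  "nbh E S = {w. w \<notin> S \<and> (\<exists>v\<in>S. {v, w} \<in> E)}"

definition expander :: "'a set \<Rightarrow> 'a set set \<Rightarrow> nat \<Rightarrow> bool" where
  "expander V E k \<longleftrightarrow> (\<forall>S\<subseteq>V. S \<noteq> {} \<and> card S \<le> k \<longrightarrow> 2 * card S \<le> card (nbh E S))"

definition all_pairs :: "'a set \<Rightarrow> 'a set set" where
  "all_pairs V = {{a, b} | a b. a \<in> V \<and> b \<in> V \<and> a \<noteq> b}"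

section \<open>Path neighbours and Posa's rotations\<close>

fun padj :: "'a list \<Rightarrow> 'a \<Rightarrow> 'a \<Rightarrow> bool" where
  "padj (a # b # xs) v w = (v = a \<and> w = b \<or> v = b \<and> w = a \<or> padj (b # xs) v w)"
| "padj _ v w = False"

lemma padj_append:
  assumes "xs \<noteq> []" "ys \<noteq> []"
  shows "padj (xs @ ys) v w \<longleftrightarrow> padj xs v w \<or> padj ys v w \<or>
    v = last xs \<and> w = hd ys \<or> v = hd ys \<and> w = last xs"
  using assms
proof (induction xs rule: induct_list012)
  case 1 then show ?case by simp
next
  case (2 x) then show ?case by (cases ys) auto
next
  case (3 x y zs) then show ?case by auto
qed

lemma padj_rev: "padj (rev xs) v w \<longleftrightarrow> padj xs v w"
proof (induction xs rule: induct_list012)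
  case (3 x y zs)
  have "padj (rev (y # zs) @ [x]) v w \<longleftrightarrow> padj (rev (y # zs)) v w \<or> padj [x] v w \<or>
     v = last (rev (y # zs)) \<and> w = hd [x] \<or> v = hd [x] \<and> w = last (rev (y # zs))"
    by (rule padj_append) auto
  then have "padj (rev (x # y # zs)) v w \<longleftrightarrow> padj (rev (y # zs)) v w \<or> v = y \<and> w = x \<or> v = x \<and> w = y"
    by (simp add: last_rev)
  then show ?case using 3 by auto
qed auto

lemma padj_imp_nth:
  "padj p v w \<Longrightarrow> \<exists>i. Suc i < length p \<and> (v = p ! i \<and> w = p ! Suc i \<or> v = p ! Suc i \<and> w = p ! i)"
proof (induction p v w rule: padj.induct)
  case (1 a b xs v w)
  show ?case
  proof (cases "padj (b # xs) v w")
    case True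
    from 1(1)[OF True] obtain i where i: "Suc i < length (b # xs)"
      "v = (b # xs) ! i \<and> w = (b # xs) ! Suc i \<or> v = (b # xs) ! Suc i \<and> w = (b # xs) ! i" by auto
    then show ?thesis by (intro exI[of _ "Suc i"]) simp
  next
    case False
    with 1(2) show ?thesis by (intro exI[of _ 0]) auto
  qed
qed auto

text \<open>A rotation keeps the head and replaces the path edge between \<open>x\<close> and
  \<open>hd B\<close> by the edge between \<open>last B\<close> and \<open>x\<close>;
  \<open>hd B\<close> becomes the new end.\<close>

inductive rotr :: "'a set set \<Rightarrow> 'a list \<Rightarrow> 'a list \<Rightarrow> bool" for E p where
  rot_refl: "rotr E p p"
| rot_step: "rotr E p (A @ x # B) \<Longrightarrow> B \<noteq> [] \<Longrightarrow> {last B, x} \<in> E \<Longrightarrow> rotr E p (A @ x # rev B)"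

lemma is_path_rev: "is_path E p \<Longrightarrow> is_path E (rev p)"
  by (auto simp: is_path_def insert_commute)

lemma rotr_path:
  assumes "rotr E p q" "is_path E p"
  shows "is_path E q \<and> set q = set p \<and> hd q = hd p \<and> length q = length p"
  using assms
proof induction
  case rot_refl then show ?case by simp
next
  case (rot_step A x B)
  then have q: "is_path E (A @ x # B)" "set (A @ x # B) = set p" "hd (A @ x # B) = hd p"
    "length (A @ x # B) = length p" by auto
  have s: "successively (\<lambda>a b. {a, b} \<in> E) (rev B)"
    using q(1) by (auto simp: is_path_def successively_append_iff successively_Cons insert_commute)
  have "is_path E (A @ x # rev B)"
    using q(1) s rot_step.hyps(2,3)
    by (auto simp: is_path_def successively_append_iff successively_Cons hd_rev insert_commute)
  moreover have "hd (A @ x # rev B) = hd p" using q(3) by (cases A) auto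
  ultimately show ?case using q by auto
qed

definition rends :: "'a set set \<Rightarrow> 'a list \<Rightarrow> 'a set" where
  "rends E p = {last q | q. rotr E p q}"

text \<open>A rotation changes path neighbours only at \<open>x\<close>, \<open>hd B\<close> and
  \<open>last B\<close>. The last two are ends of rotated paths, and \<open>x\<close> is at that
  moment a path neighbour of \<open>hd B\<close>. So a vertex that is neither an end nor, on
  \<open>p\<close>, next to an end keeps its neighbours through all rotations.\<close>

lemma padj_rotr:
  assumes "rotr E p q" "v \<notin> rends E p" "\<And>w. w \<in> rends E p \<Longrightarrow> \<not> padj p v w"
  shows "padj q v w \<longleftrightarrow> padj p v w"
  using assms
proof (induction arbitrary: w)
  case rot_refl then show ?case by simp
next
  case (rot_step A x B)
  have r1: "last B \<in> rends E p"
    using rot_step.hyps(1,2) unfolding rends_def by (auto intro!: exI[of _ "A @ x # B"])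
  have r2: "hd B \<in> rends E p"
    using rotr.rot_step[OF rot_step.hyps] rot_step.hyps(2) unfolding rends_def
    by (auto intro!: exI[of _ "A @ x # rev B"] simp: last_rev)
  have e1: "padj ((A @ [x]) @ B) v w \<longleftrightarrow> padj (A @ [x]) v w \<or> padj B v w \<or> v = x \<and> w = hd B \<or> v = hd B \<and> w = x" for w
    using padj_append[of "A @ [x]" B v w] rot_step.hyps(2) by simp
  have e2: "padj ((A @ [x]) @ rev B) v w \<longleftrightarrow> padj (A @ [x]) v w \<or> padj B v w \<or> v = x \<and> w = last B \<or> v = last B \<and> w = x" for w
    using padj_append[of "A @ [x]" "rev B" v w] rot_step.hyps(2) by (simp add: padj_rev hd_rev)
  have nx: "v \<noteq> x"
  proof
    assume "v = x"
    then have "padj ((A @ [x]) @ B) v (hd B)" using e1 by simp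
    then have "padj p v (hd B)" using rot_step.IH[OF rot_step.prems] by simp
    then show False using rot_step.prems(2) r2 by blast
  qed
  have "v \<noteq> hd B" "v \<noteq> last B" using r1 r2 rot_step.prems(1) by auto
  then have "padj ((A @ [x]) @ rev B) v w \<longleftrightarrow> padj ((A @ [x]) @ B) v w"
    using nx by (simp only: e1 e2) simp
  then show ?case using rot_step.IH[OF rot_step.prems] by simp
qed

text \<open>If \<open>v\<close> still had its original path neighbours, one more rotation along
  \<open>{u, v}\<close> would turn the current successor of \<open>v\<close>, which is also a
  neighbour of \<open>v\<close> on \<open>p\<close>, into an end.\<close>

lemma rends_neighbour:
  assumes p: "is_path E p" and u: "u \<in> rends E p" and e: "{u, v} \<in> E" and v: "v \<in> set p" "v \<notin> rends E p"
  shows "\<exists>w\<in>rends E p. padj p v w"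
proof (rule ccontr)
  assume c: "\<not> ?thesis"
  from u obtain q where q: "rotr E p q" "u = last q" unfolding rends_def by auto
  have "v \<in> set q" using rotr_path[OF q(1) p] v by simp
  then obtain A B where AB: "q = A @ v # B" by (meson split_list)
  have B: "B \<noteq> []"
  proof
    assume "B = []"
    then have "v = u" using AB q by simp
    then show False using u v by simp
  qed
  have "rotr E p (A @ v # rev B)"
    using q AB B e by (intro rotr.rot_step) auto
  then have h: "hd B \<in> rends E p" unfolding rends_def using B
    by (auto intro!: exI[of _ "A @ v # rev B"] simp: last_rev)
  have "padj ((A @ [v]) @ B) v (hd B)" using padj_append[of "A @ [v]" B v "hd B"] B by simp
  then have "padj q v (hd B)" using AB by simp
  then have "padj p v (hd B)" using padj_rotr[OF q(1) v(2)] c by blast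
  then show False using c h by blast
qed

text \<open>Each vertex has at most two path neighbours, and \<open>last p\<close> has no successor.
  That single missing neighbour makes the bound strict, which is what contradicts an expansion
  factor of exactly 2.\<close>

lemma card_padj_le:
  assumes "distinct p" "p \<noteq> []" "last p \<in> R" "R \<subseteq> set p"
  shows "card {v. \<exists>w\<in>R. padj p v w} < 2 * card R"
proof -
  define I where "I = {i. i < length p \<and> p ! i \<in> R}"
  have fI: "finite I" unfolding I_def by simp
  have img: "(\<lambda>i. p ! i) ` I = R" using assms(4) unfolding I_def by (force simp: in_set_conv_nth)
  have inj: "inj_on (\<lambda>i. p ! i) I" using assms(1) unfolding I_def by (auto simp: inj_on_def nth_eq_iff_index_eq)
  have cI: "card I = card R" using card_image[OF inj] img by simp
  have l: "length p - 1 \<in> I" using assms(2,3) unfolding I_def by (auto simp: last_conv_nth)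
  have sub: "{v. \<exists>w\<in>R. padj p v w} \<subseteq> (\<lambda>i. p ! (i - 1)) ` I \<union> (\<lambda>i. p ! Suc i) ` (I - {length p - 1})"
  proof
    fix v assume "v \<in> {v. \<exists>w\<in>R. padj p v w}"
    then obtain w where w: "w \<in> R" "padj p v w" by auto
    obtain i where i: "Suc i < length p" "v = p ! i \<and> w = p ! Suc i \<or> v = p ! Suc i \<and> w = p ! i"
      using padj_imp_nth[OF w(2)] by auto
    from i(2) show "v \<in> (\<lambda>i. p ! (i - 1)) ` I \<union> (\<lambda>i. p ! Suc i) ` (I - {length p - 1})"
    proof
      assume a: "v = p ! i \<and> w = p ! Suc i"
      then have "Suc i \<in> I" using w i unfolding I_def by auto
      then have "p ! (Suc i - 1) \<in> (\<lambda>i. p ! (i - 1)) ` I" by blast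
      then show ?thesis using a by simp
    next
      assume a: "v = p ! Suc i \<and> w = p ! i"
      then have "i \<in> I - {length p - 1}" using w i unfolding I_def by auto
      then show ?thesis using a by blast
    qed
  qed
  have "card {v. \<exists>w\<in>R. padj p v w} \<le> card ((\<lambda>i. p ! (i - 1)) ` I \<union> (\<lambda>i. p ! Suc i) ` (I - {length p - 1}))"
    using sub fI by (intro card_mono) auto
  also have "\<dots> \<le> card ((\<lambda>i. p ! (i - 1)) ` I) + card ((\<lambda>i. p ! Suc i) ` (I - {length p - 1}))"
    by (rule card_Un_le)
  also have "\<dots> \<le> card I + card (I - {length p - 1})"
    using fI by (intro add_mono card_image_le) auto
  also have "\<dots> < 2 * card I" using l fI card_Diff1_less[OF fI l] by simp
  finally show ?thesis using cI by simp
qed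

text \<open>Since \<open>p\<close> is longest, the neighbours of an end lie on the path, so outside
  the set of ends they are path neighbours of ends: fewer than twice the number of ends. Expansion
  excludes this for sets of size at most \<open>k\<close>.\<close>

lemma rends_large:
  assumes p: "is_path E p" and longest: "\<And>q. is_path E q \<Longrightarrow> length q \<le> length p"
    and pV: "set p \<subseteq> V" and ex: "expander V E k"
  shows "card (rends E p) > k"
proof (rule ccontr)
  assume "\<not> ?thesis"
  then have le: "card (rends E p) \<le> k" by simp
  have sub: "rends E p \<subseteq> set p"
    unfolding rends_def using rotr_path[OF _ p] by (force simp: is_path_def)
  have last: "last p \<in> rends E p" unfolding rends_def using rot_refl by blast
  have "nbh E (rends E p) \<subseteq> {v. \<exists>w\<in>rends E p. padj p v w}"
  proof
    fix v assume "v \<in> nbh E (rends E p)"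
    then obtain u where u: "u \<in> rends E p" "{u, v} \<in> E" "v \<notin> rends E p" unfolding nbh_def by auto
    obtain q where q: "rotr E p q" "u = last q" using u unfolding rends_def by auto
    have qq: "is_path E q" "set q = set p" "length q = length p" using rotr_path[OF q(1) p] by auto
    have "v \<in> set p"
    proof (rule ccontr)
      assume "v \<notin> set p"
      then have "is_path E (q @ [v])" using qq u(2) q(2)
        by (auto simp: is_path_def successively_append_iff)
      from longest[OF this] show False using qq by simp
    qed
    then show "v \<in> {v. \<exists>w\<in>rends E p. padj p v w}" using rends_neighbour[OF p u(1,2)] u(3) by auto
  qed
  moreover have "finite {v. \<exists>w\<in>rends E p. padj p v w}"
  proof (rule finite_subset)
    show "{v. \<exists>w\<in>rends E p. padj p v w} \<subseteq> set p" using padj_imp_nth by fastforce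
  qed simp
  ultimately have "card (nbh E (rends E p)) \<le> card {v. \<exists>w\<in>rends E p. padj p v w}" by (simp add: card_mono)
  also have "\<dots> < 2 * card (rends E p)"
    using p last sub by (intro card_padj_le) (auto simp: is_path_def)
  finally have "card (nbh E (rends E p)) < 2 * card (rends E p)" .
  moreover have "2 * card (rends E p) \<le> card (nbh E (rends E p))"
    using ex le last sub pV unfolding expander_def by blast
  ultimately show False by simp
qed

text \<open>Connectivity. If no edge crosses, a side with at least \<open>k\<close> vertices
  contains some \<open>k\<close>-set together with its \<open>2 * k\<close> neighbours, hence
  \<open>3 * k\<close> vertices. Two such sides exceed \<open>card V < 6 * k\<close>, and a nonempty
  side smaller than \<open>k\<close> would have an empty neighbourhood.\<close>

lemma expander_leaving_edge:
  assumes V: "finite V" "card V < 6 * k" and EV: "E \<subseteq> all_pairs V" and ex: "expander V E k"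
    and W: "W \<subset> V" "card W \<ge> k"
  shows "\<exists>x\<in>W. \<exists>y\<in>V - W. {x, y} \<in> E"
proof (rule ccontr)
  assume c: "\<not> ?thesis"
  have k: "k > 0" using V by (cases k) auto
  have inV: "nbh E S \<subseteq> V" for S
    using EV unfolding nbh_def all_pairs_def by (force simp: doubleton_eq_iff)
  have big: "3 * k \<le> card X" if X: "X = W \<or> X = V - W" "card X \<ge> k" for X
  proof -
    have fX: "finite X" using X V W by (auto intro: finite_subset)
    obtain S where S: "S \<subseteq> X" "card S = k" using obtain_subset_with_card_n[OF X(2)] by metis
    have SV: "S \<subseteq> V" using S(1) X(1) W(1) by blast
    have "S \<noteq> {}" using S k by auto
    then have "2 * k \<le> card (nbh E S)" using ex S(2) SV unfolding expander_def by auto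
    also have "\<dots> \<le> card (X - S)"
    proof (rule card_mono)
      show "nbh E S \<subseteq> X - S"
      proof
        fix w assume w: "w \<in> nbh E S"
        then obtain v where v: "v \<in> S" "{v, w} \<in> E" "w \<notin> S" unfolding nbh_def by auto
        have "w \<in> V" using w inV by auto
        then have "w \<in> X" using v S(1) X(1) c W(1) by (metis Diff_iff insert_commute subset_iff)
        then show "w \<in> X - S" using v by simp
      qed
    qed (use fX in auto)
    also have "\<dots> = card X - k" using S fX by (simp add: card_Diff_subset finite_subset)
    finally show ?thesis using X(2) by linarith
  qed
  have cW: "card (V - W) = card V - card W" using W(1) V(1) by (metis card_Diff_subset finite_subset psubset_imp_subset)
  have cWV: "card W \<le> card V" using W(1) V(1) by (metis card_mono psubset_imp_subset)
  show False
  proof (cases "card (V - W) \<ge> k")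
    case True
    from big[OF _ True] big[OF _ W(2)] have "3 * k \<le> card W" "3 * k \<le> card (V - W)" by auto
    then show False using cW cWV V(2) by linarith
  next
    case False
    have ne: "V - W \<noteq> {}" using W by auto
    then have "2 * card (V - W) \<le> card (nbh E (V - W))" using ex False unfolding expander_def by auto
    moreover have "nbh E (V - W) = {}"
    proof (rule ccontr)
      assume "nbh E (V - W) \<noteq> {}"
      then obtain v w where vw: "v \<in> V - W" "{v, w} \<in> E" "w \<notin> V - W" "w \<in> nbh E (V - W)"
        unfolding nbh_def by auto
      then have "w \<in> W" using inV by auto
      then show False using c vw by (metis insert_commute)
    qed
    moreover have "card (V - W) > 0" using ne V by (simp add: card_gt_0_iff)
    ultimately show False by simp
  qed
qed

text \<open>Length counts vertices. A one-vertex path is not confined to \<open>V\<close>, so there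
  may be infinitely many paths; the maximum is over their lengths, which are bounded.\<close>

definition longest_path :: "'a set set \<Rightarrow> nat" where
  "longest_path E = Max (length ` {p. is_path E p})"

lemma is_path_subset:
  assumes "E \<subseteq> all_pairs V" "is_path E p" "length p \<ge> 2"
  shows "set p \<subseteq> V"
proof
  fix v assume "v \<in> set p"
  then obtain i where i: "i < length p" "v = p ! i" by (auto simp: in_set_conv_nth)
  have s: "{p ! j, p ! Suc j} \<in> E" if "Suc j < length p" for j
    using assms(2) that by (auto simp: is_path_def successively_conv_nth)
  have sub: "e \<subseteq> V" if "e \<in> E" for e using assms(1) that unfolding all_pairs_def by auto
  show "v \<in> V"
  proof (cases "Suc i < length p")
    case True then show ?thesis using sub[OF s[OF True]] i by auto
  next
    case False
    then obtain j where "i = Suc j" using i assms(3) by (cases i) auto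
    then show ?thesis using sub[OF s[of j]] i by auto
  qed
qed

lemma path_length_le:
  assumes "finite V" "V \<noteq> {}" "E \<subseteq> all_pairs V" "is_path E p"
  shows "length p \<le> card V"
proof (cases "length p \<ge> 2")
  case True
  have "length p = card (set p)" using assms(4) by (simp add: is_path_def distinct_card)
  also have "\<dots> \<le> card V" using is_path_subset[OF assms(3,4) True] assms(1) by (rule card_mono[rotated])
  finally show ?thesis .
next
  case False
  moreover have "card V > 0" using assms by (simp add: card_gt_0_iff)
  ultimately show ?thesis by simp
qed

lemma longest_path_facts:
  assumes "finite V" "V \<noteq> {}" "E \<subseteq> all_pairs V"
  shows "is_path E p \<Longrightarrow> length p \<le> longest_path E"
    and "\<exists>p. is_path E p \<and> length p = longest_path E"
    and "longest_path E \<le> card V"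
proof -
  have fin: "finite (length ` {p. is_path E p})"
    by (rule finite_subset[of _ "{..card V}"]) (use path_length_le[OF assms] in auto)
  obtain v where "v \<in> V" using assms by auto
  then have ne: "length ` {p. is_path E p} \<noteq> {}" by (auto simp: is_path_def intro!: exI[of _ "[v]"])
  show "is_path E p \<Longrightarrow> length p \<le> longest_path E" unfolding longest_path_def using fin by (intro Max_ge) auto
  have "longest_path E \<in> length ` {p. is_path E p}" unfolding longest_path_def using fin ne by (rule Max_in)
  then show "\<exists>p. is_path E p \<and> length p = longest_path E" by auto
  then show "longest_path E \<le> card V" using path_length_le[OF assms] by metis
qed

section \<open>Effect of adding edges: monotonicity and boosters\<close>

lemma is_path_mono: "is_path E p \<Longrightarrow> E \<subseteq> E' \<Longrightarrow> is_path E' p"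
  unfolding is_path_def by (auto intro: successively_mono)

lemma ham_mono: "ham V E \<Longrightarrow> E \<subseteq> E' \<Longrightarrow> ham V E'"
  unfolding ham_def using is_path_mono by blast

lemma expander_mono:
  assumes "expander V E k" "E \<subseteq> E'" "E' \<subseteq> all_pairs V" "finite V"
  shows "expander V E' k"
  unfolding expander_def
proof (intro allI impI)
  fix S assume S: "S \<subseteq> V" "S \<noteq> {} \<and> card S \<le> k"
  have "nbh E' S \<subseteq> V"
    using assms(3) unfolding nbh_def all_pairs_def by (force simp: doubleton_eq_iff)
  then have "card (nbh E S) \<le> card (nbh E' S)"
    using assms(2) finite_subset[OF _ assms(4)] by (intro card_mono) (auto simp: nbh_def)
  then show "2 * card S \<le> card (nbh E' S)" using assms(1) S unfolding expander_def by (meson order_trans)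
qed

text \<open>A cycle through exactly the vertices of a longest path is Hamiltonian or, by connectivity,
  can be opened into a longer path.\<close>
lemma closing_longest_path:
  assumes V: "finite V" "card V < 6 * k" "E \<subseteq> all_pairs V" "expander V E k"
    and q: "is_path E q" "set q \<subseteq> V" "length q \<ge> 3" "card (set q) \<ge> k"
    and E': "E \<subseteq> E'" "{last q, hd q} \<in> E'"
  shows "ham V E' \<or> (\<exists>q'. is_path E' q' \<and> length q' = Suc (length q))"
proof (cases "set q = V")
  case True
  then show ?thesis using is_path_mono[OF q(1) E'(1)] q E' unfolding ham_def by blast
next
  case False
  then obtain x y where xy: "x \<in> set q" "y \<in> V - set q" "{x, y} \<in> E"
    using expander_leaving_edge[OF V, of "set q"] q by blast
  obtain A B where AB: "q = A @ x # B" using xy(1) by (meson split_list)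
  have "is_path E' q" using is_path_mono q E' by blast
  moreover have "{x, y} \<in> E'" using xy E' by auto
  ultimately have "is_path E' (y # x # B @ A)"
    using AB xy(2) E'(2)
    by (cases A; cases "B = []")
      (auto simp: is_path_def successively_append_iff successively_Cons insert_commute hd_append split: if_splits)
  then show ?thesis using AB by (intro disjI2 exI[of _ "y # x # B @ A"]) auto
qed

lemma card_doubleton_le: "card {a, b} \<le> 2"
  using card_length[of "[a, b]"] by simp

lemma card_doubletons_ge:
  assumes "finite O'"
  shows "card O' \<le> 2 * card ((\<lambda>(u, w). {u, w}) ` O')"
proof -
  let ?I = "(\<lambda>(u, w). {u, w}) ` O'"
  have "card O' = card (\<Union>e\<in>?I. {z \<in> O'. (\<lambda>(u, w). {u, w}) z = e})"
    by (rule arg_cong[where f = card]) auto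
  also have "\<dots> \<le> (\<Sum>e\<in>?I. card {z \<in> O'. (\<lambda>(u, w). {u, w}) z = e})"
    using assms by (intro card_UN_le) auto
  also have "\<dots> \<le> (\<Sum>e\<in>?I. 2)"
  proof (rule sum_mono)
    fix e assume "e \<in> ?I"
    then have "\<exists>z\<in>O'. e = {fst z, snd z}" by (simp add: image_iff case_prod_beta)
    then obtain u w where e: "e = {u, w}" by blast
    have "{z \<in> O'. (\<lambda>(u, w). {u, w}) z = e} \<subseteq> {(u, w), (w, u)}"
    proof
      fix z assume z: "z \<in> {z \<in> O'. (\<lambda>(u, w). {u, w}) z = e}"
      obtain a b where ab: "z = (a, b)" by (cases z)
      have "{a, b} = {u, w}" using z unfolding ab e by simp
      then show "z \<in> {(u, w), (w, u)}" unfolding ab doubleton_eq_iff by blast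
    qed
    then have "card {z \<in> O'. (\<lambda>(u, w). {u, w}) z = e} \<le> card {(u, w), (w, u)}"
      by (rule card_mono[rotated]) simp
    also have "\<dots> \<le> 2" by (rule card_doubleton_le)
    finally show "card {z \<in> O'. (\<lambda>(u, w). {u, w}) z = e} \<le> 2" .
  qed
  finally show ?thesis by simp
qed

definition boosters :: "'a set \<Rightarrow> 'a set set \<Rightarrow> 'a set set" where
  "boosters V E = {e \<in> all_pairs V - E. ham V (insert e E) \<or> longest_path (insert e E) > longest_path E}"

text \<open>A longest path has more than \<open>k\<close> rotation ends \<open>u\<close>. Reversing
  the path that ends in \<open>u\<close> makes \<open>u\<close> the fixed head, and rotating again
  yields more than \<open>k\<close> ends \<open>w\<close>. Each \<open>{u, w}\<close> closes a
  longest path into a cycle and is therefore a booster; an unordered pair arises from at most two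
  ordered ones.\<close>

lemma many_boosters:
  assumes V: "finite V" "card V < 6 * k" "E \<subseteq> all_pairs V" "expander V E k"
    and V0: "V \<noteq> {}" and k: "k \<ge> 2" and nh: "\<not> ham V E"
  shows "(Suc k)\<^sup>2 \<le> 2 * card (boosters V E)"
proof -
  note lf = longest_path_facts[OF V(1) V0]
  obtain p where p: "is_path E p" "length p = longest_path E" using lf(2)[OF V(3)] by auto
  have long: "length q \<le> longest_path E" if "is_path E q" for q using lf(1)[OF V(3) that] .
  have l2: "length q \<ge> 3 \<and> set q \<subseteq> V \<and> card (rends E q) > k" if q: "is_path E q" "length q = longest_path E" for q
  proof -
    obtain v where v: "v \<in> V" using V0 by auto
    have "2 * card {v} \<le> card (nbh E {v})"
      using V(4)[unfolded expander_def, rule_format, of "{v}"] v k by simp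
    then have "nbh E {v} \<noteq> {}" by auto
    then obtain w where "w \<noteq> v" "{v, w} \<in> E" unfolding nbh_def by auto
    then have "is_path E [v, w]" by (auto simp: is_path_def)
    from long[OF this] have "length q \<ge> 2" using q by simp
    then have sq: "set q \<subseteq> V" using is_path_subset[OF V(3) q(1)] by simp
    have r: "card (rends E q) > k" using rends_large[OF q(1) _ sq V(4)] long q(2) by simp
    have "rends E q \<subseteq> set q"
      unfolding rends_def using rotr_path[OF _ q(1)] by (force simp: is_path_def)
    then have "card (rends E q) \<le> card (set q)" by (intro card_mono) auto
    also have "\<dots> \<le> length q" by (rule card_length)
    finally show ?thesis using r k sq by simp
  qed
  define Q where "Q u = (SOME q. rotr E p q \<and> last q = u)" for u
  have Q: "rotr E p (Q u) \<and> last (Q u) = u" if "u \<in> rends E p" for u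
    unfolding Q_def by (rule someI_ex) (use that in \<open>auto simp: rends_def\<close>)
  define O' where "O' = Sigma (rends E p) (\<lambda>u. rends E (rev (Q u)))"
  have Qp: "is_path E (rev (Q u)) \<and> length (rev (Q u)) = longest_path E \<and> hd (rev (Q u)) = u"
    if "u \<in> rends E p" for u
    using Q[OF that] rotr_path[OF _ p(1)] p(2) is_path_rev by (metis hd_rev length_rev)
  have rfin: "finite (rends E q)" if "is_path E q" for q
    by (rule finite_subset[of _ "set q"]) (use rotr_path[OF _ that] in \<open>force simp: rends_def is_path_def\<close>)+
  have O: "{u, w} \<in> boosters V E" if uw: "(u, w) \<in> O'" for u w
  proof -
    have u: "u \<in> rends E p" and w: "w \<in> rends E (rev (Q u))" using uw unfolding O'_def by auto
    obtain q where q: "rotr E (rev (Q u)) q" "w = last q" using w unfolding rends_def by auto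
    have qp: "is_path E q" "length q = longest_path E" "hd q = u"
      using rotr_path[OF q(1)] Qp[OF u] by auto
    note q3 = l2[OF qp(1,2)]
    have rs: "rends E q \<subseteq> set q"
      unfolding rends_def using rotr_path[OF _ qp(1)] by (force simp: is_path_def)
    have ck: "card (set q) \<ge> k" using q3 card_mono[OF finite_set rs] by linarith
    have qne: "q \<noteq> []" "distinct q" using qp(1) unfolding is_path_def by auto
    have uV: "u \<in> V" "w \<in> V" using q3 qp(3) q(2) hd_in_set[OF qne(1)] last_in_set[OF qne(1)] by auto
    have ne: "u \<noteq> w"
    proof -
      obtain a b r where "q = a # b # r" using q3
        by (metis One_nat_def Suc_1 Suc_le_length_iff numeral_3_eq_3)
      then show ?thesis using qne(2) qp(3) q(2) by auto
    qed
    have cl: "ham V E' \<or> (\<exists>q'. is_path E' q' \<and> length q' = Suc (length q))" if "E \<subseteq> E'" "{u, w} \<in> E'" for E'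
      using closing_longest_path[OF V qp(1) _ _ ck that(1)] q3 that(2) qp(3) q(2) by (simp add: insert_commute)
    have "{u, w} \<notin> E"
    proof
      assume "{u, w} \<in> E"
      from cl[OF subset_refl this] nh obtain q' where q': "is_path E q'" "length q' = Suc (length q)" by blast
      from long[OF q'(1)] q'(2) qp(2) show False by simp
    qed
    moreover have ap: "{u, w} \<in> all_pairs V" unfolding all_pairs_def using uV ne by auto
    moreover have "ham V (insert {u, w} E) \<or> longest_path (insert {u, w} E) > longest_path E"
    proof -
      have "insert {u, w} E \<subseteq> all_pairs V" using ap V(3) by simp
      note l1 = lf(1)[OF this]
      have "ham V (insert {u, w} E) \<or> (\<exists>q'. is_path (insert {u, w} E) q' \<and> length q' = Suc (length q))"
        by (rule cl) auto
      then show ?thesis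
      proof
        assume "\<exists>q'. is_path (insert {u, w} E) q' \<and> length q' = Suc (length q)"
        then obtain q' where "is_path (insert {u, w} E) q'" "length q' = Suc (length q)" by blast
        with l1[of q'] qp(2) show ?thesis by simp
      qed simp
    qed
    ultimately show ?thesis unfolding boosters_def by simp
  qed
  have finO: "finite O'" unfolding O'_def using rfin p(1) Qp by (intro finite_SigmaI) auto
  have "(Suc k)\<^sup>2 = Suc k * Suc k" by (simp add: power2_eq_square)
  also have "\<dots> \<le> card (rends E p) * Suc k" using l2[OF p] by (intro mult_right_mono) auto
  also have "\<dots> = (\<Sum>u\<in>rends E p. Suc k)" by simp
  also have "\<dots> \<le> (\<Sum>u\<in>rends E p. card (rends E (rev (Q u))))"
  proof (rule sum_mono)
    fix u assume "u \<in> rends E p"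
    then show "Suc k \<le> card (rends E (rev (Q u)))" using l2[of "rev (Q u)"] Qp by auto
  qed
  also have "\<dots> = card O'" unfolding O'_def using rfin p(1) Qp by (subst card_SigmaI) auto
  also have "\<dots> \<le> 2 * card ((\<lambda>(u, w). {u, w}) ` O')" by (rule card_doubletons_ge[OF finO])
  also have "\<dots> \<le> 2 * card (boosters V E)"
  proof -
    have "finite (all_pairs V)" unfolding all_pairs_def
      by (rule finite_subset[of _ "Pow V"]) (use V(1) in auto)
    then have "finite (boosters V E)" unfolding boosters_def by simp
    moreover have "(\<lambda>(u, w). {u, w}) ` O' \<subseteq> boosters V E" using O by auto
    ultimately show ?thesis by (simp add: card_mono)
  qed
  finally show ?thesis .
qed

text \<open>Adding boosters one at a time: a set \<open>F\<close> of already added edges that is maximal with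
  respect to the longest path leaves no further booster in \<open>X\<close>.\<close>
lemma not_ham_obtain_boosterless:
  assumes V: "finite V" "V \<noteq> {}" "E \<subseteq> all_pairs V" "X \<subseteq> all_pairs V" and nh: "\<not> ham V (E \<union> X)"
  shows "\<exists>F\<subseteq>X. card F \<le> card V \<and> \<not> ham V (E \<union> F) \<and> boosters V (E \<union> F) \<inter> X = {}"
proof -
  have finX: "finite X"
    by (rule finite_subset[OF V(4)], unfold all_pairs_def, rule finite_subset[of _ "Pow V"]) (use V(1) in auto)
  have sub: "E \<union> F \<subseteq> all_pairs V" if "F \<subseteq> X" for F using that V by auto
  note lf = longest_path_facts[OF V(1,2)]
  \<comment> \<open>The condition records that every added edge has paid for itself by lengthening a
    longest path. It bounds \<open>card F\<close> by \<open>card V\<close> and is preserved when a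
    booster is added.\<close>
  define \<F> where "\<F> = {F. F \<subseteq> X \<and> card F \<le> longest_path (E \<union> F)}"
  have "finite \<F>" unfolding \<F>_def by (rule finite_subset[of _ "Pow X"]) (use finX in auto)
  moreover have "{} \<in> \<F>" unfolding \<F>_def by simp
  ultimately obtain F where F: "F \<in> \<F>" "\<And>F'. F' \<in> \<F> \<Longrightarrow> longest_path (E \<union> F') \<le> longest_path (E \<union> F)"
  proof -
    assume fin: "finite \<F>" and ne: "{} \<in> \<F>"
      and th: "\<And>F. F \<in> \<F> \<Longrightarrow> (\<And>F'. F' \<in> \<F> \<Longrightarrow> longest_path (E \<union> F') \<le> longest_path (E \<union> F)) \<Longrightarrow> thesis"
    let ?M = "(\<lambda>F. longest_path (E \<union> F)) ` \<F>"
    have "Max ?M \<in> ?M" using fin ne by (intro Max_in) auto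
    then obtain F where "F \<in> \<F>" "longest_path (E \<union> F) = Max ?M" by auto
    then show thesis using th[of F] fin by auto
  qed
  have FX: "F \<subseteq> X" "card F \<le> longest_path (E \<union> F)" using F unfolding \<F>_def by auto
  have nhF: "\<not> ham V (E \<union> F)" using nh ham_mono[of V "E \<union> F" "E \<union> X"] FX(1) by blast
  have "boosters V (E \<union> F) \<inter> X = {}"
  proof (rule ccontr)
    assume "\<not> ?thesis"
    then obtain e where e: "e \<in> boosters V (E \<union> F)" "e \<in> X" by auto
    have "\<not> ham V (insert e (E \<union> F))" 
      using nh ham_mono[of V "insert e (E \<union> F)" "E \<union> X"] FX(1) e(2) by blast
    then have lt: "longest_path (E \<union> insert e F) > longest_path (E \<union> F)" using e unfolding boosters_def by simp
    have "card (insert e F) \<le> Suc (card F)" by (rule card_insert_le_m1) auto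
    then have "insert e F \<in> \<F>" unfolding \<F>_def using FX e lt by auto
    from F(2)[OF this] lt show False by simp
  qed
  moreover have "card F \<le> card V" using FX lf(3)[OF sub[OF FX(1)]] by simp
  ultimately show ?thesis using FX nhF by blast
qed

section \<open>McDiarmid's colour coupling\<close>

lemma prob_bind_pmf:
  "prob (bind_pmf M f) A = measure_pmf.expectation M (\<lambda>x. prob (f x) A)"
proof -
  have "ennreal (prob (bind_pmf M f) A) = (\<integral>\<^sup>+x. ennreal (prob (f x) A) \<partial>measure_pmf M)"
    by (simp add: emeasure_bind_pmf flip: measure_pmf.emeasure_eq_measure)
  also have "\<dots> = ennreal (measure_pmf.expectation M (\<lambda>x. prob (f x) A))"
    by (intro nn_integral_eq_integral measure_pmf.integrable_const_bound[where B = 1]) auto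
  finally show ?thesis by (simp add: integral_nonneg_AE)
qed

lemma integrable_prob_pmf: "integrable (measure_pmf M) (\<lambda>x. prob (f x) (A x))"
  by (intro measure_pmf.integrable_const_bound[where B = 1]) auto

lemma prob_bind_mono:
  assumes "\<And>x. x \<in> set_pmf M \<Longrightarrow> prob (f x) A \<le> prob (g x) B"
  shows "prob (bind_pmf M f) A \<le> prob (bind_pmf M g) B"
  unfolding prob_bind_pmf
  by (intro integral_mono_AE integrable_prob_pmf) (use assms in \<open>auto simp: AE_measure_pmf_iff\<close>)

lemma prob_bind_le:
  assumes "\<And>x. x \<in> set_pmf M \<Longrightarrow> prob (f x) A \<le> \<rho>"
  shows "prob (bind_pmf M f) A \<le> \<rho>"
proof -
  have "measure_pmf.expectation M (\<lambda>x. prob (f x) A) \<le> measure_pmf.expectation M (\<lambda>x. \<rho>)"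
    by (intro integral_mono_AE integrable_prob_pmf) (use assms in \<open>auto simp: AE_measure_pmf_iff\<close>)
  then show ?thesis unfolding prob_bind_pmf by simp
qed

lemma prob_bind_ge:
  assumes "\<And>x. x \<in> set_pmf M \<Longrightarrow> \<rho> \<le> prob (f x) A"
  shows "\<rho> \<le> prob (bind_pmf M f) A"
proof -
  have "measure_pmf.expectation M (\<lambda>x. \<rho>) \<le> measure_pmf.expectation M (\<lambda>x. prob (f x) A)"
    by (intro integral_mono_AE integrable_prob_pmf) (use assms in \<open>auto simp: AE_measure_pmf_iff\<close>)
  then show ?thesis unfolding prob_bind_pmf by simp
qed

lemma prob_bind_le_add:
  assumes "\<And>x. x \<in> set_pmf M \<Longrightarrow> x \<notin> Bad \<Longrightarrow> prob (f x) A \<le> \<rho>" "0 \<le> \<rho>"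
  shows "prob (bind_pmf M f) A \<le> prob M Bad + \<rho>"
proof -
  have "measure_pmf.expectation M (\<lambda>x. prob (f x) A) \<le>
      measure_pmf.expectation M (\<lambda>x. indicator Bad x + \<rho>)"
  proof (intro integral_mono_AE integrable_prob_pmf)
    show "AE x in measure_pmf M. prob (f x) A \<le> indicator Bad x + \<rho>"
      unfolding AE_measure_pmf_iff
    proof
      fix x assume "x \<in> set_pmf M"
      then show "prob (f x) A \<le> indicator Bad x + \<rho>"
        using assms order_trans[OF measure_pmf.prob_le_1[of "f x" A], of "1 + \<rho>"] by (cases "x \<in> Bad") auto
    qed
    show "integrable (measure_pmf M) (\<lambda>x. indicator Bad x + \<rho>)"
      by (intro measure_pmf.integrable_const_bound[where B = "1 + \<rho>"]) (use assms(2) in \<open>auto simp: indicator_def\<close>)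
  qed
  also have "\<dots> = prob M Bad + \<rho>"
  proof -
    have "integrable (measure_pmf M) (indicator Bad :: _ \<Rightarrow> real)"
      by (intro measure_pmf.integrable_const_bound[where B = 1]) (auto simp: indicator_def)
    then show ?thesis by (subst Bochner_Integration.integral_add) auto
  qed
  finally show ?thesis unfolding prob_bind_pmf .
qed

section \<open>The law of a single coloured edge\<close>

lemma pmf_edge_pmf:
  assumes "0 \<le> r" "r \<le> 1"
  shows "pmf (edge_pmf r c) x = r * pmf (map_pmf Some (pmf_of_set {1..c})) x + (1 - r) * pmf (return_pmf None) x"
  unfolding edge_pmf_def using assms by (simp add: pmf_bind)

lemma prob_edge_pmf_Some:
  assumes "0 \<le> r" "r \<le> 1" "c > 0" "K \<subseteq> {1..c}"
  shows "prob (edge_pmf r c) (Some ` K) = r * card K / c"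
proof -
  have fin: "finite K" using assms(4) by (rule finite_subset) simp
  have "pmf (edge_pmf r c) (Some k) = r / c" if "k \<in> K" for k
  proof -
    have "pmf (map_pmf Some (pmf_of_set {1..c})) (Some k) = 1 / c"
      using assms that by (subst pmf_map_inj') (auto simp: pmf_of_set)
    then show ?thesis using assms by (simp add: pmf_edge_pmf)
  qed
  moreover have "prob (edge_pmf r c) (Some ` K) = (\<Sum>x\<in>Some ` K. pmf (edge_pmf r c) x)"
    using fin by (intro measure_measure_pmf_finite) auto
  ultimately show ?thesis by (subst (asm) sum.reindex) auto
qed

text \<open>Two-round exposure of one edge: a first-round edge is certainly present, a first-round
  non-edge gets a second chance \<open>r\<close>. Since \<open>edge_pmf\<close> is affine in its
  density, only the total weight of \<open>None\<close> has to agree.\<close>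

lemma edge_pmf_mixture:
  assumes "0 \<le> p" "p \<le> 1" "0 \<le> r" "r \<le> 1" "prob tp {None} = 1 - p1"
    and "(1 - p1) * (1 - r) = 1 - p" "0 \<le> p1" "p1 \<le> 1"
  shows "edge_pmf p c = bind_pmf tp (\<lambda>t. edge_pmf (if t = None then r else 1) c)"
proof (rule pmf_eqI)
  fix x
  let ?u = "pmf (map_pmf Some (pmf_of_set {1..c})) x" and ?v = "pmf (return_pmf None) x :: real"
  have "pmf (bind_pmf tp (\<lambda>t. edge_pmf (if t = None then r else 1) c)) x =
      measure_pmf.expectation tp (\<lambda>t. ?u + indicator {None} t * ((1 - r) * (?v - ?u)))"
    unfolding pmf_bind using assms
    by (intro Bochner_Integration.integral_cong refl) (auto simp: pmf_edge_pmf indicator_def algebra_simps)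
  also have "\<dots> = ?u + (1 - p1) * ((1 - r) * (?v - ?u))"
  proof -
    have "integrable (measure_pmf tp) (\<lambda>t. indicator {None} t * d)" for d :: real
      by (intro measure_pmf.integrable_const_bound[where B = "\<bar>d\<bar>"]) (auto simp: indicator_def)
    then show ?thesis using assms(5) by (subst Bochner_Integration.integral_add) auto
  qed
  also have "\<dots> = ?u + (1 - p) * (?v - ?u)" using assms(6) by (metis mult.assoc)
  also have "\<dots> = pmf (edge_pmf p c) x" using assms by (simp add: pmf_edge_pmf algebra_simps)
  finally show "pmf (edge_pmf p c) x = pmf (bind_pmf tp (\<lambda>t. edge_pmf (if t = None then r else 1) c)) x" by (rule sym)
qed

text \<open>Interpolates between the coloured and the thinned graph: visible edges need distinct
  colours, hidden ones need only survive. For the Hamilton cycles and \<open>hid = {}\<close> it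
  says that a rainbow Hamilton cycle exists.\<close>

definition hybrid :: "'a set set \<Rightarrow> 'a set \<Rightarrow> ('a \<Rightarrow> nat option) \<Rightarrow> ('a \<Rightarrow> bool) \<Rightarrow> bool" where
  "hybrid \<C> hid G y \<longleftrightarrow>
     (\<exists>C\<in>\<C>. (\<forall>e\<in>C - hid. G e \<noteq> None) \<and> inj_on G (C - hid) \<and> (\<forall>e\<in>C \<inter> hid. y e))"

lemma hybrid_upd_hidden: "e \<in> hid \<Longrightarrow> hybrid \<C> hid (G(e := g)) y \<longleftrightarrow> hybrid \<C> hid G y"
proof -
  assume e: "e \<in> hid"
  have "inj_on (G(e := g)) (C - hid) = inj_on G (C - hid)" for C
    using e by (intro inj_on_cong) auto
  then show ?thesis using e unfolding hybrid_def by (intro bex_cong refl) auto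
qed

lemma hybrid_upd_visible: "e \<notin> hid \<Longrightarrow> hybrid \<C> hid G (y(e := b)) \<longleftrightarrow> hybrid \<C> hid G y"
  unfolding hybrid_def by (intro bex_cong refl) auto

text \<open>With everything fixed except the data at \<open>e\<close>, either some \<open>C\<close>
  works without \<open>e\<close>, or some \<open>C\<close> works but only with the help of
  \<open>e\<close>, or none does. Only the middle case matters: on the left the bit must be true, on
  the right it suffices that \<open>e\<close> is present and avoids the at most \<open>N - 1\<close>
  colours on the visible rest of one chosen \<open>C0\<close>.\<close>

lemma hybrid_step:
  assumes e: "e \<notin> hid" and C: "\<And>C. C \<in> \<C> \<Longrightarrow> finite C \<and> card C \<le> N"
    and c: "c > 0" and r: "0 \<le> r" "r \<le> 1" and q: "0 \<le> q" "q \<le> 1" "q \<le> r * (1 - (real N - 1) / c)"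
  shows "prob (bernoulli_pmf q) {b. hybrid \<C> (insert e hid) G (y(e := b))} \<le>
    prob (edge_pmf r c) {g. hybrid \<C> hid (G(e := g)) y}"
proof -
  define ok where "ok C \<longleftrightarrow> (\<forall>e'\<in>C - insert e hid. G e' \<noteq> None) \<and> inj_on G (C - insert e hid) \<and> (\<forall>e'\<in>C \<inter> hid. y e')" for C
  consider (1) "\<exists>C\<in>\<C>. e \<notin> C \<and> ok C" | (2) "\<not> (\<exists>C\<in>\<C>. e \<notin> C \<and> ok C)" "\<exists>C\<in>\<C>. e \<in> C \<and> ok C" | (3) "\<not> (\<exists>C\<in>\<C>. ok C)" by blast
  then show ?thesis
  proof cases
    case 1
    then obtain C where C1: "C \<in> \<C>" "e \<notin> C" "ok C" by auto
    have eq: "C - insert e hid = C - hid" using C1 by auto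
    have "inj_on (G(e := g)) (C - hid)" for g
      using C1(3) unfolding ok_def eq by (subst inj_on_cong[of _ _ G]) (use C1(2) in auto)
    then have "hybrid \<C> hid (G(e := g)) y" for g
      unfolding hybrid_def using C1 unfolding ok_def eq by (intro bexI[of _ C]) auto
    then have "{g. hybrid \<C> hid (G(e := g)) y} = UNIV" by auto
    then show ?thesis by simp
  next
    case 2
    then obtain C0 where C0: "C0 \<in> \<C>" "e \<in> C0" "ok C0" by auto
    have sub: "{b. hybrid \<C> (insert e hid) G (y(e := b))} \<subseteq> {True}"
    proof
      fix b assume "b \<in> {b. hybrid \<C> (insert e hid) G (y(e := b))}"
      then obtain C1 where C1: "C1 \<in> \<C>" "\<forall>e'\<in>C1 - insert e hid. G e' \<noteq> None"
        "inj_on G (C1 - insert e hid)" "\<forall>e'\<in>C1 \<inter> insert e hid. (y(e := b)) e'" unfolding hybrid_def by auto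
      have "ok C1" unfolding ok_def using C1 e by (metis Int_iff fun_upd_other insertCI)
      then have "e \<in> C1" using 2 C1 by auto
      then show "b \<in> {True}" using C1(4) by auto
    qed
    define U where "U = {k \<in> {1..c}. Some k \<notin> G ` (C0 - insert e hid)}"
    have sub2: "Some ` U \<subseteq> {g. hybrid \<C> hid (G(e := g)) y}"
    proof
      fix g assume "g \<in> Some ` U"
      then have g: "g \<noteq> None" "g \<notin> G ` (C0 - insert e hid)" unfolding U_def by auto
      have eq: "C0 - hid = insert e (C0 - insert e hid)" using C0 e by auto
      have "inj_on (G(e := g)) (C0 - insert e hid)"
        by (subst inj_on_cong[of _ _ G]) (use C0(3) in \<open>auto simp: ok_def\<close>)
      moreover have "(G(e := g)) ` (C0 - insert e hid) = G ` (C0 - insert e hid)" by (intro image_cong) auto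
      ultimately have "inj_on (G(e := g)) (C0 - hid)" unfolding eq using g(2) by (subst inj_on_insert) auto
      moreover have "\<forall>e'\<in>C0 - hid. (G(e := g)) e' \<noteq> None" using C0(3) g(1) unfolding ok_def by auto
      ultimately show "g \<in> {g. hybrid \<C> hid (G(e := g)) y}" unfolding hybrid_def using C0 unfolding ok_def by blast
    qed
    have cU: "real c - (real N - 1) \<le> real (card U)"
    proof -
      let ?D = "C0 - insert e hid"
      have fC: "finite C0" "card C0 \<le> N" using C[OF C0(1)] by auto
      have "card ?D \<le> card (C0 - {e})" using fC by (intro card_mono) auto
      also have "\<dots> = card C0 - 1" using C0 fC by simp
      finally have D: "card ?D \<le> N - 1" using fC by simp
      have N1: "N \<ge> 1" using fC C0 by (metis One_nat_def Suc_leI card_gt_0_iff empty_iff less_le_trans)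
      have "U = {1..c} - {k. Some k \<in> G ` ?D}" unfolding U_def by auto
      moreover have fin: "finite {k. Some k \<in> G ` ?D}"
        using finite_vimageI[of "G ` ?D" Some] fC by (simp add: vimage_def)
      moreover have "card {k. Some k \<in> G ` ?D} \<le> card (G ` ?D)"
        using fC by (intro card_inj_on_le[of Some]) auto
      moreover have "card (G ` ?D) \<le> card ?D" using fC by (intro card_image_le) auto
      ultimately have "card U \<ge> c - (N - 1)" using D diff_card_le_card_Diff[OF fin, of "{1..c}"] by simp
      then show ?thesis using N1 by linarith
    qed
    have "prob (bernoulli_pmf q) {b. hybrid \<C> (insert e hid) G (y(e := b))} \<le>
        prob (bernoulli_pmf q) {True}" using sub by (intro measure_pmf.finite_measure_mono) auto
    also have "\<dots> = q" using q by (simp add: measure_pmf_single)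
    also have "\<dots> \<le> r * (1 - (real N - 1) / c)" by (rule q(3))
    also have "\<dots> \<le> r * card U / c" 
    proof -
      have "1 - (real N - 1) / c \<le> card U / c" using cU c by (simp add: divide_simps)
      from mult_left_mono[OF this r(1)] show ?thesis by simp
    qed
    also have "\<dots> = prob (edge_pmf r c) (Some ` U)"
      by (rule prob_edge_pmf_Some[symmetric]) (use r c in \<open>auto simp: U_def\<close>)
    also have "\<dots> \<le> prob (edge_pmf r c) {g. hybrid \<C> hid (G(e := g)) y}"
      using sub2 by (intro measure_pmf.finite_measure_mono) auto
    finally show ?thesis .
  next
    case 3
    have "\<not> hybrid \<C> (insert e hid) G (y(e := b))" for b
    proof
      assume "hybrid \<C> (insert e hid) G (y(e := b))"
      then obtain C1 where C1: "C1 \<in> \<C>" "\<forall>e'\<in>C1 - insert e hid. G e' \<noteq> None"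
        "inj_on G (C1 - insert e hid)" "\<forall>e'\<in>C1 \<inter> insert e hid. (y(e := b)) e'" unfolding hybrid_def by auto
      have "ok C1" unfolding ok_def using C1 e by (metis Int_iff fun_upd_other insertCI)
      then show False using 3 C1 by auto
    qed
    then show ?thesis by simp
  qed
qed

text \<open>McDiarmid's coupling: the colours of the hidden edges are traded, one edge at a time,
  for independent survival bits.  Given everything else, an edge needed by some \<open>C\<close> works with
  probability at least \<open>r (1 - (N - 1) / c)\<close>, since at most \<open>N - 1\<close> colours are forbidden.\<close>
lemma hybrid_mono_hidden:
  assumes P: "finite P" and hid: "finite hid" "hid \<subseteq> P"
    and C: "\<And>C. C \<in> \<C> \<Longrightarrow> finite C \<and> card C \<le> N"
    and c: "c > 0" and r: "\<And>e. 0 \<le> r e \<and> r e \<le> 1"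
    and q: "\<And>e. 0 \<le> q e \<and> q e \<le> 1 \<and> q e \<le> r e * (1 - (real N - 1) / c)"
  shows "prob (pair_pmf (Pi_pmf P None (\<lambda>e. edge_pmf (r e) c)) (Pi_pmf P False (\<lambda>e. bernoulli_pmf (q e))))
      {(G, y). hybrid \<C> hid G y} \<le>
    prob (Pi_pmf P None (\<lambda>e. edge_pmf (r e) c)) {G. hybrid \<C> {} G (\<lambda>_. False)}"
    (is "prob (pair_pmf ?M ?Y) _ \<le> _")
  using hid
proof (induction hid rule: finite_induct)
  case empty
  have "{(G, y). hybrid \<C> {} G y} = fst -` {G. hybrid \<C> {} G (\<lambda>_. False)}"
  proof (rule set_eqI)
    fix z :: "('a \<Rightarrow> nat option) \<times> ('a \<Rightarrow> bool)"
    have "hybrid \<C> {} (fst z) (snd z) = hybrid \<C> {} (fst z) (\<lambda>_. False)" unfolding hybrid_def by simp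
    then show "z \<in> {(G, y). hybrid \<C> {} G y} \<longleftrightarrow> z \<in> fst -` {G. hybrid \<C> {} G (\<lambda>_. False)}"
      by (simp add: case_prod_unfold)
  qed
  then have "prob (pair_pmf ?M ?Y) {(G, y). hybrid \<C> {} G y} =
     prob (map_pmf fst (pair_pmf ?M ?Y)) {G. hybrid \<C> {} G (\<lambda>_. False)}"
    unfolding measure_map_pmf by simp
  then show ?case by (simp add: map_fst_pair_pmf)
next
  case (insert e hid)
  define P' where "P' = P - {e}"
  have P': "finite P'" "e \<notin> P'" "P = insert e P'" using P insert.prems unfolding P'_def by auto
  define M' where "M' = Pi_pmf P' None (\<lambda>e. edge_pmf (r e) c)"
  define Y' where "Y' = Pi_pmf P' False (\<lambda>e. bernoulli_pmf (q e))"
  define In where "In G y = do {g \<leftarrow> edge_pmf (r e) c; b \<leftarrow> bernoulli_pmf (q e); return_pmf (G(e := g), y(e := b))}" for G y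
  have pair: "pair_pmf ?M ?Y = do {G \<leftarrow> M'; y \<leftarrow> Y'; In G y}"
  proof -
    have "pair_pmf ?M ?Y = do {g \<leftarrow> edge_pmf (r e) c; G \<leftarrow> M'; b \<leftarrow> bernoulli_pmf (q e); y \<leftarrow> Y'; return_pmf (G(e := g), y(e := b))}"
      unfolding P'(3) Pi_pmf_insert'[OF P'(1,2)] pair_pmf_def M'_def Y'_def
      by (simp add: bind_assoc_pmf bind_return_pmf)
    also have "\<dots> = do {G \<leftarrow> M'; g \<leftarrow> edge_pmf (r e) c; b \<leftarrow> bernoulli_pmf (q e); y \<leftarrow> Y'; return_pmf (G(e := g), y(e := b))}"
      by (subst bind_commute_pmf) simp
    also have "\<dots> = do {G \<leftarrow> M'; g \<leftarrow> edge_pmf (r e) c; y \<leftarrow> Y'; b \<leftarrow> bernoulli_pmf (q e); return_pmf (G(e := g), y(e := b))}"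
      by (subst (2) bind_commute_pmf) simp
    also have "\<dots> = do {G \<leftarrow> M'; y \<leftarrow> Y'; In G y}"
      unfolding In_def by (subst (2) bind_commute_pmf) simp
    finally show ?thesis .
  qed
  have "prob (pair_pmf ?M ?Y) {(G, y). hybrid \<C> (insert e hid) G y} \<le>
      prob (pair_pmf ?M ?Y) {(G, y). hybrid \<C> hid G y}"
    unfolding pair
  proof (intro prob_bind_mono)
    fix G y
    \<comment> \<open>This number separates the two sides: once \<open>e\<close> is hidden its
      colour is irrelevant, and while \<open>e\<close> is visible its bit is, so each side reduces
      to a statement about one of the two draws.\<close>
    define \<rho> where "\<rho> = prob (edge_pmf (r e) c) {g. hybrid \<C> hid (G(e := g)) y}"
    have "prob (In G y) {(G, y). hybrid \<C> (insert e hid) G y} \<le> \<rho>"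
      unfolding In_def
    proof (rule prob_bind_le)
      fix g
      have "prob (bernoulli_pmf (q e) \<bind> (\<lambda>b. return_pmf (G(e := g), y(e := b)))) {(G, y). hybrid \<C> (insert e hid) G y}
        = prob (bernoulli_pmf (q e)) {b. hybrid \<C> (insert e hid) G (y(e := b))}"
        by (simp add: map_pmf_def[symmetric] measure_map_pmf vimage_def hybrid_upd_hidden)
      also have "\<dots> \<le> \<rho>" unfolding \<rho>_def
        using hybrid_step[OF insert.hyps(2) C c] r q by auto
      finally show "prob (bernoulli_pmf (q e) \<bind> (\<lambda>b. return_pmf (G(e := g), y(e := b)))) {(G, y). hybrid \<C> (insert e hid) G y} \<le> \<rho>" .
    qed
    also have "\<rho> \<le> prob (In G y) {(G, y). hybrid \<C> hid G y}"
    proof -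
      have "In G y = do {b \<leftarrow> bernoulli_pmf (q e); g \<leftarrow> edge_pmf (r e) c; return_pmf (G(e := g), y(e := b))}"
        unfolding In_def by (rule bind_commute_pmf)
      moreover have "prob (edge_pmf (r e) c \<bind> (\<lambda>g. return_pmf (G(e := g), y(e := b)))) {(G, y). hybrid \<C> hid G y} = \<rho>" for b
        unfolding \<rho>_def using insert.hyps(2)
        by (simp add: map_pmf_def[symmetric] measure_map_pmf vimage_def hybrid_upd_visible)
      ultimately show ?thesis by (auto intro: prob_bind_ge)
    qed
    finally show "prob (In G y) {(G, y). hybrid \<C> (insert e hid) G y} \<le> prob (In G y) {(G, y). hybrid \<C> hid G y}" .
  qed
  also have "\<dots> \<le> prob ?M {G. hybrid \<C> {} G (\<lambda>_. False)}"
    using insert.IH insert.prems by simp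
  finally show ?case .
qed

section \<open>Typical properties of random graphs\<close>

definition star :: "'a set \<Rightarrow> 'a \<Rightarrow> 'a set set" where
  "star V v = (\<lambda>w. {v, w}) ` (V - {v})"

definition deg :: "'a set \<Rightarrow> 'a set set \<Rightarrow> 'a \<Rightarrow> nat" where
  "deg V X v = card (X \<inter> star V v)"

lemma finite_all_pairs: "finite V \<Longrightarrow> finite (all_pairs V)"
  unfolding all_pairs_def by (rule finite_subset[of _ "Pow V"]) auto

lemma card_all_pairs_le:
  assumes "finite V"
  shows "card (all_pairs V) \<le> (card V)\<^sup>2"
proof -
  have "all_pairs V \<subseteq> (\<lambda>(a, b). {a, b}) ` (V \<times> V)" unfolding all_pairs_def by auto
  then have "card (all_pairs V) \<le> card ((\<lambda>(a, b). {a, b}) ` (V \<times> V))" using assms by (intro card_mono) auto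
  also have "\<dots> \<le> card (V \<times> V)" using assms by (intro card_image_le) auto
  finally show ?thesis by (simp add: card_cartesian_product power2_eq_square)
qed

lemma card_doubletons_image: "v \<notin> W \<Longrightarrow> card ((\<lambda>w. {v, w}) ` W) = card W"
  by (intro card_image inj_onI) (metis doubleton_eq_iff)

lemma star_props:
  assumes "finite V" "v \<in> V"
  shows "star V v \<subseteq> all_pairs V" "finite (star V v)" "card (star V v) = card V - 1"
proof -
  show "star V v \<subseteq> all_pairs V" using assms unfolding star_def all_pairs_def by blast
  show "finite (star V v)" using assms unfolding star_def by simp
  show "card (star V v) = card V - 1" using assms unfolding star_def by (subst card_doubletons_image) auto
qed

lemma rsub_min_degree:
  fixes \<theta> :: real
  assumes V: "finite V" and \<theta>: "0 \<le> \<theta>" "\<theta> \<le> 1"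
  shows "prob (rsub (all_pairs V) \<theta>) {X. \<exists>v\<in>V. deg V X v < 2} \<le>
    card V * ((1 + card V * \<theta>) * exp (2 - \<theta> * card V))"
proof -
  let ?M = "rsub (all_pairs V) \<theta>" and ?n = "card V"
  note fP = finite_all_pairs[OF V]
  \<comment> \<open>The slack 2 in the exponent absorbs the pairs that are not forced to be absent:
    \<open>card V - 1\<close> are forced for degree 0 and \<open>card V - 2\<close> for degree
    1.\<close>
  have pw: "(1 - \<theta>) ^ k \<le> exp (2 - \<theta> * ?n)" if "k + 2 \<ge> ?n" for k
  proof -
    have "(1 - \<theta>) ^ k \<le> exp (- \<theta>) ^ k" using \<theta> exp_ge_add_one_self[of "- \<theta>"] by (intro power_mono) auto
    also have "\<dots> = exp (- \<theta> * k)" by (simp add: exp_of_nat_mult[symmetric] mult.commute)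
    also have "\<dots> \<le> exp (2 - \<theta> * ?n)"
    proof -
      have "\<theta> * ?n \<le> \<theta> * (k + 2)" using that \<theta> by (intro mult_left_mono) auto
      then show ?thesis using \<theta> by (simp add: algebra_simps)
    qed
    finally show ?thesis .
  qed
  have one: "prob ?M {X. deg V X v < 2} \<le> (1 + ?n * \<theta>) * exp (2 - \<theta> * ?n)" if v: "v \<in> V" for v
  proof -
    note st = star_props[OF V v]
    have "{X. deg V X v < 2} \<subseteq> {X. {} \<subseteq> X \<and> X \<inter> star V v = {}} \<union> {X. \<exists>e\<in>star V v. {e} \<subseteq> X \<and> X \<inter> (star V v - {e}) = {}}"
    proof
      fix X assume "X \<in> {X. deg V X v < 2}"
      then have "card (X \<inter> star V v) = 0 \<or> card (X \<inter> star V v) = 1" unfolding deg_def by auto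
      then show "X \<in> {X. {} \<subseteq> X \<and> X \<inter> star V v = {}} \<union> {X. \<exists>e\<in>star V v. {e} \<subseteq> X \<and> X \<inter> (star V v - {e}) = {}}"
      proof
        assume "card (X \<inter> star V v) = 0"
        then show ?thesis using st(2) by simp
      next
        assume "card (X \<inter> star V v) = 1"
        then obtain e where "X \<inter> star V v = {e}" by (auto simp: card_1_singleton_iff)
        then have "e \<in> star V v \<and> {e} \<subseteq> X \<and> X \<inter> (star V v - {e}) = {}" by blast
        then show ?thesis by blast
      qed
    qed
    then have "prob ?M {X. deg V X v < 2} \<le>
        prob ?M ({X. {} \<subseteq> X \<and> X \<inter> star V v = {}} \<union> {X. \<exists>e\<in>star V v. {e} \<subseteq> X \<and> X \<inter> (star V v - {e}) = {}})"
      by (intro measure_pmf.finite_measure_mono) auto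
    also have "\<dots> \<le> prob ?M {X. {} \<subseteq> X \<and> X \<inter> star V v = {}} +
        prob ?M {X. \<exists>e\<in>star V v. {e} \<subseteq> X \<and> X \<inter> (star V v - {e}) = {}}"
      by (intro measure_Un_le) auto
    also have "prob ?M {X. {} \<subseteq> X \<and> X \<inter> star V v = {}} \<le> \<theta> ^ card ({} :: 'a set set) * (1 - \<theta>) ^ card (star V v)"
      using st by (intro rsub_forced[OF fP \<theta>]) auto
    also have "\<dots> \<le> exp (2 - \<theta> * ?n)" using pw[of "?n - 1"] st by simp
    also have "prob ?M {X. \<exists>e\<in>star V v. {e} \<subseteq> X \<and> X \<inter> (star V v - {e}) = {}} \<le>
        (\<Sum>e\<in>star V v. prob ?M {X. {e} \<subseteq> X \<and> X \<inter> (star V v - {e}) = {}})"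
      by (rule prob_ex_le_sum[OF st(2)])
    also have "\<dots> \<le> (\<Sum>e\<in>star V v. \<theta> * exp (2 - \<theta> * ?n))"
    proof (rule sum_mono)
      fix e assume e: "e \<in> star V v"
      have "prob ?M {X. {e} \<subseteq> X \<and> X \<inter> (star V v - {e}) = {}} \<le> \<theta> ^ card {e} * (1 - \<theta>) ^ card (star V v - {e})"
        using st e by (intro rsub_forced[OF fP \<theta>]) auto
      also have "\<dots> = \<theta> * (1 - \<theta>) ^ (?n - 1 - 1)" using st e by simp
      also have "\<dots> \<le> \<theta> * exp (2 - \<theta> * ?n)" using pw[of "?n - 1 - 1"] \<theta> by (intro mult_left_mono) auto
      finally show "prob ?M {X. {e} \<subseteq> X \<and> X \<inter> (star V v - {e}) = {}} \<le> \<theta> * exp (2 - \<theta> * ?n)" .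
    qed
    also have "\<dots> = card (star V v) * (\<theta> * exp (2 - \<theta> * ?n))" by simp
    also have "\<dots> \<le> ?n * (\<theta> * exp (2 - \<theta> * ?n))" using st \<theta> by (intro mult_right_mono) auto
    finally show ?thesis by (simp add: algebra_simps)
  qed
  have "prob ?M {X. \<exists>v\<in>V. deg V X v < 2} \<le> (\<Sum>v\<in>V. prob ?M {X. deg V X v < 2})"
    by (rule prob_ex_le_sum[OF V])
  also have "\<dots> \<le> (\<Sum>v\<in>V. (1 + ?n * \<theta>) * exp (2 - \<theta> * ?n))" by (rule sum_mono) (rule one)
  finally show ?thesis by simp
qed

lemma rsub_low_degree:
  fixes \<theta> y :: real
  assumes V: "finite V" "v \<in> V" and \<theta>: "0 \<le> \<theta>" "\<theta> \<le> 1" and y: "0 < y" "y \<le> 1"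
  shows "prob (rsub (all_pairs V) \<theta>) {X. deg V X v < D} \<le> (1 / y) ^ D * exp (- \<theta> * (1 - y) * (card V - 1))"
  using rsub_few[OF finite_all_pairs[OF V(1)] \<theta> y star_props(1)[OF V], of D] star_props(3)[OF V]
  unfolding deg_def by simp

lemma rsub_many_low:
  fixes \<theta> y a :: real
  assumes V: "finite V" and \<theta>: "0 \<le> \<theta>" "\<theta> \<le> 1" and y: "0 < y" "y \<le> 1" and a: "a > 0"
  shows "prob (rsub (all_pairs V) \<theta>) {X. a \<le> card {v \<in> V. deg V X v < D}} \<le>
    card V * ((1 / y) ^ D * exp (- \<theta> * (1 - y) * (card V - 1))) / a"
proof -
  let ?M = "rsub (all_pairs V) \<theta>"
  let ?f = "\<lambda>X. \<Sum>v\<in>V. indicator {X. deg V X v < D} X :: real"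
  have int: "integrable (measure_pmf ?M) (indicator A :: _ \<Rightarrow> real)" for A
    by (intro measure_pmf.integrable_const_bound[where B = 1]) (auto simp: indicator_def)
  have f: "?f X = real (card {v \<in> V. deg V X v < D})" for X
    using V by (simp add: indicator_def sum.If_cases Int_def of_bool_def)
  have "prob ?M {X \<in> space (measure_pmf ?M). a \<le> ?f X} \<le> measure_pmf.expectation ?M ?f / a"
    by (intro integral_Markov_inequality_measure[where A = "{}"] Bochner_Integration.integrable_sum int)
      (use a in \<open>auto intro!: sum_nonneg\<close>)
  also have "measure_pmf.expectation ?M ?f = (\<Sum>v\<in>V. prob ?M {X. deg V X v < D})"
    by (subst Bochner_Integration.integral_sum[OF int]) simp
  also have "\<dots> \<le> (\<Sum>v\<in>V. (1 / y) ^ D * exp (- \<theta> * (1 - y) * (card V - 1)))"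
    by (rule sum_mono) (rule rsub_low_degree[OF V _ \<theta> y])
  finally show ?thesis using a unfolding f by (simp add: divide_right_mono)
qed

lemma rsub_max_degree:
  fixes \<theta> :: real
  assumes V: "finite V" and \<theta>: "0 \<le> \<theta>" "\<theta> \<le> 1"
  shows "prob (rsub (all_pairs V) \<theta>) {X. \<exists>v\<in>V. \<Delta> \<le> deg V X v} \<le> card V * exp (3 * \<theta> * card V - \<Delta>)"
proof -
  let ?M = "rsub (all_pairs V) \<theta>"
  have "prob ?M {X. \<exists>v\<in>V. \<Delta> \<le> deg V X v} \<le> (\<Sum>v\<in>V. prob ?M {X. \<Delta> \<le> deg V X v})"
    by (rule prob_ex_le_sum[OF V])
  also have "\<dots> \<le> (\<Sum>v\<in>V. exp (3 * \<theta> * card V - \<Delta>))"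
  proof (rule sum_mono)
    fix v assume v: "v \<in> V"
    note st = star_props[OF V v]
    have "prob ?M {X. \<Delta> \<le> deg V X v} \<le> exp (\<theta> * exp 1 * card (star V v)) / exp 1 ^ \<Delta>"
      unfolding deg_def by (rule rsub_many[OF finite_all_pairs[OF V] \<theta> _ st(1)]) simp
    also have "\<dots> = exp (\<theta> * exp 1 * card (star V v) - \<Delta>)"
      by (simp add: exp_diff exp_of_nat_mult[symmetric])
    also have "\<dots> \<le> exp (3 * \<theta> * card V - \<Delta>)"
    proof -
      have "\<theta> * exp 1 * card (star V v) \<le> \<theta> * 3 * card V"
        using \<theta> st exp_le by (intro mult_mono) auto
      then show ?thesis by (simp add: mult_ac)
    qed
    finally show "prob ?M {X. \<Delta> \<le> deg V X v} \<le> exp (3 * \<theta> * card V - \<Delta>)" .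
  qed
  finally show ?thesis by simp
qed

section \<open>Edge counts inside and between vertex sets\<close>

lemma geometric_tail_le:
  fixes r :: real
  assumes "0 \<le> r" "r \<le> 1 / 2" "1 \<le> a"
  shows "(\<Sum>k=a..b. r ^ k) \<le> 2 * r"
proof -
  have "(\<Sum>k=a..b. r ^ k) \<le> (\<Sum>k=1..b. r ^ k)" using assms by (intro sum_mono2) auto
  also have "\<dots> \<le> 2 * r - 2 * r ^ Suc b"
  proof (induction b)
    case (Suc b)
    have "r * r ^ Suc b \<le> 1 / 2 * r ^ Suc b" using assms by (intro mult_right_mono) auto
    then have "2 * r ^ Suc (Suc b) \<le> r ^ Suc b" by simp
    moreover have "(\<Sum>k=1..Suc b. r ^ k) = (\<Sum>k=1..b. r ^ k) + r ^ Suc b" by simp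
    ultimately show ?case using Suc by linarith
  qed simp
  also have "\<dots> \<le> 2 * r" using assms by simp
  finally show ?thesis .
qed

text \<open>For sets of size \<open>w\<close> the Chernoff parameter
  \<open>1 / (\<theta> * w)\<close> reduces the exponent to at most \<open>w\<close>, because there
  are at most \<open>w * w\<close> pairs. Multiplying by the \<open>(e * n / w) ^ w\<close> choices
  of the set, with \<open>n = card V\<close>, leaves the \<open>w\<close>-th power of
  \<open>exp 2 * n * \<theta> ^ 3 * w\<^sup>2\<close>, and the sum over \<open>w\<close> is
  geometric.\<close>

lemma rsub_locally_sparse:
  fixes \<theta> :: real
  assumes V: "finite V" "V \<noteq> {}" and \<theta>: "0 < \<theta>" "\<theta> \<le> 1" and w0: "\<theta> * w0 \<le> 1" "w0 \<le> card V"
    and r: "exp 2 * card V * \<theta> ^ 3 * (real w0)\<^sup>2 \<le> 1 / 2"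
  shows "prob (rsub (all_pairs V) \<theta>)
      {X. \<exists>W\<subseteq>V. 1 \<le> card W \<and> card W \<le> w0 \<and> 3 * card W \<le> card (X \<inter> all_pairs W)} \<le>
    2 * (exp 2 * card V * \<theta> ^ 3 * (real w0)\<^sup>2)"
proof -
  let ?M = "rsub (all_pairs V) \<theta>" and ?n = "card V"
  define r where "r = exp 2 * ?n * \<theta> ^ 3 * (real w0)\<^sup>2"
  define \<W> where "\<W> w = {W. W \<subseteq> V \<and> card W = w}" for w
  have fW: "finite (\<W> w)" for w unfolding \<W>_def by (rule finite_subset[of _ "Pow V"]) (use V in auto)
  have n: "?n > 0" using V by (simp add: card_gt_0_iff)
  have fix_w: "prob ?M {X. \<exists>W\<in>\<W> w. 3 * w \<le> card (X \<inter> all_pairs W)} \<le> r ^ w"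
    if w: "w \<in> {1..w0}" for w
  proof -
    have w1: "1 \<le> w" "w \<le> w0" using w by auto
    have tw: "\<theta> * w \<le> 1"
      using w1 \<theta> w0(1) mult_left_mono[of "real w" "real w0" \<theta>] by linarith
    have tw0: "\<theta> * w > 0" using w1 \<theta> by simp
    have "prob ?M {X. \<exists>W\<in>\<W> w. 3 * w \<le> card (X \<inter> all_pairs W)} \<le>
      (\<Sum>W\<in>\<W> w. prob ?M {X. 3 * w \<le> card (X \<inter> all_pairs W)})"
      by (rule prob_ex_le_sum[OF fW])
    also have "\<dots> \<le> (\<Sum>W\<in>\<W> w. exp w * (\<theta> * w) ^ (3 * w))"
    proof (rule sum_mono)
      fix W assume W: "W \<in> \<W> w"
      then have W': "W \<subseteq> V" "card W = w" "finite W" using V unfolding \<W>_def by (auto intro: finite_subset)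
      have "prob ?M {X. 3 * w \<le> card (X \<inter> all_pairs W)} \<le>
          exp (\<theta> * (1 / (\<theta> * w)) * card (all_pairs W)) / (1 / (\<theta> * w)) ^ (3 * w)"
        using \<theta> tw tw0 W' by (intro rsub_many finite_all_pairs V) (auto simp: all_pairs_def divide_simps)
      also have "\<dots> \<le> exp w * (\<theta> * w) ^ (3 * w)"
      proof -
        have cp: "real (card (all_pairs W)) \<le> real w * real w"
          using card_all_pairs_le[OF W'(3)] W'(2) by (metis of_nat_le_iff of_nat_mult power2_eq_square)
        have "\<theta> * (1 / (\<theta> * w)) * card (all_pairs W) = (1 / w) * card (all_pairs W)"
          using \<theta> w1 by simp
        also have "\<dots> \<le> (1 / w) * (real w * real w)" by (rule mult_left_mono[OF cp]) simp
        also have "\<dots> = w" using w1 by simp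
        finally have "exp (\<theta> * (1 / (\<theta> * w)) * card (all_pairs W)) \<le> exp w" by simp
        moreover have "x / (1 / (\<theta> * w)) ^ (3 * w) = x * (\<theta> * w) ^ (3 * w)" for x
          by (simp add: power_one_over)
        ultimately show ?thesis using tw0 by (metis mult_right_mono zero_le_power less_imp_le)
      qed
      finally show "prob ?M {X. 3 * w \<le> card (X \<inter> all_pairs W)} \<le> exp w * (\<theta> * w) ^ (3 * w)" .
    qed
    also have "\<dots> = card (\<W> w) * (exp w * (\<theta> * w) ^ (3 * w))" by simp
    also have "\<dots> \<le> (exp w / (w / ?n) ^ w) * (exp w * (\<theta> * w) ^ (3 * w))"
    proof (rule mult_right_mono)
      have "real (card (\<W> w)) \<le> real (card {F. F \<subseteq> V \<and> card F \<le> w})"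
        unfolding \<W>_def of_nat_le_iff by (rule card_mono) (use V in auto)
      also have "\<dots> \<le> exp (w / ?n * ?n) / (w / ?n) ^ w"
        by (rule card_small_subsets_le[OF V(1)]) (use w1 w0 n in auto)
      finally show "real (card (\<W> w)) \<le> exp w / (w / ?n) ^ w" using n by simp
    qed (use tw0 in simp)
    also have "\<dots> = (exp 1 / (w / ?n) * (exp 1 * (\<theta> * w) ^ 3)) ^ w"
    proof -
      have e: "exp (real w) = exp 1 ^ w" using exp_of_nat_mult[of w "1::real"] by simp
      have "(\<theta> * w) ^ (3 * w) = ((\<theta> * w) ^ 3) ^ w" by (rule power_mult)
      then show ?thesis unfolding e by (simp only: power_mult_distrib power_divide)
    qed
    also have "exp 1 / (w / ?n) * (exp 1 * (\<theta> * w) ^ 3) = exp 2 * ?n * \<theta> ^ 3 * (real w)\<^sup>2"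
      using w1 n exp_add[of 1 "1::real"] by (simp add: field_simps power2_eq_square power3_eq_cube)
    also have "(exp 2 * ?n * \<theta> ^ 3 * (real w)\<^sup>2) ^ w \<le> r ^ w" unfolding r_def
      using w1 \<theta> by (intro power_mono mult_left_mono) (auto intro!: mult_nonneg_nonneg)
    finally show ?thesis .
  qed
  have "prob ?M {X. \<exists>W\<subseteq>V. 1 \<le> card W \<and> card W \<le> w0 \<and> 3 * card W \<le> card (X \<inter> all_pairs W)} \<le>
      prob ?M {X. \<exists>w\<in>{1..w0}. \<exists>W\<in>\<W> w. 3 * w \<le> card (X \<inter> all_pairs W)}"
    unfolding \<W>_def by (intro measure_pmf.finite_measure_mono subsetI CollectI) (auto simp: Bex_def)
  also have "\<dots> \<le> (\<Sum>w=1..w0. prob ?M {X. \<exists>W\<in>\<W> w. 3 * w \<le> card (X \<inter> all_pairs W)})"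
    by (rule prob_ex_le_sum) simp
  also have "\<dots> \<le> (\<Sum>w=1..w0. r ^ w)" by (rule sum_mono) (rule fix_w)
  also have "\<dots> \<le> 2 * r" by (rule geometric_tail_le) (use r \<theta> in \<open>auto simp: r_def\<close>)
  finally show ?thesis unfolding r_def .
qed

definition cut :: "'a set \<Rightarrow> 'a set \<Rightarrow> 'a set set" where
  "cut S T = (\<lambda>(s, t). {s, t}) ` (S \<times> T)"

lemma card_cut: "S \<inter> T = {} \<Longrightarrow> card (cut S T) = card S * card T"
  unfolding cut_def
  by (subst card_image) (auto simp: inj_on_def doubleton_eq_iff card_cartesian_product)

lemma cut_subset: "S \<subseteq> V \<Longrightarrow> T \<subseteq> V \<Longrightarrow> S \<inter> T = {} \<Longrightarrow> cut S T \<subseteq> all_pairs V"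
  unfolding cut_def all_pairs_def by clarsimp blast

text \<open>A violating set \<open>W\<close> carries \<open>card W + 1\<close> independent demands,
  edges to be present or vertices to be of low degree, each of probability at most
  \<open>\<rho>\<close>. There are about \<open>n ^ card W\<close> sets for
  \<open>n = card V\<close>, so one factor \<open>\<rho>\<close> is left over, up to powers of
  \<open>n * \<rho>\<close>. The constant \<open>2 ^ 37 = 2 ^ (2 ^ 5) * 2 ^ 5\<close> crudely counts
  the choices of the demands inside a set of five vertices.\<close>

lemma rsub_small_sets_tree_like:
  fixes \<theta> y \<rho> :: real
  assumes V: "finite V" and \<theta>: "0 \<le> \<theta>" "\<theta> \<le> 1" and y: "0 < y" "y \<le> 1"
    and \<rho>: "\<theta> \<le> \<rho>" "(1 / y) ^ D * exp (- \<theta> * (1 - y) * (card V - 5)) \<le> \<rho>" "1 \<le> card V * \<rho>"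
  shows "prob (rsub (all_pairs V) \<theta>)
      {X. \<exists>W\<subseteq>V. card W \<le> 5 \<and> card W < card (X \<inter> all_pairs W) + card {v \<in> W. deg V X v < D}} \<le>
    2 ^ 37 * \<rho> * (exp 1 * (card V * \<rho>) ^ 5)"
proof -
  let ?M = "rsub (all_pairs V) \<theta>" and ?n = "card V"
  have n: "?n > 0" using \<rho>(3) by (cases "?n = 0") auto
  have \<rho>0: "\<rho> > 0" using \<rho>(3) n by (smt (verit) mult_nonneg_nonpos of_nat_0_le_iff)
  define \<W> where "\<W> = {W. W \<subseteq> V \<and> card W \<le> 5}"
  define I where "I = Sigma \<W> (\<lambda>W. Pow (Pow W) \<times> Pow W)"
  define Q where "Q = (\<lambda>(W, F, L) X. F \<subseteq> all_pairs W \<and> L \<subseteq> W \<and> card F + card L = card W + 1 \<and>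
     F \<subseteq> X \<and> (\<forall>v\<in>L. deg V X v < D))"
  have fW: "finite \<W>" unfolding \<W>_def by (rule finite_subset[of _ "Pow V"]) (use V in auto)
  have WV: "finite W" "W \<subseteq> V" "card W \<le> 5" if "W \<in> \<W>" for W
    using that V unfolding \<W>_def by (auto intro: finite_subset)
  have one: "prob ?M {X. Q (W, F, L) X} \<le> \<rho> ^ (card W + 1)" if W: "W \<in> \<W>" for W F L
  proof (cases "F \<subseteq> all_pairs W \<and> L \<subseteq> W \<and> card F + card L = card W + 1")
    case True
    note W' = WV[OF W]
    have L: "finite L" "L \<subseteq> V" "L \<inter> (V - W) = {}" using True W' by (auto intro: finite_subset)
    \<comment> \<open>Only pairs leaving \<open>W\<close> are used to witness low degrees: they are
      disjoint from \<open>F\<close>, and each has exactly one endpoint in \<open>L\<close>, so the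
      demands multiply.\<close>
    let ?A = "cut L (V - W)"
    have cA: "card ?A = card L * (?n - card W)"
      using V W' L by (subst card_cut) (auto simp: card_Diff_subset)
    have aW: "all_pairs W \<subseteq> all_pairs V" using W' unfolding all_pairs_def by blast
    have "prob ?M {X. Q (W, F, L) X} \<le>
        \<theta> ^ card F * (1 - \<theta>) ^ card ({} :: 'a set set) * (1 - \<theta> + \<theta> * y) ^ card ?A / (y ^ (D * card L))"
    proof (rule rsub_prob_weight_le[OF finite_all_pairs[OF V] \<theta> y(1)])
      show "F \<subseteq> all_pairs V" using True aW by auto
      show "?A \<subseteq> all_pairs V" using L by (intro cut_subset) auto
      show "F \<inter> ?A = {}" using True unfolding all_pairs_def cut_def by (auto simp: doubleton_eq_iff)
      fix X assume X: "X \<in> {X. Q (W, F, L) X}" "X \<subseteq> all_pairs V"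
      have fX: "finite X" using X finite_all_pairs[OF V] by (auto intro: finite_subset)
      have "X \<inter> ?A \<subseteq> (\<Union>v\<in>L. X \<inter> star V v)"
      proof
        fix e assume "e \<in> X \<inter> ?A"
        then obtain a b where ab: "e = {a, b}" "a \<in> L" "b \<in> V - W" "e \<in> X" unfolding cut_def by auto
        then have "b \<noteq> a" using L by auto
        then have "e \<in> star V a" using ab unfolding star_def by auto
        then show "e \<in> (\<Union>v\<in>L. X \<inter> star V v)" using ab by auto
      qed
      then have "card (X \<inter> ?A) \<le> card (\<Union>v\<in>L. X \<inter> star V v)" using L fX by (intro card_mono) auto
      also have "\<dots> \<le> (\<Sum>v\<in>L. card (X \<inter> star V v))" using L by (intro card_UN_le) auto
      also have "\<dots> \<le> (\<Sum>v\<in>L. D)" using X unfolding Q_def deg_def by (intro sum_mono) (auto intro: less_imp_le)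
      finally have "card (X \<inter> ?A) \<le> D * card L" by (simp add: mult.commute)
      then have "y ^ (D * card L) \<le> y ^ card (X \<inter> ?A)" using y by (intro power_decreasing) auto
      then show "F \<subseteq> X \<and> X \<inter> {} = {} \<and> y ^ (D * card L) \<le> y ^ card (X \<inter> ?A)"
        using X unfolding Q_def by auto
    qed (use y in auto)
    also have "\<dots> = \<theta> ^ card F * ((1 / y) ^ D * (1 - \<theta> + \<theta> * y) ^ (?n - card W)) ^ card L"
      unfolding cA by (simp add: power_mult_distrib power_divide power_mult[symmetric] mult.commute)
    also have "\<dots> \<le> \<rho> ^ card F * \<rho> ^ card L"
    proof (intro mult_mono power_mono)
      have nn: "0 \<le> 1 - \<theta> + \<theta> * y" using \<theta> y by (simp add: add_nonneg_nonneg)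
      have "(1 - \<theta> + \<theta> * y) ^ (?n - card W) \<le> exp (- \<theta> * (1 - y)) ^ (?n - card W)"
        using exp_ge_add_one_self[of "- \<theta> * (1 - y)"] nn by (intro power_mono) (auto simp: algebra_simps)
      also have "\<dots> = exp (- (\<theta> * (1 - y) * (?n - card W)))"
        by (simp add: exp_of_nat_mult[symmetric] mult_ac)
      also have "\<dots> \<le> exp (- \<theta> * (1 - y) * (?n - 5))"
      proof -
        have "\<theta> * (1 - y) * real (?n - 5) \<le> \<theta> * (1 - y) * real (?n - card W)"
          using W'(3) \<theta> y by (intro mult_left_mono) auto
        then show ?thesis by simp
      qed
      finally have "(1 / y) ^ D * (1 - \<theta> + \<theta> * y) ^ (?n - card W) \<le> (1 / y) ^ D * exp (- \<theta> * (1 - y) * (?n - 5))"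
        using y by (intro mult_left_mono) auto
      then show "(1 / y) ^ D * (1 - \<theta> + \<theta> * y) ^ (?n - card W) \<le> \<rho>" using \<rho>(2) by linarith
      show "0 \<le> (1 / y) ^ D * (1 - \<theta> + \<theta> * y) ^ (?n - card W)" using nn y by simp
      then show "0 \<le> ((1 / y) ^ D * (1 - \<theta> + \<theta> * y) ^ (?n - card W)) ^ card L" by simp
    qed (use \<rho> \<rho>0 \<theta> in auto)
    also have "\<dots> = \<rho> ^ (card W + 1)" using True by (simp flip: power_add)
    finally show ?thesis .
  next
    case False
    then have "{X. Q (W, F, L) X} = {}" unfolding Q_def by auto
    then show ?thesis using \<rho>0 by simp
  qed
  have "prob ?M
      {X. \<exists>W\<subseteq>V. card W \<le> 5 \<and> card W < card (X \<inter> all_pairs W) + card {v \<in> W. deg V X v < D}} \<le>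
      prob ?M {X. \<exists>i\<in>I. Q i X}"
  proof (intro measure_pmf.finite_measure_mono subsetI)
    fix X assume "X \<in> {X. \<exists>W\<subseteq>V. card W \<le> 5 \<and> card W < card (X \<inter> all_pairs W) + card {v \<in> W. deg V X v < D}}"
    then obtain W where W: "W \<subseteq> V" "card W \<le> 5" "card W < card (X \<inter> all_pairs W) + card {v \<in> W. deg V X v < D}" by blast
    have "\<exists>F L. F \<subseteq> X \<inter> all_pairs W \<and> L \<subseteq> {v \<in> W. deg V X v < D} \<and> card F + card L = card W + 1"
    proof (cases "card W + 1 \<le> card (X \<inter> all_pairs W)")
      case True
      obtain F where "F \<subseteq> X \<inter> all_pairs W" "card F = card W + 1"
        by (rule obtain_subset_with_card_n[OF True])
      then show ?thesis by (intro exI[of _ F] exI[of _ "{}"]) auto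
    next
      case False
      then have le: "card W + 1 - card (X \<inter> all_pairs W) \<le> card {v \<in> W. deg V X v < D}" using W(3) by linarith
      obtain L where L: "L \<subseteq> {v \<in> W. deg V X v < D}" "card L = card W + 1 - card (X \<inter> all_pairs W)"
        by (rule obtain_subset_with_card_n[OF le])
      have "card (X \<inter> all_pairs W) + card L = card W + 1" using False L(2) by linarith
      then show ?thesis using L(1) by blast
    qed
    then obtain F L where FL: "F \<subseteq> X \<inter> all_pairs W" "L \<subseteq> {v \<in> W. deg V X v < D}" "card F + card L = card W + 1" by blast
    have "F \<subseteq> Pow W" using FL(1) unfolding all_pairs_def by auto
    moreover have "L \<subseteq> W" using FL(2) by auto
    moreover have "W \<in> \<W>" unfolding \<W>_def using W by simp
    ultimately have "(W, F, L) \<in> I" unfolding I_def by simp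
    moreover have "Q (W, F, L) X"
    proof -
      have "F \<subseteq> all_pairs W" "F \<subseteq> X" "L \<subseteq> W" "\<forall>v\<in>L. deg V X v < D" using FL(1,2) by auto
      then show ?thesis unfolding Q_def prod.case using FL(3) by simp
    qed
    ultimately show "X \<in> {X. \<exists>i\<in>I. Q i X}" by blast
  qed simp
  also have "\<dots> \<le> (\<Sum>i\<in>I. prob ?M {X. Q i X})"
    by (rule prob_ex_le_sum) (use fW WV in \<open>auto simp: I_def\<close>)
  also have "\<dots> \<le> (\<Sum>(W, FL)\<in>I. \<rho> ^ (card W + 1))"
  proof (rule sum_mono)
    fix i assume i: "i \<in> I"
    obtain W F L where WFL: "i = (W, F, L)" by (cases i)
    have "W \<in> \<W>" using i unfolding WFL I_def by simp
    from one[OF this] show "prob ?M {X. Q i X} \<le> (case i of (W, FL) \<Rightarrow> \<rho> ^ (card W + 1))"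
      unfolding WFL by simp
  qed
  also have "\<dots> = (\<Sum>W\<in>\<W>. \<Sum>FL\<in>Pow (Pow W) \<times> Pow W. \<rho> ^ (card W + 1))"
    unfolding I_def using fW WV by (subst sum.Sigma) auto
  also have "\<dots> \<le> (\<Sum>W\<in>\<W>. 2 ^ 37 * \<rho> * \<rho> ^ card W)"
  proof (rule sum_mono)
    fix W assume W: "W \<in> \<W>"
    have "card (Pow (Pow W) \<times> Pow W) = 2 ^ (2 ^ card W) * 2 ^ card W"
      using WV[OF W] by (simp add: card_cartesian_product card_Pow)
    also have "\<dots> \<le> 2 ^ (2 ^ 5) * 2 ^ 5"
      using WV[OF W] by (intro mult_mono power_increasing) auto
    finally have "card (Pow (Pow W) \<times> Pow W) \<le> 2 ^ 37" by simp
    then have "real (card (Pow (Pow W) \<times> Pow W)) \<le> 2 ^ 37" by (metis of_nat_le_iff of_nat_numeral of_nat_power)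
    from mult_right_mono[OF this, of "\<rho> ^ (card W + 1)"] \<rho>0
    show "(\<Sum>FL\<in>Pow (Pow W) \<times> Pow W. \<rho> ^ (card W + 1)) \<le> 2 ^ 37 * \<rho> * \<rho> ^ card W"
      by (simp only: sum_constant) (simp add: mult_ac)
  qed
  also have "\<dots> = 2 ^ 37 * \<rho> * (\<Sum>W\<in>\<W>. \<rho> ^ card W)" by (simp only: sum_distrib_left)
  also have "(\<Sum>W\<in>\<W>. \<rho> ^ card W) \<le> exp (\<rho> * (1 / (?n * \<rho>)) * ?n) / (1 / (?n * \<rho>)) ^ 5"
    unfolding \<W>_def by (rule sum_Pow_small_le[OF V]) (use \<rho> \<rho>0 n in \<open>auto simp: divide_simps\<close>)
  also have "\<dots> = exp 1 * (?n * \<rho>) ^ 5" using \<rho>0 n by (simp add: power_one_over)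
  finally show ?thesis using \<rho>0 by simp
qed

text \<open>A pair \<open>S\<close>, \<open>A\<close> forbids at least
  \<open>card S * card V / 4\<close> edges. The exponent \<open>9 = 1 + 8\<close> of
  \<open>1 / y\<close> comes from choosing \<open>S\<close> and the up to eight times larger
  \<open>A\<close>; a density above a large multiple of \<open>ln (1 / y) / card V\<close> beats
  this entropy.\<close>

lemma rsub_large_expansion:
  fixes \<theta> y :: real and x0 :: nat
  assumes V: "finite V" and \<theta>: "0 \<le> \<theta>" "\<theta> \<le> 1" and y: "0 < y" "y \<le> 1" "y * card V \<le> x0" "1 \<le> x0"
    and r: "exp 2 * (1 / y) ^ 9 * exp (- \<theta> * card V / 4) \<le> 1 / 2"
  shows "prob (rsub (all_pairs V) \<theta>)
      {X. \<exists>S A. S \<subseteq> A \<and> A \<subseteq> V \<and> x0 \<le> card S \<and> card A \<le> 8 * card S \<and> 4 * card A \<le> 3 * card V \<and> X \<inter> cut S (V - A) = {}} \<le>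
    2 * (exp 2 * (1 / y) ^ 9 * exp (- \<theta> * card V / 4))" (is "prob _ ?Bad \<le> _")
proof -
  let ?M = "rsub (all_pairs V) \<theta>" and ?n = "card V"
  define r where "r = exp 2 * (1 / y) ^ 9 * exp (- \<theta> * ?n / 4)"
  define \<S> where "\<S> x = {S. S \<subseteq> V \<and> card S \<le> x}" for x
  have fS: "finite (\<S> x)" for x unfolding \<S>_def by (rule finite_subset[of _ "Pow V"]) (use V in auto)
  define Q where "Q x = (\<lambda>(S, A) X. S \<subseteq> A \<and> card S = x \<and> 4 * card A \<le> 3 * ?n \<and> X \<inter> cut S (V - A) = {})" for x
  have fix_x: "prob ?M {X. \<exists>SA\<in>\<S> x \<times> \<S> (8 * x). Q x SA X} \<le> r ^ x"
    if x: "x \<in> {x0..?n}" for x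
  proof -
    have "prob ?M {X. \<exists>SA\<in>\<S> x \<times> \<S> (8 * x). Q x SA X} \<le>
        (\<Sum>SA\<in>\<S> x \<times> \<S> (8 * x). prob ?M {X. Q x SA X})"
      by (rule prob_ex_le_sum) (use fS in simp)
    also have "\<dots> \<le> (\<Sum>SA\<in>\<S> x \<times> \<S> (8 * x). exp (- \<theta> * ?n / 4) ^ x)"
    proof (rule sum_mono)
      fix SA assume "SA \<in> \<S> x \<times> \<S> (8 * x)"
      then obtain S A where SA: "SA = (S, A)" "S \<subseteq> V" "A \<subseteq> V" unfolding \<S>_def by auto
      show "prob ?M {X. Q x SA X} \<le> exp (- \<theta> * ?n / 4) ^ x"
      proof (cases "S \<subseteq> A \<and> card S = x \<and> 4 * card A \<le> 3 * ?n")
        case True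
        have cc: "card (cut S (V - A)) = x * (?n - card A)"
          using True SA V by (subst card_cut) (auto simp: card_Diff_subset finite_subset)
        have "prob ?M {X. Q x SA X} \<le> prob ?M {X. {} \<subseteq> X \<and> X \<inter> cut S (V - A) = {}}"
          unfolding Q_def SA by (intro measure_pmf.finite_measure_mono) auto
        also have "\<dots> \<le> \<theta> ^ card ({} :: 'a set set) * (1 - \<theta>) ^ card (cut S (V - A))"
          using True SA by (intro rsub_forced finite_all_pairs V \<theta> cut_subset) auto
        also have "\<dots> = ((1 - \<theta>) ^ (?n - card A)) ^ x" 
          unfolding cc by (simp add: power_mult[symmetric] mult.commute)
        also have "\<dots> \<le> exp (- \<theta> * ?n / 4) ^ x"
        proof (rule power_mono)
          have "(1 - \<theta>) ^ (?n - card A) \<le> exp (- \<theta>) ^ (?n - card A)"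
            using \<theta> exp_ge_add_one_self[of "- \<theta>"] by (intro power_mono) auto
          also have "\<dots> = exp (- \<theta> * (?n - card A))" by (simp add: exp_of_nat_mult[symmetric] mult.commute)
          also have "\<dots> \<le> exp (- \<theta> * ?n / 4)"
          proof -
            have "?n / 4 \<le> real (?n - card A)" using True by linarith
            then have "\<theta> * (?n / 4) \<le> \<theta> * real (?n - card A)" using \<theta> by (intro mult_left_mono) auto
            then show ?thesis by simp
          qed
          finally show "(1 - \<theta>) ^ (?n - card A) \<le> exp (- \<theta> * ?n / 4)" .
        qed (use \<theta> in simp)
        finally show ?thesis .
      next
        case False
        then have "{X. Q x SA X} = {}" unfolding Q_def SA by auto
        then show ?thesis by simp
      qed
    qed
    also have "\<dots> = real (card (\<S> x)) * real (card (\<S> (8 * x))) * exp (- \<theta> * ?n / 4) ^ x"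
      by (simp add: card_cartesian_product)
    also have "\<dots> \<le> (exp x / y ^ x) * (exp x / y ^ (8 * x)) * exp (- \<theta> * ?n / 4) ^ x"
    proof -
      have c: "real (card (\<S> k)) \<le> exp x / y ^ k" for k
      proof -
        have "y * ?n \<le> x" using y(3) x by simp
        then have "exp (y * ?n) / y ^ k \<le> exp x / y ^ k" using y by (intro divide_right_mono) auto
        then show ?thesis unfolding \<S>_def
          using card_small_subsets_le[OF V y(1,2), of k] by linarith
      qed
      show ?thesis by (intro mult_right_mono mult_mono c) (use y in auto)
    qed
    also have "\<dots> = r ^ x"
    proof -
      have e: "exp (real x) = exp 1 ^ x" using exp_of_nat_mult[of x "1::real"] by simp
      have "(exp x / y ^ x) * (exp x / y ^ (8 * x)) = (exp 1 * exp 1 * (1 / y) ^ 9) ^ x"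
        unfolding e by (simp add: power_mult_distrib power_divide power_mult[symmetric] power_add[symmetric])
      also have "exp 1 * exp 1 = exp (2::real)" by (simp flip: exp_add)
      finally show ?thesis unfolding r_def by (simp add: power_mult_distrib)
    qed
    finally show ?thesis .
  qed
  have "prob ?M ?Bad \<le>
      prob ?M {X. \<exists>x\<in>{x0..?n}. \<exists>SA\<in>\<S> x \<times> \<S> (8 * x). Q x SA X}"
  proof (intro measure_pmf.finite_measure_mono subsetI)
    fix X assume "X \<in> ?Bad"
    then obtain S A where SA: "S \<subseteq> A" "A \<subseteq> V" "x0 \<le> card S" "card A \<le> 8 * card S" "4 * card A \<le> 3 * card V" "X \<inter> cut S (V - A) = {}"
      by blast
    have "card S \<le> ?n" using SA V by (intro card_mono) auto
    then show "X \<in> {X. \<exists>x\<in>{x0..?n}. \<exists>SA\<in>\<S> x \<times> \<S> (8 * x). Q x SA X}"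
      using SA unfolding \<S>_def Q_def
      by (intro CollectI bexI[of _ "card S"] bexI[of _ "(S, A)"]) auto
  qed simp
  also have "\<dots> \<le> (\<Sum>x=x0..?n. prob ?M {X. \<exists>SA\<in>\<S> x \<times> \<S> (8 * x). Q x SA X})"
    by (rule prob_ex_le_sum) simp
  also have "\<dots> \<le> (\<Sum>x=x0..?n. r ^ x)" by (rule sum_mono) (rule fix_x)
  also have "\<dots> \<le> 2 * r" by (rule geometric_tail_le) (use assms in \<open>auto simp: r_def\<close>)
  finally show ?thesis unfolding r_def .
qed

section \<open>Sprinkling and first occurrences of colours\<close>

text \<open>Adding boosters is adaptive, so failure is encoded by a static witness: a set
  \<open>F\<close> of at most \<open>card V\<close> sprinkled edges such that \<open>X\<close>
  misses every booster of \<open>\<Gamma> \<union> F\<close>. For fixed \<open>F\<close>, containing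
  \<open>F\<close> and avoiding the boosters outside \<open>T\<close> concern disjoint sets of
  pairs, which gives \<open>q ^ card F * exp (- q * b)\<close>, to be summed over all
  \<open>F\<close>.\<close>

lemma sprinkle_boosters:
  fixes q y :: real
  assumes V: "finite V" "V \<noteq> {}" "card V < 6 * k" "k \<ge> 2" and G: "\<Gamma> \<subseteq> all_pairs V" "expander V \<Gamma> k"
    and T: "T \<subseteq> all_pairs V" and q: "0 \<le> q" "q \<le> 1" and y: "0 < y" "y \<le> 1"
    and b: "2 * (b + card T) \<le> (Suc k)\<^sup>2"
  shows "prob (rsub (all_pairs V - T) q) {X. \<not> ham V (\<Gamma> \<union> X)} \<le>
    exp (q * y * (card V)\<^sup>2) / y ^ card V * exp (- q * b)"
proof -
  let ?N = "all_pairs V - T" and ?n = "card V"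
  let ?M = "rsub ?N q"
  have fN: "finite ?N" "finite T" using finite_all_pairs[OF V(1)] T by (auto intro: finite_subset)
  define \<F> where "\<F> = {F. F \<subseteq> ?N \<and> card F \<le> ?n}"
  have fF: "finite \<F>" unfolding \<F>_def by (rule finite_subset[of _ "Pow ?N"]) (use fN in auto)
  define Q where "Q F X \<longleftrightarrow> \<not> ham V (\<Gamma> \<union> F) \<and> F \<subseteq> X \<and> X \<inter> (boosters V (\<Gamma> \<union> F) - T) = {}" for F X
  have one: "prob ?M {X. Q F X} \<le> q ^ card F * exp (- q * b)" if F: "F \<in> \<F>" for F
  proof (cases "ham V (\<Gamma> \<union> F)")
    case True
    then show ?thesis using q unfolding Q_def by simp
  next
    case False
    have sub: "\<Gamma> \<union> F \<subseteq> all_pairs V" using G F unfolding \<F>_def by auto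
    have ex: "expander V (\<Gamma> \<union> F) k" by (rule expander_mono[OF G(2) _ sub V(1)]) auto
    let ?B = "boosters V (\<Gamma> \<union> F) - T"
    have "2 * (b + card T) \<le> 2 * card (boosters V (\<Gamma> \<union> F))"
      by (rule order_trans[OF b many_boosters[OF V(1,3) sub ex V(2,4) False]])
    then have "b + card T \<le> card (boosters V (\<Gamma> \<union> F))" by simp
    moreover have "card (boosters V (\<Gamma> \<union> F)) - card T \<le> card ?B" by (rule diff_card_le_card_Diff[OF fN(2)])
    ultimately have b': "b \<le> card ?B" by linarith
    have "prob ?M {X. Q F X} \<le> prob ?M {X. F \<subseteq> X \<and> X \<inter> ?B = {}}"
      unfolding Q_def by (intro measure_pmf.finite_measure_mono) auto
    also have "\<dots> \<le> q ^ card F * (1 - q) ^ card ?B"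
      by (rule rsub_forced[OF fN(1) q]) (use F in \<open>auto simp: \<F>_def boosters_def\<close>)
    also have "(1 - q) ^ card ?B \<le> exp (- q) ^ card ?B"
      using q exp_ge_add_one_self[of "- q"] by (intro power_mono) auto
    also have "exp (- q) ^ card ?B \<le> exp (- q) ^ b" using b' q by (intro power_decreasing) auto
    also have "exp (- q) ^ b = exp (- q * b)" by (simp add: exp_of_nat_mult[symmetric] mult.commute)
    finally show ?thesis using q by (simp add: mult_left_mono)
  qed
  have "prob ?M {X. \<not> ham V (\<Gamma> \<union> X)} = prob ?M ({X. \<not> ham V (\<Gamma> \<union> X)} \<inter> set_pmf ?M)"
    by (simp add: measure_Int_set_pmf)
  also have "\<dots> \<le> prob ?M {X. \<exists>F\<in>\<F>. Q F X}"
  proof (intro measure_pmf.finite_measure_mono subsetI)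
    fix X assume X: "X \<in> {X. \<not> ham V (\<Gamma> \<union> X)} \<inter> set_pmf ?M"
    then have XN: "X \<subseteq> ?N" using set_rsub[OF fN(1)] by blast
    obtain F where F: "F \<subseteq> X" "card F \<le> ?n" "\<not> ham V (\<Gamma> \<union> F)" "boosters V (\<Gamma> \<union> F) \<inter> X = {}"
      using not_ham_obtain_boosterless[OF V(1,2) G(1), of X] X XN by blast
    have "F \<in> \<F>" unfolding \<F>_def using F XN by auto
    moreover have "Q F X" unfolding Q_def using F by auto
    ultimately show "X \<in> {X. \<exists>F\<in>\<F>. Q F X}" by blast
  qed simp
  also have "\<dots> \<le> (\<Sum>F\<in>\<F>. prob ?M {X. Q F X})" by (rule prob_ex_le_sum[OF fF])
  also have "\<dots> \<le> (\<Sum>F\<in>\<F>. q ^ card F * exp (- q * b))" by (rule sum_mono) (rule one)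
  also have "\<dots> = (\<Sum>F\<in>\<F>. q ^ card F) * exp (- q * b)" by (simp add: sum_distrib_right)
  also have "\<dots> \<le> exp (q * y * (card V)\<^sup>2) / y ^ card V * exp (- q * b)"
  proof (rule mult_right_mono)
    have "(\<Sum>F\<in>\<F>. q ^ card F) \<le> exp (q * y * card ?N) / y ^ ?n"
      unfolding \<F>_def by (rule sum_Pow_small_le[OF fN(1) y q(1)])
    also have "\<dots> \<le> exp (q * y * (card V)\<^sup>2) / y ^ ?n"
    proof (intro divide_right_mono)
      have "card ?N \<le> card (all_pairs V)" using finite_all_pairs[OF V(1)] by (intro card_mono) auto
      also have "\<dots> \<le> (card V)\<^sup>2" by (rule card_all_pairs_le[OF V(1)])
      finally have "real (card ?N) \<le> real ((card V)\<^sup>2)" by simp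
      then have "q * y * card ?N \<le> q * y * real ((card V)\<^sup>2)" using q y by (intro mult_left_mono) auto
      then show "exp (q * y * card ?N) \<le> exp (q * y * (card V)\<^sup>2)" by simp
    qed (use y in simp)
    finally show "(\<Sum>F\<in>\<F>. q ^ card F) \<le> exp (q * y * (card V)\<^sup>2) / y ^ card V" .
  qed simp
  finally show ?thesis .
qed

section \<open>Keeping only the first edge of every colour in a list\<close>

definition repeats :: "'a list \<Rightarrow> ('a \<Rightarrow> 'b) \<Rightarrow> 'a set" where
  "repeats es G = {e. \<exists>xs ys. es = xs @ e # ys \<and> G e \<in> G ` set xs}"

lemma repeats_snoc:
  "repeats (es @ [e]) G = repeats es G \<union> (if G e \<in> G ` set es then {e} else {})"
proof (rule set_eqI)
  fix f
  have "(\<exists>xs ys. es @ [e] = xs @ f # ys \<and> G f \<in> G ` set xs) \<longleftrightarrow>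
     (\<exists>xs ys. es = xs @ f # ys \<and> G f \<in> G ` set xs) \<or> (f = e \<and> G f \<in> G ` set es)" (is "?L \<longleftrightarrow> ?R")
  proof
    assume ?L
    then obtain xs ys where x: "es @ [e] = xs @ f # ys" "G f \<in> G ` set xs" by blast
    show ?R
    proof (cases ys rule: rev_cases)
      case Nil then show ?thesis using x by simp
    next
      case (snoc zs z)
      then have "es = xs @ f # zs" using x(1) by (simp flip: append_assoc append_Cons)
      then show ?thesis using x(2) by blast
    qed
  next
    assume ?R
    then show ?L
    proof
      assume "\<exists>xs ys. es = xs @ f # ys \<and> G f \<in> G ` set xs"
      then obtain xs ys where "es = xs @ f # ys" "G f \<in> G ` set xs" by blast
      then have "es @ [e] = xs @ f # (ys @ [e]) \<and> G f \<in> G ` set xs" by simp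
      then show ?L by blast
    next
      assume "f = e \<and> G f \<in> G ` set es"
      moreover from this have "es @ [e] = es @ f # []" by simp
      ultimately show ?L by blast
    qed
  qed
  then show "f \<in> repeats (es @ [e]) G \<longleftrightarrow> f \<in> repeats es G \<union> (if G e \<in> G ` set es then {e} else {})"
    unfolding repeats_def by auto
qed

lemma repeats_subset: "repeats es G \<subseteq> set es"
  unfolding repeats_def by auto

lemma inj_on_non_repeats: "inj_on G (set es - repeats es G)"
proof (induction es rule: rev_induct)
  case (snoc e es)
  let ?A = "set es - repeats es G"
  have sub: "set (es @ [e]) - repeats (es @ [e]) G \<subseteq> (if G e \<in> G ` set es then ?A else insert e ?A)"
    unfolding repeats_snoc by auto
  have "inj_on G (if G e \<in> G ` set es then ?A else insert e ?A)"
  proof (cases "G e \<in> G ` set es")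
    case False
    then have "G e \<notin> G ` (?A - {e})" by blast
    then show ?thesis using False snoc inj_on_insert[of G e ?A] by simp
  qed (use snoc in simp)
  then show ?case using sub by (rule inj_on_subset)
qed simp

lemma repeats_cong: "(\<And>e. e \<in> set es \<Longrightarrow> G e = G' e) \<Longrightarrow> repeats es G = repeats es G'"
proof -
  assume a: "\<And>e. e \<in> set es \<Longrightarrow> G e = G' e"
  have h: "G e \<in> G ` set xs \<longleftrightarrow> G' e \<in> G' ` set xs" if "es = xs @ e # ys" for e xs ys
  proof -
    have "G e = G' e" "G ` set xs = G' ` set xs" using a that by (auto intro!: image_cong)
    then show ?thesis by simp
  qed
  show ?thesis unfolding repeats_def by (intro Collect_cong ex_cong1 conj_cong refl) (rule h)
qed

lemma prob_edge_pmf_le: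
  assumes c: "c > 0" and Z: "finite Z" "None \<notin> Z"
  shows "prob (edge_pmf 1 c) Z \<le> card Z / c"
proof -
  have "prob (edge_pmf 1 c) Z = (\<Sum>x\<in>Z. pmf (edge_pmf 1 c) x)"
    using Z by (intro measure_measure_pmf_finite) auto
  also have "\<dots> \<le> (\<Sum>x\<in>Z. 1 / c)"
  proof (rule sum_mono)
    fix x assume "x \<in> Z"
    then obtain k where k: "x = Some k" using Z by (cases x) auto
    have "pmf (map_pmf Some (pmf_of_set {1..c})) (Some k) = pmf (pmf_of_set {1..c}) k"
      by (rule pmf_map_inj') simp
    also have "\<dots> \<le> 1 / c" using c by (auto simp: pmf_of_set indicator_def)
    finally show "pmf (edge_pmf 1 c) x \<le> 1 / c" unfolding k by (simp add: pmf_edge_pmf)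
  qed
  finally show ?thesis by simp
qed

lemma edge_pmf_1_not_None: "c > 0 \<Longrightarrow> None \<notin> set_pmf (edge_pmf 1 c)"
  by (simp add: set_pmf_iff pmf_edge_pmf pmf_map_outside)

lemma prob_bind_le_mult:
  assumes "\<And>x. x \<in> set_pmf M \<Longrightarrow> x \<in> B \<Longrightarrow> prob (f x) A \<le> \<rho>"
    and "\<And>x. x \<in> set_pmf M \<Longrightarrow> x \<notin> B \<Longrightarrow> prob (f x) A = 0"
  shows "prob (bind_pmf M f) A \<le> prob M B * \<rho>"
proof -
  have int: "integrable (measure_pmf M) (indicator B :: _ \<Rightarrow> real)"
    by (intro measure_pmf.integrable_const_bound[where B = 1]) (auto simp: indicator_def)
  have "measure_pmf.expectation M (\<lambda>x. prob (f x) A) \<le>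
      measure_pmf.expectation M (\<lambda>x. indicator B x * \<rho>)"
  proof (intro integral_mono_AE integrable_prob_pmf)
    show "integrable (measure_pmf M) (\<lambda>x. indicator B x * \<rho>)" using int by simp
    show "AE x in measure_pmf M. prob (f x) A \<le> indicator B x * \<rho>"
      unfolding AE_measure_pmf_iff
    proof
      fix x assume "x \<in> set_pmf M"
      then show "prob (f x) A \<le> indicator B x * \<rho>" using assms by (cases "x \<in> B") auto
    qed
  qed
  also have "\<dots> = prob M B * \<rho>" by simp
  finally show ?thesis unfolding prob_bind_pmf .
qed

text \<open>The colours are revealed in the order of the list: given the earlier ones, an edge repeats one
  of at most \<open>N\<close> colours.\<close>
lemma prob_all_repeat_le:
  assumes "finite P" "distinct es" "set es \<subseteq> P" "\<And>e. e \<in> set es \<Longrightarrow> r e = 1" "K \<subseteq> set es" "c > 0"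
    and "length es \<le> N"
  shows "prob (Pi_pmf P None (\<lambda>e. edge_pmf (r e) c)) {G. K \<subseteq> repeats es G} \<le> (N / c) ^ card K"
  using assms
proof (induction es arbitrary: K P rule: rev_induct)
  case Nil
  then show ?case by simp
next
  case (snoc e es)
  have e: "e \<notin> set es" "e \<in> P" "r e = 1" using snoc.prems by auto
  show ?case
  proof (cases "e \<in> K")
    case False
    have "{G. K \<subseteq> repeats (es @ [e]) G} \<subseteq> {G. K \<subseteq> repeats es G}"
      using False by (auto simp: repeats_snoc split: if_splits)
    then have "prob (Pi_pmf P None (\<lambda>e. edge_pmf (r e) c)) {G. K \<subseteq> repeats (es @ [e]) G} \<le>
        prob (Pi_pmf P None (\<lambda>e. edge_pmf (r e) c)) {G. K \<subseteq> repeats es G}"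
      by (intro measure_pmf.finite_measure_mono) auto
    also have "\<dots> \<le> (N / c) ^ card K"
      by (rule snoc.IH) (use snoc.prems False in auto)
    finally show ?thesis .
  next
    case True
    define K' where "K' = K - {e}"
    define P' where "P' = P - {e}"
    have K': "K' \<subseteq> set es" "finite K'" "card K = Suc (card K')"
      using snoc.prems(5) True finite_subset[OF snoc.prems(5)] card.remove[of K e] unfolding K'_def by auto
    have P': "finite P'" "e \<notin> P'" "P = insert e P'" "set es \<subseteq> P'" using snoc.prems e unfolding P'_def by auto
    let ?M' = "Pi_pmf P' None (\<lambda>e. edge_pmf (r e) c)"
    have ed: "Pi_pmf P None (\<lambda>e. edge_pmf (r e) c) =
        bind_pmf ?M' (\<lambda>G. map_pmf (\<lambda>g. G(e := g)) (edge_pmf 1 c))"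
      unfolding P'(3) Pi_pmf_insert'[OF P'(1,2)] using e(3)
      by (subst bind_commute_pmf) (simp add: map_pmf_def)
    have rep: "repeats es (G(e := g)) = repeats es G" for G :: "'a \<Rightarrow> nat option" and g
      by (rule repeats_cong) (use e in auto)
    have im: "(G(e := g)) ` set es = G ` set es" for G :: "'a \<Rightarrow> nat option" and g
      by (rule image_cong) (use e in auto)
    have ev: "K \<subseteq> repeats (es @ [e]) (G(e := g)) \<longleftrightarrow> K' \<subseteq> repeats es G \<and> g \<in> G ` set es" for G :: "'a \<Rightarrow> nat option" and g
    proof -
      have "e \<notin> repeats es G" using repeats_subset e by fast
      then show ?thesis using True unfolding K'_def repeats_snoc rep im by (auto split: if_splits)
    qed
    have "prob (Pi_pmf P None (\<lambda>e. edge_pmf (r e) c)) {G. K \<subseteq> repeats (es @ [e]) G} \<le>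
        prob ?M' {G. K' \<subseteq> repeats es G} * (N / c)"
      unfolding ed
    proof (rule prob_bind_le_mult)
      fix G :: "'a \<Rightarrow> nat option" assume "G \<in> {G. K' \<subseteq> repeats es G}"
      have "prob (map_pmf (\<lambda>g. G(e := g)) (edge_pmf 1 c)) {G. K \<subseteq> repeats (es @ [e]) G} \<le>
          prob (edge_pmf 1 c) (G ` set es)"
        unfolding measure_map_pmf vimage_def mem_Collect_eq ev
        by (intro measure_pmf.finite_measure_mono) auto
      \<comment> \<open>The fixed \<open>G\<close> may take the value \<open>None\<close> on
        \<open>es\<close>, but an edge of density 1 never does; discarding it leaves only genuine
        colours to be counted.\<close>
      also have "\<dots> = prob (edge_pmf 1 c) (G ` set es \<inter> set_pmf (edge_pmf 1 c))"
        by (simp add: measure_Int_set_pmf)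
      also have "\<dots> \<le> prob (edge_pmf 1 c) (G ` set es - {None})"
        using edge_pmf_1_not_None[OF snoc.prems(6)] by (intro measure_pmf.finite_measure_mono) auto
      also have "\<dots> \<le> card (G ` set es - {None}) / c"
        by (rule prob_edge_pmf_le[OF snoc.prems(6)]) auto
      also have "\<dots> \<le> N / c"
      proof (rule divide_right_mono)
        have "card (G ` set es - {None}) \<le> card (G ` set es)" by (intro card_mono) auto
        also have "\<dots> \<le> card (set es)" by (intro card_image_le) auto
        also have "\<dots> \<le> length es" by (rule card_length)
        finally show "real (card (G ` set es - {None})) \<le> real N" using snoc.prems(7) by simp
      qed simp
      finally show "prob (map_pmf (\<lambda>g. G(e := g)) (edge_pmf 1 c)) {G. K \<subseteq> repeats (es @ [e]) G} \<le> N / c" .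
    next
      fix G :: "'a \<Rightarrow> nat option" assume "G \<notin> {G. K' \<subseteq> repeats es G}"
      then show "prob (map_pmf (\<lambda>g. G(e := g)) (edge_pmf 1 c)) {G. K \<subseteq> repeats (es @ [e]) G} = 0"
        unfolding measure_map_pmf vimage_def mem_Collect_eq ev by simp
    qed
    also have "\<dots> \<le> (N / c) ^ card K' * (N / c)"
      by (intro mult_right_mono snoc.IH) (use snoc.prems P' K' in auto)
    also have "\<dots> = (N / c) ^ card K" using K'(3) by simp
    finally show ?thesis .
  qed
qed

section \<open>Expansion from local properties\<close>

lemma deg_eq:
  assumes "X \<subseteq> all_pairs V" "v \<in> V"
  shows "deg V X v = card {w. {v, w} \<in> X}"
proof -
  have "X \<inter> star V v = (\<lambda>w. {v, w}) ` {w. {v, w} \<in> X}"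
  proof
    show "X \<inter> star V v \<subseteq> (\<lambda>w. {v, w}) ` {w. {v, w} \<in> X}" unfolding star_def by auto
    show "(\<lambda>w. {v, w}) ` {w. {v, w} \<in> X} \<subseteq> X \<inter> star V v"
    proof
      fix e assume "e \<in> (\<lambda>w. {v, w}) ` {w. {v, w} \<in> X}"
      then obtain w where w: "e = {v, w}" "{v, w} \<in> X" by auto
      then have "{v, w} \<in> all_pairs V" using assms by auto
      then have "w \<in> V - {v}" unfolding all_pairs_def by (auto simp: doubleton_eq_iff)
      then show "e \<in> X \<inter> star V v" using w unfolding star_def by auto
    qed
  qed
  moreover have "inj_on (\<lambda>w. {v, w}) {w. {v, w} \<in> X}"
    by (intro inj_onI) (metis doubleton_eq_iff)
  ultimately show ?thesis unfolding deg_def by (simp add: card_image)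
qed

lemma sum_deg_le:
  assumes V: "finite V" and X: "X \<subseteq> all_pairs V" and S: "S \<subseteq> W" "W \<subseteq> V" and cl: "\<And>v w. v \<in> S \<Longrightarrow> {v, w} \<in> X \<Longrightarrow> w \<in> W"
  shows "(\<Sum>v\<in>S. deg V X v) \<le> 2 * card (X \<inter> all_pairs W)"
proof -
  have fin: "finite S" "finite W" using finite_subset[OF S(2) V] finite_subset[OF S(1)] by auto
  have fw: "finite {w. {v, w} \<in> X}" if "v \<in> S" for v
    by (rule finite_subset[OF _ fin(2)]) (use cl that in auto)
  have "(\<Sum>v\<in>S. deg V X v) = (\<Sum>v\<in>S. card {w. {v, w} \<in> X})"
    by (rule sum.cong[OF refl deg_eq[OF X]]) (use S in blast)
  also have "\<dots> = card (Sigma S (\<lambda>v. {w. {v, w} \<in> X}))"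
    using fin fw by (subst card_SigmaI) auto
  also have "\<dots> \<le> 2 * card ((\<lambda>(u, w). {u, w}) ` Sigma S (\<lambda>v. {w. {v, w} \<in> X}))"
    by (rule card_doubletons_ge) (use fin fw in auto)
  also have "\<dots> \<le> 2 * card (X \<inter> all_pairs W)"
  proof (intro mult_left_mono card_mono)
    show "finite (X \<inter> all_pairs W)" using finite_all_pairs[OF fin(2)] by simp
    show "(\<lambda>(u, w). {u, w}) ` Sigma S (\<lambda>v. {w. {v, w} \<in> X}) \<subseteq> X \<inter> all_pairs W"
    proof
      fix e assume "e \<in> (\<lambda>(u, w). {u, w}) ` Sigma S (\<lambda>v. {w. {v, w} \<in> X})"
      then obtain u w where uw: "e = {u, w}" "u \<in> S" "{u, w} \<in> X" by auto
      have "u \<in> W" "w \<in> W" using uw S cl by auto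
      moreover have "u \<noteq> w" using uw(3) X unfolding all_pairs_def by (auto simp: doubleton_eq_iff)
      ultimately show "e \<in> X \<inter> all_pairs W" using uw unfolding all_pairs_def by auto
    qed
  qed simp
  finally show ?thesis .
qed

text \<open>Sparseness gives the vertices of degree at least 31 fourfold expansion; the tree-like
  neighbourhoods of the low-degree vertices cost at most one neighbour per vertex.\<close>
lemma expander_of_local_properties:
  assumes V: "finite V" and T: "T \<subseteq> all_pairs V" and \<Gamma>: "\<Gamma> \<subseteq> T"
    and low: "\<And>v. v \<in> V \<inter> Low \<Longrightarrow> 2 \<le> deg V \<Gamma> v" and high: "\<And>v. v \<in> V - Low \<Longrightarrow> 31 \<le> deg V \<Gamma> v"
    and tree: "\<And>W. W \<subseteq> V \<Longrightarrow> card W \<le> 5 \<Longrightarrow> card (T \<inter> all_pairs W) + card (W \<inter> Low) \<le> card W"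
    and sparse: "\<And>W. W \<subseteq> V \<Longrightarrow> 1 \<le> card W \<Longrightarrow> card W \<le> w0 \<Longrightarrow> card (T \<inter> all_pairs W) < 3 * card W"
    and large: "\<And>S. S \<subseteq> V \<Longrightarrow> w0 < 5 * card S \<Longrightarrow> card S \<le> k \<Longrightarrow> 2 * card S \<le> card (nbh \<Gamma> S)"
  shows "expander V \<Gamma> k"
  unfolding expander_def
proof (intro allI impI)
  fix S assume S: "S \<subseteq> V" "S \<noteq> {} \<and> card S \<le> k"
  show "2 * card S \<le> card (nbh \<Gamma> S)"
  proof (cases "w0 < 5 * card S")
    case True
    then show ?thesis using large S by auto
  next
    case False
    have GV: "\<Gamma> \<subseteq> all_pairs V" using \<Gamma> T by auto
    have inV: "a \<in> V \<and> b \<in> V \<and> a \<noteq> b" if "{a, b} \<in> T" for a b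
      using that T unfolding all_pairs_def by (auto simp: doubleton_eq_iff)
    define nb where "nb v = {w. {v, w} \<in> \<Gamma>}" for v
    have nbT: "{v, w} \<in> T" "w \<in> V" "v \<in> V" "v \<noteq> w" if "w \<in> nb v" for v w
      using that \<Gamma> inV[of v w] unfolding nb_def by auto
    have fnb: "finite (nb v)" for v by (rule finite_subset[OF _ V]) (use nbT in auto)
    have dnb: "deg V \<Gamma> v = card (nb v)" if "v \<in> V" for v unfolding nb_def by (rule deg_eq[OF GV that])
    have treeFL: "card F + card L \<le> card W"
      if "W \<subseteq> V" "card W \<le> 5" "F \<subseteq> T" "F \<subseteq> all_pairs W" "L \<subseteq> W" "L \<subseteq> Low" for W F L
    proof -
      have fW: "finite W" using that V finite_subset by blast
      have "card F \<le> card (T \<inter> all_pairs W)" using that finite_all_pairs[OF fW] by (intro card_mono) auto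
      moreover have "card L \<le> card (W \<inter> Low)" using that fW by (intro card_mono) auto
      ultimately show ?thesis using tree[OF that(1,2)] by linarith
    qed
    \<comment> \<open>The six facts \<open>t2\<close> to \<open>t5\<close> exclude two low vertices
      joined by a path of at most four edges, and a low vertex on a triangle or 4-cycle: each
      configuration has more edges plus low vertices than vertices. The longest path has five
      vertices, hence the bound 5 in \<open>tree\<close>.\<close>
    have t2: False if "{a, b} \<in> T" "a \<in> Low" "b \<in> Low" for a b
    proof -
      have ab: "a \<in> V" "b \<in> V" "a \<noteq> b" using inV[OF that(1)] by auto
      have "card {{a, b}} + card {a, b} \<le> card {a, b}"
        by (rule treeFL) (use ab that in \<open>auto simp: all_pairs_def\<close>)
      then show False by simp
    qed
    have t3: False if "{a, b} \<in> T" "{b, c} \<in> T" "a \<noteq> c" "a \<in> Low" "c \<in> Low" for a b c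
    proof -
      have ab: "a \<in> V" "b \<in> V" "c \<in> V" "a \<noteq> b" "b \<noteq> c" using inV[OF that(1)] inV[OF that(2)] by auto
      have "card {{a, b}, {b, c}} + card {a, c} \<le> card {a, b, c}"
        by (rule treeFL) (use ab that in \<open>auto simp: all_pairs_def\<close>)
      then show False using ab that by (simp add: doubleton_eq_iff)
    qed
    have tri: False if "{a, b} \<in> T" "{b, c} \<in> T" "{a, c} \<in> T" "a \<in> Low" for a b c
    proof -
      have ab: "a \<in> V" "b \<in> V" "c \<in> V" "a \<noteq> b" "b \<noteq> c" "a \<noteq> c"
        using inV[OF that(1)] inV[OF that(2)] inV[OF that(3)] by auto
      have "card {{a, b}, {b, c}, {a, c}} + card {a} \<le> card {a, b, c}"
        by (rule treeFL) (use ab that in \<open>auto simp: all_pairs_def\<close>)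
      then show False using ab by (simp add: doubleton_eq_iff)
    qed
    have t4: False if "{a, b} \<in> T" "{b, c} \<in> T" "{c, d} \<in> T" "a \<noteq> c" "b \<noteq> d" "a \<noteq> d" "a \<in> Low" "d \<in> Low" for a b c d
    proof -
      have ab: "a \<in> V" "b \<in> V" "c \<in> V" "d \<in> V" "a \<noteq> b" "b \<noteq> c" "c \<noteq> d"
        using inV[OF that(1)] inV[OF that(2)] inV[OF that(3)] by auto
      have "card {{a, b}, {b, c}, {c, d}} + card {a, d} \<le> card {a, b, c, d}"
        by (rule treeFL) (use ab that in \<open>auto simp: all_pairs_def card_insert_if\<close>)
      then show False using ab that by (simp add: doubleton_eq_iff)
    qed
    have c4: False if "{a, b} \<in> T" "{b, c} \<in> T" "{c, d} \<in> T" "{d, a} \<in> T" "a \<noteq> c" "b \<noteq> d" "a \<in> Low" for a b c d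
    proof -
      have ab: "a \<in> V" "b \<in> V" "c \<in> V" "d \<in> V" "a \<noteq> b" "b \<noteq> c" "c \<noteq> d" "d \<noteq> a"
        using inV[OF that(1)] inV[OF that(2)] inV[OF that(3)] inV[OF that(4)] by auto
      have "card {{a, b}, {b, c}, {c, d}, {d, a}} + card {a} \<le> card {a, b, c, d}"
        by (rule treeFL) (use ab that in \<open>auto simp: all_pairs_def card_insert_if\<close>)
      then show False using ab that by (auto simp: doubleton_eq_iff)
    qed
    have t5: False if "{a, b} \<in> T" "{b, c} \<in> T" "{c, d} \<in> T" "{d, f} \<in> T" "distinct [a, b, c, d, f]" "a \<in> Low" "f \<in> Low" for a b c d f
    proof -
      have ab: "a \<in> V" "b \<in> V" "c \<in> V" "d \<in> V" "f \<in> V"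
        using inV[OF that(1)] inV[OF that(2)] inV[OF that(3)] inV[OF that(4)] by auto
      have ne: "a \<noteq> b" "a \<noteq> c" "a \<noteq> d" "a \<noteq> f" "b \<noteq> c" "b \<noteq> d" "b \<noteq> f" "c \<noteq> d" "c \<noteq> f" "d \<noteq> f" using that(5) by auto
      have "card {{a, b}, {b, c}, {c, d}, {d, f}} + card {a, f} \<le> card {a, b, c, d, f}"
        by (rule treeFL) (use ab ne that in \<open>auto simp: all_pairs_def card_insert_if\<close>)
      then show False using ne by (simp add: doubleton_eq_iff)
    qed
    define S0 S1 where "S0 = S \<inter> Low" and "S1 = S - Low"
    have fS: "finite S" "finite S0" "finite S1" using S V finite_subset unfolding S0_def S1_def by blast+
    have cS: "card S = card S0 + card S1"
      unfolding S0_def S1_def using fS(1) by (metis card_Int_Diff)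
    define Z where "Z = (\<Union>v\<in>S0. nb v)"
    define N1 where "N1 = (\<Union>v\<in>S1. nb v) - S1"
    have fZ: "finite Z" "finite N1" unfolding Z_def N1_def using fS fnb by auto
    have Zlow: "z \<notin> Low" if "z \<in> Z" for z
      using that t2 nbT(1) unfolding Z_def S0_def by blast
    have cZ: "2 * card S0 \<le> card Z"
    proof -
      have "card Z = (\<Sum>v\<in>S0. card (nb v))"
        unfolding Z_def
      proof (rule card_UN_disjoint)
        show "\<forall>i\<in>S0. \<forall>j\<in>S0. i \<noteq> j \<longrightarrow> nb i \<inter> nb j = {}"
        proof (intro ballI impI equals0I)
          fix i j w assume "i \<in> S0" "j \<in> S0" "i \<noteq> j" "w \<in> nb i \<inter> nb j"
          then show False using t3[of i w j] nbT(1)[of w i] nbT(1)[of w j]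
            unfolding S0_def by (auto simp: insert_commute)
        qed
      qed (use fS fnb in auto)
      moreover have "(\<Sum>v\<in>S0. 2) \<le> (\<Sum>v\<in>S0. card (nb v))"
      proof (rule sum_mono)
        fix v assume "v \<in> S0"
        then show "2 \<le> card (nb v)" using low[of v] dnb[of v] S unfolding S0_def by auto
      qed
      ultimately show ?thesis by simp
    qed
    \<comment> \<open>The origin of 31: otherwise \<open>W\<close> would have fewer than
      \<open>5 * card S1\<close> vertices, and the degree sum would be below
      \<open>2 * 3 * 5 * card S1 = 30 * card S1\<close>.\<close>
    have N1: "4 * card S1 \<le> card N1"
    proof (rule ccontr)
      assume lt: "\<not> ?thesis"
      then have S1: "card S1 > 0" by simp
      define W where "W = S1 \<union> N1"
      have WV: "W \<subseteq> V" unfolding W_def N1_def S1_def using S nbT(2) by auto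
      have cW: "card W < 5 * card S1" using card_Un_le[of S1 N1] lt unfolding W_def by linarith
      have cW1: "card S1 \<le> card W" unfolding W_def using fS fZ by (intro card_mono) auto
      have "31 * card S1 = (\<Sum>v\<in>S1. 31)" by simp
      also have "\<dots> \<le> (\<Sum>v\<in>S1. deg V \<Gamma> v)"
        using high S unfolding S1_def by (intro sum_mono) auto
      also have "\<dots> \<le> 2 * card (\<Gamma> \<inter> all_pairs W)"
        by (rule sum_deg_le[OF V GV _ WV]) (auto simp: W_def N1_def nb_def)
      also have "\<dots> \<le> 2 * card (T \<inter> all_pairs W)"
        using \<Gamma> finite_all_pairs[OF finite_subset[OF WV V]] by (intro mult_left_mono card_mono) auto
      also have "card (T \<inter> all_pairs W) < 3 * card W"
        using sparse[OF WV] cW cW1 S1 False cS by linarith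
      finally show False using cW by linarith
    qed
    \<comment> \<open>Two such neighbours of \<open>v\<close> would put a low vertex on a triangle
      or 4-cycle through \<open>v\<close>, or join two low vertices through \<open>v\<close> by a
      path of at most four edges.\<close>
    have few: "card (nb v \<inter> (S0 \<union> Z)) \<le> 1" if v: "v \<in> S1" for v
    proof -
      have vl: "v \<notin> Low" using v unfolding S1_def by auto
      have "x = y" if xy: "x \<in> nb v" "y \<in> nb v" "x \<in> S0 \<union> Z" "y \<in> S0 \<union> Z" for x y
      proof (rule ccontr)
        assume ne: "x \<noteq> y"
        have mixed: False if "a \<in> nb v" "b \<in> nb v" "a \<in> S0" "b \<in> Z" "a \<noteq> b" for a b
        proof -
          have va: "{v, a} \<in> T" "{v, b} \<in> T" "a \<in> Low" using nbT(1) that unfolding S0_def by auto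
          obtain l where l: "l \<in> S0" "{l, b} \<in> T" using \<open>b \<in> Z\<close> nbT(1) unfolding Z_def by blast
          then have ll: "l \<in> Low" unfolding S0_def by auto
          have bl: "b \<notin> Low" using Zlow that by auto
          show False
          proof (cases "l = a")
            case True
            then show False using tri[of a v b] va l by (simp add: insert_commute)
          next
            case False
            have "a \<noteq> b" "v \<noteq> l" using that vl ll by auto
            then show False using t4[of a v b l] va l False ll by (simp add: insert_commute)
          qed
        qed
        have v2: "{v, x} \<in> T" "{v, y} \<in> T" using nbT(1) xy by auto
        consider "x \<in> S0 \<and> y \<in> S0" | "x \<in> S0 \<and> y \<in> Z" | "x \<in> Z \<and> y \<in> S0" | "x \<in> Z \<and> y \<in> Z" using xy by auto
        then show False
        proof cases
          case 1
          then show False using t3[of x v y] v2 ne unfolding S0_def by (simp add: insert_commute)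
        next
          case 2 then show False using mixed[of x y] xy ne by auto
        next
          case 3 then show False using mixed[of y x] xy ne by auto
        next
          case 4
          obtain l where l: "l \<in> S0" "{l, x} \<in> T" using 4 nbT(1) unfolding Z_def by blast
          obtain m where m: "m \<in> S0" "{m, y} \<in> T" using 4 nbT(1) unfolding Z_def by blast
          have lm: "l \<in> Low" "m \<in> Low" using l m unfolding S0_def by auto
          have xyl: "x \<notin> Low" "y \<notin> Low" using Zlow 4 by auto
          show False
          proof (cases "l = m")
            case True
            have "l \<noteq> v" using lm vl by auto
            then show False using c4[of l x v y] l m v2 True ne lm by (simp add: insert_commute)
          next
            case False
            have "distinct [l, x, v, y, m]" using False ne lm vl xyl inV[OF v2(1)] inV[OF v2(2)] by auto
            then show False using t5[of l x v y m] l m v2 lm by (simp add: insert_commute)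
          qed
        qed
      qed
      then show ?thesis by (intro card_le_Suc0_iff_eq[THEN iffD2, unfolded One_nat_def[symmetric]]) (use fnb in auto)
    qed
    have cut: "card (N1 \<inter> (S0 \<union> Z)) \<le> card S1"
    proof -
      have "card (N1 \<inter> (S0 \<union> Z)) \<le> card (\<Union>v\<in>S1. nb v \<inter> (S0 \<union> Z))"
        using fS fnb unfolding N1_def by (intro card_mono) auto
      also have "\<dots> \<le> (\<Sum>v\<in>S1. card (nb v \<inter> (S0 \<union> Z)))" using fS by (intro card_UN_le) auto
      also have "\<dots> \<le> (\<Sum>v\<in>S1. 1)" by (rule sum_mono) (rule few)
      finally show ?thesis by simp
    qed
    \<comment> \<open>The two disjoint pieces have at least \<open>2 * card S0 - card S1\<close> and
      \<open>4 * card S1 - card S1\<close> vertices: the surplus in the expansion of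
      \<open>S1\<close> pays for both overlaps, and twice \<open>card S\<close> remains.\<close>
    have sub: "(Z - S1) \<union> (N1 - (S0 \<union> Z)) \<subseteq> nbh \<Gamma> S"
    proof
      fix w assume "w \<in> (Z - S1) \<union> (N1 - (S0 \<union> Z))"
      then show "w \<in> nbh \<Gamma> S"
      proof
        assume w: "w \<in> Z - S1"
        then obtain v where "v \<in> S0" "{v, w} \<in> \<Gamma>" unfolding Z_def nb_def by auto
        moreover have "w \<notin> S" using w Zlow unfolding S1_def by auto
        ultimately show ?thesis unfolding nbh_def S0_def by auto
      next
        assume w: "w \<in> N1 - (S0 \<union> Z)"
        then obtain v where "v \<in> S1" "{v, w} \<in> \<Gamma>" unfolding N1_def nb_def by auto
        moreover have "w \<notin> S" using w unfolding N1_def S0_def S1_def by auto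
        ultimately show ?thesis unfolding nbh_def S1_def by auto
      qed
    qed
    have "finite (nbh \<Gamma> S)"
      by (rule finite_subset[OF _ V]) (use inV \<Gamma> in \<open>auto simp: nbh_def\<close>)
    then have "card ((Z - S1) \<union> (N1 - (S0 \<union> Z))) \<le> card (nbh \<Gamma> S)" using sub by (intro card_mono) auto
    moreover have "card ((Z - S1) \<union> (N1 - (S0 \<union> Z))) = card (Z - S1) + card (N1 - (S0 \<union> Z))"
      using fZ by (intro card_Un_disjoint) auto
    moreover have "card Z - card S1 \<le> card (Z - S1)" by (rule diff_card_le_card_Diff[OF fS(3)])
    moreover have "card N1 \<le> card (N1 - (S0 \<union> Z)) + card (N1 \<inter> (S0 \<union> Z))"
      using card_Int_Diff[OF fZ(2), of "S0 \<union> Z"] by linarith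
    ultimately show ?thesis using cZ N1 cut cS by linarith
  qed
qed

text \<open>Edges of \<open>H\<close> are guaranteed to be in \<open>\<Gamma>\<close> only away from
  \<open>L1\<close>, so \<open>L1\<close> is removed from \<open>S\<close> and added to the set
  \<open>A\<close> to be left. If \<open>S\<close> had few neighbours, \<open>A\<close> would be
  small enough for \<open>cuts\<close>, and the edge found there would lead to a neighbour of
  \<open>S\<close> outside \<open>A\<close>.\<close>

lemma large_set_expansion:
  assumes V: "finite V" and \<Gamma>: "\<Gamma> \<subseteq> all_pairs V" and H: "\<And>e. e \<in> H \<Longrightarrow> e \<inter> L1 = {} \<Longrightarrow> e \<in> \<Gamma>"
    and cuts: "\<And>S A. S \<subseteq> A \<Longrightarrow> A \<subseteq> V \<Longrightarrow> x0 \<le> card S \<Longrightarrow> card A \<le> 8 * card S \<Longrightarrow> 4 * card A \<le> 3 * card V \<Longrightarrow> H \<inter> cut S (V - A) \<noteq> {}"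
    and L1: "L1 \<subseteq> V" "card L1 \<le> l1" "10 * l1 \<le> w0" "10 * x0 \<le> w0" "4 * (3 * k + l1) \<le> 3 * card V"
    and S: "S \<subseteq> V" "w0 < 5 * card S" "card S \<le> k"
  shows "2 * card S \<le> card (nbh \<Gamma> S)"
proof (rule ccontr)
  assume lt: "\<not> ?thesis"
  define X where "X = S - L1"
  define A where "A = S \<union> nbh \<Gamma> S \<union> L1"
  have fin: "finite S" "finite L1" using V S L1 finite_subset by blast+
  have nV: "nbh \<Gamma> S \<subseteq> V"
    using \<Gamma> unfolding nbh_def all_pairs_def by (force simp: doubleton_eq_iff)
  have cX: "card S - card L1 \<le> card X" unfolding X_def by (rule diff_card_le_card_Diff[OF fin(2)])
  have cA: "card A \<le> card S + card (nbh \<Gamma> S) + card L1"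
    unfolding A_def using card_Un_le[of "S \<union> nbh \<Gamma> S" L1] card_Un_le[of S "nbh \<Gamma> S"] by linarith
  have "H \<inter> cut X (V - A) \<noteq> {}"
  proof (rule cuts)
    show "X \<subseteq> A" unfolding X_def A_def by auto
    show "A \<subseteq> V" unfolding A_def using S nV L1 by auto
    show "x0 \<le> card X" using cX L1 S by linarith
    \<comment> \<open>From \<open>10 * l1 \<le> w0 < 5 * card S\<close> the set \<open>L1\<close>
      has less than half the size of \<open>S\<close>. So \<open>card A\<close> is below
      \<open>3.5 * card S\<close>, while \<open>8 * card X\<close> exceeds
      \<open>4 * card S\<close>.\<close>
    show "card A \<le> 8 * card X" using cX cA lt L1 S by linarith
    have "card A \<le> 3 * k + l1" using cA lt L1(2) S(3) by linarith
    then have "4 * card A \<le> 4 * (3 * k + l1)" by (rule mult_le_mono2)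
    then show "4 * card A \<le> 3 * card V" using L1(5) by (rule order_trans)
  qed
  then obtain a b where ab: "{a, b} \<in> H" "a \<in> X" "b \<in> V - A" unfolding cut_def by auto
  have "{a, b} \<in> \<Gamma>" by (rule H[OF ab(1)]) (use ab in \<open>auto simp: X_def A_def\<close>)
  then have "b \<in> nbh \<Gamma> S" using ab unfolding nbh_def X_def A_def by auto
  then show False using ab unfolding A_def by auto
qed

section \<open>The rainbow skeleton\<close>

definition cycle_edges :: "'a list \<Rightarrow> 'a set set" where
  "cycle_edges p = (\<lambda>k. {p ! k, p ! ((k + 1) mod length p)}) ` {..<length p}"

definition ham_cycles :: "'a set \<Rightarrow> 'a set set set" where
  "ham_cycles V = cycle_edges ` {p. distinct p \<and> set p = V \<and> length p \<ge> 3}"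

lemma ham_cycles_card: "C \<in> ham_cycles V \<Longrightarrow> finite C \<and> card C \<le> card V"
proof -
  assume "C \<in> ham_cycles V"
  then obtain p where p: "C = cycle_edges p" "distinct p" "set p = V" unfolding ham_cycles_def by blast
  have "card (cycle_edges p) \<le> card {..<length p}" unfolding cycle_edges_def by (rule card_image_le) simp
  then show ?thesis using p distinct_card[OF p(2)] by (simp add: cycle_edges_def)
qed

lemma cycle_edges_all_pairs:
  assumes "C \<in> ham_cycles V"
  shows "C \<subseteq> all_pairs V"
proof
  fix e assume "e \<in> C"
  then obtain p k where p: "distinct p" "set p = V" "length p \<ge> 3" and k: "k < length p"
    and e: "e = {p ! k, p ! ((k + 1) mod length p)}"
    using assms unfolding ham_cycles_def cycle_edges_def by blast
  have l: "(k + 1) mod length p < length p" using k by (intro mod_less_divisor) linarith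
  have "(k + 1) mod length p \<noteq> k" using k p(3) by (cases "k + 1 = length p") auto
  then have "p ! ((k + 1) mod length p) \<noteq> p ! k" using nth_eq_iff_index_eq[OF p(1) l k] by simp
  then show "e \<in> all_pairs V" unfolding e all_pairs_def using p(2) k l nth_mem by blast
qed

lemma ham_obtain_cycle:
  assumes "ham V E"
  shows "\<exists>C\<in>ham_cycles V. C \<subseteq> E"
proof -
  obtain p where p: "is_path E p" "set p = V" "length p \<ge> 3" "{last p, hd p} \<in> E" using assms unfolding ham_def by blast
  have "cycle_edges p \<subseteq> E"
  proof
    fix e assume "e \<in> cycle_edges p"
    then obtain k where k: "k < length p" "e = {p ! k, p ! ((k + 1) mod length p)}" unfolding cycle_edges_def by auto
    show "e \<in> E"
    proof (cases "k + 1 = length p")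
      case True
      have ne: "p \<noteq> []" using p(3) by auto
      have "p ! k = last p" using True ne by (simp add: last_conv_nth flip: True)
      moreover have "p ! ((k + 1) mod length p) = hd p" using True ne by (simp add: hd_conv_nth)
      ultimately show ?thesis using p(4) k by simp
    next
      case False
      then have "Suc k < length p" using k by simp
      then show ?thesis using p(1) k unfolding is_path_def successively_conv_nth by simp
    qed
  qed
  moreover have "cycle_edges p \<in> ham_cycles V" unfolding ham_cycles_def using p by (auto simp: is_path_def)
  ultimately show ?thesis by blast
qed

text \<open>\<open>has_rainbow_ham_cycle\<close> compares colours by position, \<open>hybrid\<close>
  by edge. Two positions with the same edge would be each other's successor modulo the length,
  impossible for length at least 3.\<close>

lemma cycle_edge_inj:
  assumes "distinct p" "length p \<ge> 3"
  shows "inj_on (\<lambda>k. {p ! k, p ! ((k + 1) mod length p)}) {..<length p}"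
proof (rule inj_onI)
  let ?m = "length p"
  fix i j assume ij: "i \<in> {..<?m}" "j \<in> {..<?m}" "{p ! i, p ! ((i + 1) mod ?m)} = {p ! j, p ! ((j + 1) mod ?m)}"
  have l: "(i + 1) mod ?m < ?m" "(j + 1) mod ?m < ?m" using assms(2) by (auto intro!: mod_less_divisor)
  have nth: "p ! a = p ! b \<longleftrightarrow> a = b" if "a < ?m" "b < ?m" for a b using nth_eq_iff_index_eq[OF assms(1) that] .
  have "i = j \<or> (i = (j + 1) mod ?m \<and> (i + 1) mod ?m = j)"
    using ij l nth unfolding doubleton_eq_iff by (metis lessThan_iff)
  moreover have "\<not> (i = (j + 1) mod ?m \<and> (i + 1) mod ?m = j)"
  proof
    assume a: "i = (j + 1) mod ?m \<and> (i + 1) mod ?m = j"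
    have "i < ?m" "j < ?m" using ij by auto
    then show False using a assms(2) by (cases "i + 1 = ?m"; cases "j + 1 = ?m") auto
  qed
  ultimately show "i = j" by blast
qed

lemma rainbow_of_hybrid:
  assumes "hybrid (ham_cycles {1..n}) {} G y"
  shows "has_rainbow_ham_cycle n G"
proof -
  obtain p where p: "distinct p" "set p = {1..n}" "length p \<ge> 3"
    and G: "\<forall>e\<in>cycle_edges p. G e \<noteq> None" "inj_on G (cycle_edges p)"
    using assms unfolding hybrid_def ham_cycles_def by auto
  have "inj_on (G \<circ> (\<lambda>k. {p ! k, p ! ((k + 1) mod length p)})) {..<length p}"
    using cycle_edge_inj[OF p(1,3)] G(2) unfolding cycle_edges_def by (rule comp_inj_on)
  then have "inj_on (\<lambda>k. G {p ! k, p ! ((k + 1) mod length p)}) {..<length p}" by (simp add: comp_def)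
  moreover have "\<forall>k<length p. G {p ! k, p ! ((k + 1) mod length p)} \<noteq> None"
    using G(1) unfolding cycle_edges_def by auto
  ultimately show ?thesis unfolding has_rainbow_ham_cycle_def using p by blast
qed

text \<open>Edges of type \<open>Some True\<close> have their colour revealed from the start, edges of type
  \<open>Some False\<close> are hidden unless they meet \<open>low1\<close>; \<open>y\<close> marks the surviving hidden edges.\<close>
locale typed_graph =
  fixes V :: "'a set" and D :: nat and t :: "'a set \<Rightarrow> bool option" and y :: "'a set \<Rightarrow> bool"
  assumes finV: "finite V"
begin

definition "T = {e \<in> all_pairs V. t e \<noteq> None}"
definition "U = {e \<in> all_pairs V. t e = Some True}"
definition "H = {e \<in> all_pairs V. t e = Some False \<and> y e}"
definition "low0 = {v \<in> V. deg V T v < D}"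
definition "low1 = {v \<in> V. deg V U v < D}"
text \<open>This set depends on \<open>t\<close> but not on the survival bits \<open>y\<close>, so
  the hidden set is fixed before the bits of the coupling are drawn. Vertices of \<open>low1\<close>
  have too few edges in \<open>U\<close> to rely on, hence all their first-round edges are
  revealed.\<close>

definition "revealed = {e \<in> T. t e = Some True \<or> e \<inter> low1 \<noteq> {}}"
definition "core = {e \<in> H. e \<inter> low1 = {}}"
text \<open>The vertices that the surviving hidden edges do not serve. They include vertices that
  had enough surviving edges but lost some because these meet \<open>low1\<close>.\<close>

definition "low = low1 \<union> {v \<in> V. deg V core v < 31}"
definition "cands = {e \<in> revealed. e \<inter> low \<noteq> {}}"
text \<open>Any order serves, as long as it does not depend on the colours: these are exposed one at
  a time along this list.\<close>

definition "cand_list = (SOME es. distinct es \<and> set es = cands)"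
definition "skeleton G = core \<union> (cands - repeats cand_list G)"

lemma T_sub: "T \<subseteq> all_pairs V" "finite T"
  unfolding T_def using finite_all_pairs[OF finV] by auto

lemma sub_T: "U \<subseteq> T" "H \<subseteq> T" "core \<subseteq> T" "cands \<subseteq> T" "revealed \<subseteq> T" "cands \<subseteq> revealed" "core \<subseteq> H"
  unfolding U_def H_def core_def cands_def revealed_def T_def by auto

lemma skeleton_T: "skeleton G \<subseteq> T"
  using sub_T unfolding skeleton_def by auto

lemma low_V: "low \<subseteq> V" "low0 \<subseteq> V" "low1 \<subseteq> V" "low1 \<subseteq> low" "finite low" "finite low1"
  using finV unfolding low_def low0_def low1_def by auto

lemma fin_star: "finite (X \<inter> star V v)"
  unfolding star_def using finV by auto

lemma deg_mono: "X \<subseteq> Y \<Longrightarrow> deg V X v \<le> deg V Y v"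
  unfolding deg_def using fin_star by (intro card_mono) auto

lemma low0_low1: "low0 \<subseteq> low1"
  unfolding low0_def low1_def using deg_mono[OF sub_T(1)] le_less_trans by blast

lemma cand_list: "distinct cand_list" "set cand_list = cands"
proof -
  have "finite cands" using sub_T(4) T_sub(2) by (rule finite_subset)
  then have "\<exists>es. distinct es \<and> set es = cands" using finite_distinct_list by metis
  from someI_ex[OF this] show "distinct cand_list" "set cand_list = cands" unfolding cand_list_def by auto
qed

lemma star_mem: "e \<in> star V v \<Longrightarrow> v \<in> e"
  unfolding star_def by auto

lemma edge_in_star:
  assumes "e \<in> all_pairs V" "v \<in> e"
  shows "e \<in> star V v"
proof -
  obtain a b where ab: "e = {a, b}" "a \<in> V" "b \<in> V" "a \<noteq> b" using assms(1) unfolding all_pairs_def by blast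
  show ?thesis
  proof (cases "v = a")
    case True then show ?thesis unfolding star_def ab using ab by auto
  next
    case False
    then have "v = b" using assms(2) ab by auto
    then show ?thesis unfolding star_def ab using ab by (intro image_eqI[of _ _ a]) auto
  qed
qed

lemma low1_cands: "v \<in> low1 \<Longrightarrow> T \<inter> star V v \<subseteq> cands"
  using low_V(4) star_mem unfolding cands_def revealed_def by blast

lemma low_cands: "v \<in> low \<Longrightarrow> U \<inter> star V v \<subseteq> cands"
  using sub_T(1) star_mem unfolding cands_def revealed_def U_def by blast

text \<open>A vertex of \<open>low1\<close> has all its edges of \<open>T\<close> among the
  candidates, any other vertex of \<open>low\<close> all its edges of \<open>U\<close>; either way
  there are at least \<open>D\<close>.\<close>

lemma cands_deg:
  assumes "v \<in> low" "v \<notin> low0"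
  shows "D \<le> deg V cands v"
proof (cases "v \<in> low1")
  case True
  have "D \<le> deg V T v" using assms low_V unfolding low0_def by auto
  also have "\<dots> \<le> deg V cands v"
    unfolding deg_def using low1_cands[OF True] fin_star by (intro card_mono) auto
  finally show ?thesis .
next
  case False
  have "D \<le> deg V U v" using assms False low_V unfolding low1_def by auto
  also have "\<dots> \<le> deg V cands v"
    unfolding deg_def using low_cands[OF assms(1)] fin_star by (intro card_mono) auto
  finally show ?thesis .
qed

lemma card_edges_at_le:
  assumes \<Delta>: "\<And>v. v \<in> V \<Longrightarrow> deg V T v \<le> \<Delta>" and S: "S \<subseteq> V" and X: "X \<subseteq> T" "\<And>e. e \<in> X \<Longrightarrow> e \<inter> S \<noteq> {}"
  shows "card X \<le> card S * \<Delta>"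
proof -
  have fS: "finite S" using S finV by (rule finite_subset)
  have "X \<subseteq> (\<Union>v\<in>S. T \<inter> star V v)"
  proof
    fix e assume e: "e \<in> X"
    then obtain v where v: "v \<in> e" "v \<in> S" using X(2) by blast
    have "e \<in> T" using e X(1) by auto
    then show "e \<in> (\<Union>v\<in>S. T \<inter> star V v)" using v edge_in_star T_sub(1) by blast
  qed
  then have "card X \<le> card (\<Union>v\<in>S. T \<inter> star V v)" using T_sub(2) by (intro card_mono) auto
  also have "\<dots> \<le> (\<Sum>v\<in>S. card (T \<inter> star V v))" using fS by (intro card_UN_le) auto
  also have "\<dots> \<le> (\<Sum>v\<in>S. \<Delta>)" using \<Delta> S unfolding deg_def by (intro sum_mono) auto
  finally show ?thesis by simp
qed

lemma card_T_le:
  assumes "\<And>v. v \<in> V \<Longrightarrow> deg V T v \<le> \<Delta>"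
  shows "card T \<le> card V * \<Delta>"
  by (rule card_edges_at_le[OF assms]) (use T_sub in \<open>auto simp: all_pairs_def\<close>)

lemma card_cands_le:
  assumes "\<And>v. v \<in> V \<Longrightarrow> deg V T v \<le> \<Delta>"
  shows "card cands \<le> card low * \<Delta>"
  by (rule card_edges_at_le[OF assms low_V(1) sub_T(4)]) (auto simp: cands_def)

text \<open>A vertex whose degree drops below 31 only in passing from \<open>H\<close> to
  \<open>core\<close> has lost an edge to \<open>low1\<close>, so it is one of the at most
  \<open>card low1 * \<Delta>\<close> neighbours of that set.\<close>

lemma card_low_le:
  assumes \<Delta>: "\<And>v. v \<in> V \<Longrightarrow> deg V T v \<le> \<Delta>"
  shows "card low \<le> card {v \<in> V. deg V H v < 31} + card low1 * (1 + \<Delta>)"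
proof -
  have fn: "finite {w. {u, w} \<in> T}" for u
    by (rule finite_subset[OF _ finV]) (use T_sub(1) in \<open>auto simp: all_pairs_def doubleton_eq_iff\<close>)
  have "low \<subseteq> {v \<in> V. deg V H v < 31} \<union> (low1 \<union> (\<Union>u\<in>low1. {w. {u, w} \<in> T}))"
  proof
    fix v assume v: "v \<in> low"
    show "v \<in> {v \<in> V. deg V H v < 31} \<union> (low1 \<union> (\<Union>u\<in>low1. {w. {u, w} \<in> T}))"
    proof (cases "v \<in> low1 \<or> deg V H v < 31")
      case True
      then show ?thesis using v low_V(1) by auto
    next
      case False
      then have "deg V core v < deg V H v" using v unfolding low_def by auto
      then have "\<not> H \<inter> star V v \<subseteq> core \<inter> star V v"
        using card_mono[OF fin_star] unfolding deg_def by (metis not_le)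
      then obtain e where e: "e \<in> H" "e \<in> star V v" "e \<inter> low1 \<noteq> {}" unfolding core_def by auto
      then obtain w where w: "e = {v, w}" unfolding star_def by auto
      then have "w \<in> low1" using e False by auto
      moreover have "{w, v} \<in> T" using e w sub_T(2) by (auto simp: insert_commute)
      ultimately show ?thesis by auto
    qed
  qed
  then have "card low \<le> card ({v \<in> V. deg V H v < 31} \<union> (low1 \<union> (\<Union>u\<in>low1. {w. {u, w} \<in> T})))"
    using finV low_V fn by (intro card_mono) auto
  also have "\<dots> \<le> card {v \<in> V. deg V H v < 31} + (card low1 + card (\<Union>u\<in>low1. {w. {u, w} \<in> T}))"
    using card_Un_le[of "{v \<in> V. deg V H v < 31}" "low1 \<union> (\<Union>u\<in>low1. {w. {u, w} \<in> T})"]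
      card_Un_le[of low1 "\<Union>u\<in>low1. {w. {u, w} \<in> T}"] by linarith
  also have "card (\<Union>u\<in>low1. {w. {u, w} \<in> T}) \<le> (\<Sum>u\<in>low1. card {w. {u, w} \<in> T})"
    using low_V by (intro card_UN_le) auto
  also have "\<dots> \<le> (\<Sum>u\<in>low1. \<Delta>)"
  proof (rule sum_mono)
    fix u assume "u \<in> low1"
    then have "u \<in> V" using low_V by auto
    then show "card {w. {u, w} \<in> T} \<le> \<Delta>" using \<Delta> deg_eq[OF T_sub(1)] by metis
  qed
  finally show ?thesis by (simp add: algebra_simps)
qed

text \<open>Vertices of \<open>low0\<close> may have degree as small as 2 and cannot afford any
  loss. The other vertices of \<open>low\<close> have \<open>D\<close> candidates and need only 31
  of them.\<close>

definition colours_ok :: "('a set \<Rightarrow> nat option) \<Rightarrow> bool" where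
  "colours_ok G \<longleftrightarrow> (\<forall>v\<in>low0. cands \<inter> star V v \<inter> repeats cand_list G = {}) \<and>
     (\<forall>v\<in>low - low0. 31 \<le> deg V (cands - repeats cand_list G) v)"

lemma skeleton_expander:
  assumes mindeg: "\<And>v. v \<in> V \<Longrightarrow> 2 \<le> deg V T v" and G: "colours_ok G"
    and tree: "\<And>W. W \<subseteq> V \<Longrightarrow> card W \<le> 5 \<Longrightarrow> card (T \<inter> all_pairs W) + card {v \<in> W. deg V T v < D} \<le> card W"
    and sparse: "\<And>W. W \<subseteq> V \<Longrightarrow> 1 \<le> card W \<Longrightarrow> card W \<le> w0 \<Longrightarrow> card (T \<inter> all_pairs W) < 3 * card W"
    and cuts: "\<And>S A. S \<subseteq> A \<Longrightarrow> A \<subseteq> V \<Longrightarrow> x0 \<le> card S \<Longrightarrow> card A \<le> 8 * card S \<Longrightarrow> 4 * card A \<le> 3 * card V \<Longrightarrow> H \<inter> cut S (V - A) \<noteq> {}"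
    and l1: "card low1 \<le> l1" "10 * l1 \<le> w0" "10 * x0 \<le> w0" "4 * (3 * k + l1) \<le> 3 * card V"
  shows "expander V (skeleton G) k"
proof (rule expander_of_local_properties[OF finV T_sub(1) skeleton_T, where Low = low0 and ?w0.0 = w0])
  fix v assume v: "v \<in> V \<inter> low0"
  then have vl: "v \<in> low1" using low0_low1 by auto
  have "T \<inter> star V v \<subseteq> skeleton G"
    using low1_cands[OF vl] v G unfolding colours_ok_def skeleton_def by blast
  then have "deg V T v \<le> deg V (skeleton G) v" unfolding deg_def using fin_star by (intro card_mono) auto
  then show "2 \<le> deg V (skeleton G) v" using mindeg[of v] v by auto
next
  fix v assume v: "v \<in> V - low0"
  show "31 \<le> deg V (skeleton G) v"
  proof (cases "v \<in> low")
    case True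
    then have "31 \<le> deg V (cands - repeats cand_list G) v" using v G unfolding colours_ok_def by auto
    also have "\<dots> \<le> deg V (skeleton G) v" by (rule deg_mono) (auto simp: skeleton_def)
    finally show ?thesis .
  next
    case False
    then have "31 \<le> deg V core v" using v unfolding low_def by auto
    also have "\<dots> \<le> deg V (skeleton G) v" by (rule deg_mono) (auto simp: skeleton_def)
    finally show ?thesis .
  qed
next
  fix W assume W: "W \<subseteq> V" "card W \<le> 5"
  have "W \<inter> low0 = {v \<in> W. deg V T v < D}" using W unfolding low0_def by auto
  then show "card (T \<inter> all_pairs W) + card (W \<inter> low0) \<le> card W" using tree[OF W] by simp
next
  fix S assume S: "S \<subseteq> V" "w0 < 5 * card S" "card S \<le> k"
  show "2 * card S \<le> card (nbh (skeleton G) S)"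
  proof (rule large_set_expansion[OF finV _ _ cuts low_V(3) l1 S])
    show "skeleton G \<subseteq> all_pairs V" using skeleton_T T_sub by blast
    show "\<And>e. e \<in> H \<Longrightarrow> e \<inter> low1 = {} \<Longrightarrow> e \<in> skeleton G" unfolding skeleton_def core_def by auto
  qed
qed (fact sparse)

text \<open>A candidate repeats an earlier colour with probability at most
  \<open>card cands / c\<close>. At a vertex of \<open>low0\<close> fewer than \<open>D\<close>
  edges are at risk. At another vertex of \<open>low\<close>, fix \<open>D\<close> candidates:
  keeping at most 30 of them means that some \<open>D - 30\<close> all repeat, and there are at most
  \<open>2 ^ D\<close> choices for these.\<close>

lemma prob_colours_bad:
  assumes c: "c > 0" and r: "\<And>e. e \<in> T \<Longrightarrow> r e = (1::real)" and D: "31 \<le> D"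
  shows "prob (Pi_pmf (all_pairs V) None (\<lambda>e. edge_pmf (r e) c)) {G. \<not> colours_ok G} \<le>
    card low0 * (D * (card cands / c)) + card V * (2 ^ D * (card cands / c) ^ (D - 30))"
proof -
  let ?M = "Pi_pmf (all_pairs V) None (\<lambda>e. edge_pmf (r e) c)" and ?q = "real (card cands) / c"
  have rep: "prob ?M {G. K \<subseteq> repeats cand_list G} \<le> ?q ^ card K" if "K \<subseteq> cands" for K
    by (rule prob_all_repeat_le[OF finite_all_pairs[OF finV] cand_list(1)])
      (use cand_list sub_T(4) T_sub r that c in \<open>auto simp: distinct_card[symmetric]\<close>)
  define S where "S v = (SOME S. S \<subseteq> cands \<inter> star V v \<and> card S = D)" for v
  have S: "S v \<subseteq> cands \<inter> star V v \<and> card (S v) = D" if v: "v \<in> low - low0" for v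
  proof -
    have "D \<le> card (cands \<inter> star V v)" using cands_deg v unfolding deg_def by auto
    then have "\<exists>S. S \<subseteq> cands \<inter> star V v \<and> card S = D" using obtain_subset_with_card_n by metis
    from someI_ex[OF this] show ?thesis unfolding S_def .
  qed
  define KK where "KK v = {K. K \<subseteq> S v \<and> card K = D - 30}" for v
  define B0 :: "('a set \<Rightarrow> nat option) set" where "B0 = {G. \<exists>v\<in>low0. \<exists>e\<in>T \<inter> star V v. e \<in> cands \<and> {e} \<subseteq> repeats cand_list G}"
  define B1 :: "('a set \<Rightarrow> nat option) set" where "B1 = {G. \<exists>v\<in>low - low0. \<exists>K\<in>KK v. K \<subseteq> repeats cand_list G}"
  have fS: "finite (S v)" if "v \<in> low - low0" for v
    using S[OF that] fin_star finite_subset by blast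
  have fK: "finite (KK v)" if "v \<in> low - low0" for v
    unfolding KK_def by (rule finite_subset[of _ "Pow (S v)"]) (use fS[OF that] in auto)
  have "{G. \<not> colours_ok G} \<subseteq> B0 \<union> B1"
  proof
    fix G assume "G \<in> {G. \<not> colours_ok G}"
    then consider v where "v \<in> low0" "cands \<inter> star V v \<inter> repeats cand_list G \<noteq> {}"
      | v where "v \<in> low - low0" "\<not> 31 \<le> deg V (cands - repeats cand_list G) v"
      unfolding colours_ok_def by blast
    then show "G \<in> B0 \<union> B1"
    proof cases
      case 1
      then show ?thesis using sub_T(4) unfolding B0_def by blast
    next
      case 2
      have "card (S v - repeats cand_list G) \<le> deg V (cands - repeats cand_list G) v"
        unfolding deg_def using S[OF 2(1)] fin_star by (intro card_mono) auto
      moreover have "card (S v) = card (S v \<inter> repeats cand_list G) + card (S v - repeats cand_list G)"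
        using card_Int_Diff[OF fS[OF 2(1)], of "repeats cand_list G"] by simp
      ultimately have "D - 30 \<le> card (S v \<inter> repeats cand_list G)" using 2(2) S[OF 2(1)] by linarith
      then obtain K where "K \<subseteq> S v \<inter> repeats cand_list G" "card K = D - 30"
        by (rule obtain_subset_with_card_n)
      then show ?thesis using 2(1) unfolding B1_def KK_def by blast
    qed
  qed
  then have "prob ?M {G. \<not> colours_ok G} \<le> prob ?M (B0 \<union> B1)"
    by (intro measure_pmf.finite_measure_mono) auto
  also have "\<dots> \<le> prob ?M B0 + prob ?M B1" by (intro measure_Un_le) auto
  also have "prob ?M B0 \<le> (\<Sum>v\<in>low0. D * ?q)"
    unfolding B0_def
  proof (rule order_trans[OF prob_ex_le_sum sum_mono])
    show "finite low0" using low_V(2) finV by (rule finite_subset)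
    fix v assume v: "v \<in> low0"
    have "prob ?M {G. \<exists>e\<in>T \<inter> star V v. e \<in> cands \<and> {e} \<subseteq> repeats cand_list G} \<le>
        (\<Sum>e\<in>T \<inter> star V v. prob ?M {G. e \<in> cands \<and> {e} \<subseteq> repeats cand_list G})"
      by (rule prob_ex_le_sum[OF fin_star])
    also have "\<dots> \<le> (\<Sum>e\<in>T \<inter> star V v. ?q)"
    proof (rule sum_mono)
      fix e
      show "prob ?M {G. e \<in> cands \<and> {e} \<subseteq> repeats cand_list G} \<le> ?q"
        using rep[of "{e}"] by (cases "e \<in> cands") auto
    qed
    also have "\<dots> = deg V T v * ?q" unfolding deg_def by simp
    also have "\<dots> \<le> D * ?q" using v unfolding low0_def by (intro mult_right_mono) auto
    finally show "prob ?M {G. \<exists>e\<in>T \<inter> star V v. e \<in> cands \<and> {e} \<subseteq> repeats cand_list G} \<le> D * ?q" .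
  qed
  also have "(\<Sum>v\<in>low0. D * ?q) = card low0 * (D * ?q)" by simp
  also have "prob ?M B1 \<le> (\<Sum>v\<in>low - low0. 2 ^ D * ?q ^ (D - 30))"
    unfolding B1_def
  proof (rule order_trans[OF prob_ex_le_sum sum_mono])
    show "finite (low - low0)" using low_V by auto
    fix v assume v: "v \<in> low - low0"
    have "prob ?M {G. \<exists>K\<in>KK v. K \<subseteq> repeats cand_list G} \<le>
        (\<Sum>K\<in>KK v. prob ?M {G. K \<subseteq> repeats cand_list G})"
      by (rule prob_ex_le_sum[OF fK[OF v]])
    also have "\<dots> \<le> (\<Sum>K\<in>KK v. ?q ^ (D - 30))"
    proof (rule sum_mono)
      fix K assume "K \<in> KK v"
      then show "prob ?M {G. K \<subseteq> repeats cand_list G} \<le> ?q ^ (D - 30)"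
        using rep[of K] S[OF v] unfolding KK_def by auto
    qed
    also have "\<dots> = card (KK v) * ?q ^ (D - 30)" by simp
    also have "\<dots> \<le> 2 ^ D * ?q ^ (D - 30)"
    proof (rule mult_right_mono)
      have "card (KK v) \<le> card (Pow (S v))"
        unfolding KK_def using fS[OF v] by (intro card_mono) auto
      also have "\<dots> = 2 ^ D" using S[OF v] fS[OF v] by (simp add: card_Pow)
      finally show "real (card (KK v)) \<le> 2 ^ D" by (metis of_nat_le_iff of_nat_numeral of_nat_power)
    qed simp
    finally show "prob ?M {G. \<exists>K\<in>KK v. K \<subseteq> repeats cand_list G} \<le> 2 ^ D * ?q ^ (D - 30)" .
  qed
  also have "\<dots> = card (low - low0) * (2 ^ D * ?q ^ (D - 30))" by simp
  also have "\<dots> \<le> card V * (2 ^ D * ?q ^ (D - 30))"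
    using low_V finV by (intro mult_right_mono) (auto intro!: card_mono)
  finally show ?thesis by simp
qed

text \<open>A revealed edge of the cycle lies neither in \<open>core\<close> nor outside
  \<open>T\<close>, so it is a candidate that is the first of its colour; hence the visible edges
  are rainbow. Every other edge of the cycle carries a survival bit.\<close>

lemma hybrid_of_ham:
  assumes ham: "ham V (skeleton G \<union> {e \<in> all_pairs V - T. y' e})"
    and G: "\<And>e. e \<in> T \<Longrightarrow> G e \<noteq> None" and y': "\<And>e. e \<in> T \<Longrightarrow> y' e = y e"
  shows "hybrid (ham_cycles V) (all_pairs V - revealed) G y'"
proof -
  obtain C where C: "C \<in> ham_cycles V" "C \<subseteq> skeleton G \<union> {e \<in> all_pairs V - T. y' e}"
    using ham_obtain_cycle[OF ham] by blast
  have core: "core \<inter> revealed = {}" unfolding core_def H_def revealed_def by auto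
  have vis: "C - (all_pairs V - revealed) \<subseteq> cands - repeats cand_list G"
    using C cycle_edges_all_pairs[OF C(1)] core sub_T(5) unfolding skeleton_def by blast
  have "\<forall>e\<in>C - (all_pairs V - revealed). G e \<noteq> None"
    using vis G sub_T(4) by blast
  moreover have "inj_on G (C - (all_pairs V - revealed))"
    using inj_on_subset[OF inj_on_non_repeats[of G cand_list], OF vis[folded cand_list(2)]] .
  moreover have "\<forall>e\<in>C \<inter> (all_pairs V - revealed). y' e"
  proof
    fix e assume e: "e \<in> C \<inter> (all_pairs V - revealed)"
    then have "e \<in> core \<or> e \<in> {e \<in> all_pairs V - T. y' e}" using C(2) sub_T(6) unfolding skeleton_def by blast
    then show "y' e"
    proof
      assume "e \<in> core"
      then have "y e" "e \<in> T" using sub_T(3) unfolding core_def H_def by auto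
      then show ?thesis using y' by simp
    qed simp
  qed
  ultimately show ?thesis unfolding hybrid_def using C(1) by blast
qed

end

section \<open>The probability of a rainbow Hamilton cycle\<close>

definition type_pmf :: "real \<Rightarrow> bool option pmf" where
  "type_pmf p1 = bind_pmf (bernoulli_pmf p1) (\<lambda>b. if b then map_pmf Some (bernoulli_pmf (1 / 2)) else return_pmf None)"

lemma pmf_type_pmf:
  assumes "0 \<le> p1" "p1 \<le> 1"
  shows "pmf (type_pmf p1) None = 1 - p1" "pmf (type_pmf p1) (Some b) = p1 / 2"
proof -
  have "pmf (map_pmf Some (bernoulli_pmf (1 / 2))) None = (0 :: real)" by (rule pmf_map_outside) auto
  then show "pmf (type_pmf p1) None = 1 - p1" unfolding type_pmf_def using assms by (simp add: pmf_bind)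
  have "pmf (map_pmf Some (bernoulli_pmf (1 / 2))) (Some b) = pmf (bernoulli_pmf (1 / 2)) b"
    by (rule pmf_map_inj') simp
  then show "pmf (type_pmf p1) (Some b) = p1 / 2" unfolding type_pmf_def using assms by (simp add: pmf_bind)
qed

lemma Pi_pmf_pair:
  assumes "finite A"
  shows "Pi_pmf A (d1, d2) (\<lambda>e. pair_pmf (p e) (q e)) =
    map_pmf (\<lambda>(f, g) e. if e \<in> A then (f e, g e) else (d1, d2)) (pair_pmf (Pi_pmf A d1 p) (Pi_pmf A d2 q))"
proof -
  have "Pi_pmf A (d1, d2) (\<lambda>e. pair_pmf (p e) (q e)) =
      bind_pmf (Pi_pmf A d1 p) (\<lambda>f. Pi_pmf A (d1, d2) (\<lambda>e. bind_pmf (q e) (\<lambda>b. return_pmf (f e, b))))"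
    unfolding pair_pmf_def by (rule Pi_pmf_bind[OF assms])
  also have "\<dots> = bind_pmf (Pi_pmf A d1 p) (\<lambda>f. bind_pmf (Pi_pmf A d2 q) (\<lambda>g. return_pmf (\<lambda>e. if e \<in> A then (f e, g e) else (d1, d2))))"
    using assms by (subst Pi_pmf_bind[where d' = d2]) auto
  finally show ?thesis by (simp add: map_pmf_def pair_pmf_def bind_assoc_pmf bind_return_pmf)
qed

lemma prob_or_le:
  "prob M {x. P x} \<le> a \<Longrightarrow> prob M {x. Q x} \<le> b \<Longrightarrow> prob M {x. P x \<or> Q x} \<le> a + b"
  using measure_Un_le[of "{x. P x}" "measure_pmf M" "{x. Q x}"] by (simp add: Collect_disj_eq)

lemma set_Pi_pmf_component:
  assumes "finite A" "f \<in> set_pmf (Pi_pmf A d p)" "x \<in> A"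
  shows "f x \<in> set_pmf (p x)"
  using assms by (auto simp: set_Pi_pmf PiE_dflt_def)

text \<open>The failure events that do not involve colours, in the order of the eight error terms of
  \<open>prob_bad_types\<close>.\<close>

definition bad_types :: "nat set \<Rightarrow> nat \<Rightarrow> nat \<Rightarrow> nat \<Rightarrow> nat \<Rightarrow> real \<Rightarrow> real \<Rightarrow> nat set set \<Rightarrow> nat set set \<Rightarrow> nat set set \<Rightarrow> bool" where
  "bad_types V D \<Delta> w0 x0 a0 a1 T U H \<longleftrightarrow>
     (\<exists>v\<in>V. deg V T v < 2) \<or>
     (\<exists>W\<subseteq>V. card W \<le> 5 \<and> card W < card (T \<inter> all_pairs W) + card {v \<in> W. deg V T v < D}) \<or>
     (\<exists>W\<subseteq>V. 1 \<le> card W \<and> card W \<le> w0 \<and> 3 * card W \<le> card (T \<inter> all_pairs W)) \<or>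
     (\<exists>v\<in>V. \<Delta> \<le> deg V T v) \<or>
     a0 \<le> card {v \<in> V. deg V T v < D} \<or>
     a1 \<le> card {v \<in> V. deg V U v < D} \<or>
     a1 \<le> card {v \<in> V. deg V H v < 31} \<or>
     (\<exists>S A. S \<subseteq> A \<and> A \<subseteq> V \<and> x0 \<le> card S \<and> card A \<le> 8 * card S \<and> 4 * card A \<le> 3 * card V \<and> H \<inter> cut S (V - A) = {})"

text \<open>The three graphs are dependent, but marginal laws suffice because the failure events are
  combined by a union bound.\<close>

lemma type_laws:
  fixes p1 \<beta> :: real and V :: "'a set"
  assumes V: "finite V" and p1: "0 \<le> p1" "p1 \<le> 1" and \<beta>: "0 \<le> \<beta>" "\<beta> \<le> 1"
  defines "M \<equiv> pair_pmf (Pi_pmf (all_pairs V) None (\<lambda>_. type_pmf p1)) (Pi_pmf (all_pairs V) False (\<lambda>_. bernoulli_pmf \<beta>))"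
  shows "map_pmf (\<lambda>(t, y). typed_graph.T V t) M = rsub (all_pairs V) p1"
    and "map_pmf (\<lambda>(t, y). typed_graph.U V t) M = rsub (all_pairs V) (p1 / 2)"
    and "map_pmf (\<lambda>(t, y). typed_graph.H V t y) M = rsub (all_pairs V) (p1 * \<beta> / 2)"
proof -
  let ?P = "all_pairs V"
  note fP = finite_all_pairs[OF V]
  have tg: "typed_graph V" using V by unfold_locales
  note defs = typed_graph.T_def[OF tg] typed_graph.U_def[OF tg] typed_graph.H_def[OF tg]
  have "map_pmf (\<lambda>(t, y). typed_graph.T V t) M = map_pmf (\<lambda>t. {e \<in> ?P. t e \<noteq> None}) (map_pmf fst M)"
    unfolding defs map_pmf_comp by (simp add: case_prod_unfold)
  also have "map_pmf fst M = Pi_pmf ?P None (\<lambda>_. type_pmf p1)" unfolding M_def by (rule map_fst_pair_pmf)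
  also have "map_pmf (\<lambda>t. {e \<in> ?P. t e \<noteq> None}) \<dots> = rsub ?P p1"
  proof (rule rsub_of_Pi[OF fP])
    have "prob (type_pmf p1) (- {None}) = p1"
      using measure_pmf.prob_compl[of "{None}" "type_pmf p1"] pmf_type_pmf(1)[OF p1]
      by (simp add: Compl_eq_Diff_UNIV measure_pmf_single)
    then show "prob (type_pmf p1) {x. x \<noteq> None} = p1" by (simp add: Compl_eq)
  qed
  finally show "map_pmf (\<lambda>(t, y). typed_graph.T V t) M = rsub (all_pairs V) p1" .
  have "map_pmf (\<lambda>(t, y). typed_graph.U V t) M = map_pmf (\<lambda>t. {e \<in> ?P. t e = Some True}) (map_pmf fst M)"
    unfolding defs map_pmf_comp by (simp add: case_prod_unfold)
  also have "map_pmf fst M = Pi_pmf ?P None (\<lambda>_. type_pmf p1)" unfolding M_def by (rule map_fst_pair_pmf)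
  also have "map_pmf (\<lambda>t. {e \<in> ?P. t e = Some True}) \<dots> = rsub ?P (p1 / 2)"
    by (rule rsub_of_Pi[OF fP]) (use pmf_type_pmf(2)[OF p1] in \<open>simp add: measure_pmf_single\<close>)
  finally show "map_pmf (\<lambda>(t, y). typed_graph.U V t) M = rsub (all_pairs V) (p1 / 2)" .
  let ?h = "\<lambda>z :: bool option \<times> bool. fst z = Some False \<and> snd z"
  have "rsub ?P (p1 * \<beta> / 2) = map_pmf (\<lambda>\<omega>. {e \<in> ?P. ?h (\<omega> e)}) (Pi_pmf ?P (None, False) (\<lambda>_. pair_pmf (type_pmf p1) (bernoulli_pmf \<beta>)))"
  proof (rule rsub_of_Pi[OF fP, symmetric])
    have "{x. ?h x} = {Some False} \<times> {True}" by auto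
    then have "prob (pair_pmf (type_pmf p1) (bernoulli_pmf \<beta>)) {x. ?h x} =
        prob (type_pmf p1) {Some False} * prob (bernoulli_pmf \<beta>) {True}"
      by (simp only: measure_pmf_prob_product countableI_type)
    then show "prob (pair_pmf (type_pmf p1) (bernoulli_pmf \<beta>)) {x. ?h x} = p1 * \<beta> / 2"
      using pmf_type_pmf(2)[OF p1] \<beta> by (simp add: measure_pmf_single)
  qed
  also have "\<dots> = map_pmf (\<lambda>(t, y). typed_graph.H V t y) M"
    unfolding Pi_pmf_pair[OF fP] M_def map_pmf_comp defs
    by (intro map_pmf_cong refl) (auto simp: case_prod_unfold)
  finally show "map_pmf (\<lambda>(t, y). typed_graph.H V t y) M = rsub (all_pairs V) (p1 * \<beta> / 2)" by (rule sym)
qed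

lemma prob_bad_types:
  fixes n D \<Delta> w0 x0 :: nat and p1 \<beta> y yx a0 a1 \<rho> :: real
  assumes n: "n \<ge> 1" and p1: "0 < p1" "p1 \<le> 1" and \<beta>: "0 \<le> \<beta>" "\<beta> \<le> 1"
    and y: "0 < y" "y \<le> 1" and yx: "0 < yx" "yx \<le> 1" "yx * n \<le> x0" "1 \<le> x0"
    and a: "0 < a0" "0 < a1"
    and \<rho>: "p1 \<le> \<rho>" "(1 / y) ^ D * exp (- p1 * (1 - y) * real (n - 5)) \<le> \<rho>" "1 \<le> n * \<rho>"
    and w0: "p1 * w0 \<le> 1" "w0 \<le> n" "exp 2 * n * p1 ^ 3 * (real w0)\<^sup>2 \<le> 1 / 2"
    and ex: "exp 2 * (1 / yx) ^ 9 * exp (- (p1 * \<beta> / 2) * n / 4) \<le> 1 / 2"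
  defines "M \<equiv> pair_pmf (Pi_pmf (all_pairs {1..n}) None (\<lambda>_. type_pmf p1)) (Pi_pmf (all_pairs {1..n}) False (\<lambda>_. bernoulli_pmf \<beta>))"
  shows "prob M {(t, z). bad_types {1..n} D \<Delta> w0 x0 a0 a1
      (typed_graph.T {1..n} t) (typed_graph.U {1..n} t) (typed_graph.H {1..n} t z)} \<le>
    n * ((1 + n * p1) * exp (2 - p1 * n)) +
    (2 ^ 37 * \<rho> * (exp 1 * (n * \<rho>) ^ 5) +
    (2 * (exp 2 * n * p1 ^ 3 * (real w0)\<^sup>2) +
    (n * exp (3 * p1 * n - \<Delta>) +
    (n * ((1 / y) ^ D * exp (- p1 * (1 - y) * real (n - 1))) / a0 +
    (n * ((1 / y) ^ D * exp (- (p1 / 2) * (1 - y) * real (n - 1))) / a1 +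
    (n * ((1 / y) ^ 31 * exp (- (p1 * \<beta> / 2) * (1 - y) * real (n - 1))) / a1 +
     2 * (exp 2 * (1 / yx) ^ 9 * exp (- (p1 * \<beta> / 2) * n / 4))))))))"
proof -
  let ?V = "{1..n}"
  have V: "finite ?V" "?V \<noteq> {}" "card ?V = n" using n by auto
  note laws = type_laws[OF V(1) less_imp_le[OF p1(1)] p1(2) \<beta>, folded M_def]
  have pT: "prob M {z. Q (typed_graph.T ?V (fst z))} = prob (rsub (all_pairs ?V) p1) {X. Q X}" for Q
    unfolding laws(1)[symmetric] by (simp add: measure_map_pmf vimage_def case_prod_unfold)
  have pU: "prob M {z. Q (typed_graph.U ?V (fst z))} = prob (rsub (all_pairs ?V) (p1 / 2)) {X. Q X}" for Q
    unfolding laws(2)[symmetric] by (simp add: measure_map_pmf vimage_def case_prod_unfold)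
  have pH: "prob M {z. Q (typed_graph.H ?V (fst z) (snd z))} = prob (rsub (all_pairs ?V) (p1 * \<beta> / 2)) {X. Q X}" for Q
    unfolding laws(3)[symmetric] by (simp add: measure_map_pmf vimage_def case_prod_unfold)
  have b: "0 \<le> p1 * \<beta> / 2" "p1 * \<beta> / 2 \<le> 1" using p1 \<beta> mult_mono[of p1 1 \<beta> 1] by auto
  have p10: "0 \<le> p1" "0 \<le> p1 / 2" "p1 / 2 \<le> 1" using p1 by auto
  show ?thesis
    unfolding bad_types_def case_prod_unfold
  proof (intro prob_or_le)
    show "prob M {x. \<exists>v\<in>?V. deg ?V (typed_graph.T ?V (fst x)) v < 2} \<le> n * ((1 + n * p1) * exp (2 - p1 * n))"
      unfolding pT[of "\<lambda>T. \<exists>v\<in>?V. deg ?V T v < 2"]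
      using rsub_min_degree[OF V(1) p10(1) p1(2)] V(3) by simp
    show "prob M {x. \<exists>W\<subseteq>?V. card W \<le> 5 \<and> card W < card (typed_graph.T ?V (fst x) \<inter> all_pairs W) +
        card {v \<in> W. deg ?V (typed_graph.T ?V (fst x)) v < D}} \<le> 2 ^ 37 * \<rho> * (exp 1 * (n * \<rho>) ^ 5)"
      unfolding pT[of "\<lambda>T. \<exists>W\<subseteq>?V. card W \<le> 5 \<and> card W < card (T \<inter> all_pairs W) + card {v \<in> W. deg ?V T v < D}"]
      using rsub_small_sets_tree_like[OF V(1) p10(1) p1(2) y \<rho>(1), of D] V(3) \<rho> by simp
    show "prob M {x. \<exists>W\<subseteq>?V. 1 \<le> card W \<and> card W \<le> w0 \<and> 3 * card W \<le> card (typed_graph.T ?V (fst x) \<inter> all_pairs W)}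
        \<le> 2 * (exp 2 * n * p1 ^ 3 * (real w0)\<^sup>2)"
      unfolding pT[of "\<lambda>T. \<exists>W\<subseteq>?V. 1 \<le> card W \<and> card W \<le> w0 \<and> 3 * card W \<le> card (T \<inter> all_pairs W)"]
      using rsub_locally_sparse[OF V(1,2) p1 w0(1)] V(3) w0 by simp
    show "prob M {x. \<exists>v\<in>?V. \<Delta> \<le> deg ?V (typed_graph.T ?V (fst x)) v} \<le> n * exp (3 * p1 * n - \<Delta>)"
      unfolding pT[of "\<lambda>T. \<exists>v\<in>?V. \<Delta> \<le> deg ?V T v"]
      using rsub_max_degree[OF V(1) p10(1) p1(2)] V(3) by simp
    show "prob M {x. a0 \<le> card {v \<in> ?V. deg ?V (typed_graph.T ?V (fst x)) v < D}} \<le>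
        n * ((1 / y) ^ D * exp (- p1 * (1 - y) * real (n - 1))) / a0"
      unfolding pT[of "\<lambda>T. a0 \<le> card {v \<in> ?V. deg ?V T v < D}"]
      using rsub_many_low[OF V(1) p10(1) p1(2) y a(1)] V(3) by simp
    show "prob M {x. a1 \<le> card {v \<in> ?V. deg ?V (typed_graph.U ?V (fst x)) v < D}} \<le>
        n * ((1 / y) ^ D * exp (- (p1 / 2) * (1 - y) * real (n - 1))) / a1"
      unfolding pU[of "\<lambda>T. a1 \<le> card {v \<in> ?V. deg ?V T v < D}"]
      using rsub_many_low[OF V(1) p10(2,3) y a(2)] V(3) by simp
    show "prob M {x. a1 \<le> card {v \<in> ?V. deg ?V (typed_graph.H ?V (fst x) (snd x)) v < 31}} \<le>
        n * ((1 / y) ^ 31 * exp (- (p1 * \<beta> / 2) * (1 - y) * real (n - 1))) / a1"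
      unfolding pH[of "\<lambda>T. a1 \<le> card {v \<in> ?V. deg ?V T v < 31}"]
      using rsub_many_low[OF V(1) b y a(2), of 31] V(3) by simp
    show "prob M {x. \<exists>S A. S \<subseteq> A \<and> A \<subseteq> ?V \<and> x0 \<le> card S \<and> card A \<le> 8 * card S \<and> 4 * card A \<le> 3 * card ?V \<and>
        typed_graph.H ?V (fst x) (snd x) \<inter> cut S (?V - A) = {}} \<le> 2 * (exp 2 * (1 / yx) ^ 9 * exp (- (p1 * \<beta> / 2) * n / 4))"
      unfolding pH[of "\<lambda>H. \<exists>S A. S \<subseteq> A \<and> A \<subseteq> ?V \<and> x0 \<le> card S \<and> card A \<le> 8 * card S \<and> 4 * card A \<le> 3 * card ?V \<and> H \<inter> cut S (?V - A) = {}"]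
      using rsub_large_expansion[OF V(1) b yx(1,2), of x0] V(3) yx ex by simp
  qed
qed

text \<open>The order of exposure is: types, survival bits of the first round, colours, survival
  bits of the second round. Each stage is analysed given that the earlier ones went well; the
  summands of the error are \<open>\<rho>1\<close> for types and first bits, two terms for colours,
  and one for the sprinkling.\<close>

lemma prob_rainbow_ge:
  fixes n c D \<Delta> w0 x0 l1 b :: nat and p p1 r \<beta> qs ys a0 a1 \<rho>1 :: real
  assumes n: "n \<ge> 30" and c: "c > 0" and D: "31 \<le> D"
    and p: "0 \<le> p" "p \<le> 1" and p1: "0 \<le> p1" "p1 \<le> 1" and r: "0 \<le> r" "r \<le> 1" "(1 - p1) * (1 - r) = 1 - p"
    and \<beta>: "0 \<le> \<beta>" "\<beta> \<le> 1" "\<beta> \<le> 1 - (real n - 1) / c" and qs: "0 \<le> qs" "qs \<le> 1" "qs \<le> \<beta> * r"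
    and ys: "0 < ys" "ys \<le> 1" and a: "0 < a0" "0 < a1"
    and l1: "a1 \<le> l1" "10 * l1 \<le> w0" "10 * x0 \<le> w0" "4 * (3 * (n div 5) + l1) \<le> 3 * n"
    and b: "2 * (b + n * \<Delta>) \<le> (Suc (n div 5))\<^sup>2"
    and bad: "prob (pair_pmf (Pi_pmf (all_pairs {1..n}) None (\<lambda>_. type_pmf p1)) (Pi_pmf (all_pairs {1..n}) False (\<lambda>_. bernoulli_pmf \<beta>)))
      {(t, z). bad_types {1..n} D \<Delta> w0 x0 a0 a1
      (typed_graph.T {1..n} t) (typed_graph.U {1..n} t) (typed_graph.H {1..n} t z)} \<le> \<rho>1"
  defines "N \<equiv> a1 * (2 + \<Delta>) * \<Delta>"
  shows "1 - (\<rho>1 + (a0 * (D * (N / c)) + n * (2 ^ D * (N / c) ^ (D - 30)) + exp (qs * ys * (real n)\<^sup>2) / ys ^ n * exp (- qs * b))) \<le>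
    prob (Gc n c p) {G. has_rainbow_ham_cycle n G}"
proof -
  let ?V = "{1..n}" and ?P = "all_pairs {1..n}"
  let ?C = "ham_cycles ?V"
  have V: "finite ?V" "?V \<noteq> {}" "card ?V = n" using n by auto
  note fP = finite_all_pairs[OF V(1)]
  have pairs: "pairs n = ?P" unfolding pairs_def all_pairs_def by simp
  have tg: "typed_graph ?V" using V by unfold_locales
  define Pt where "Pt = Pi_pmf ?P None (\<lambda>_. type_pmf p1)"
  define Py where "Py = Pi_pmf ?P False (\<lambda>_. bernoulli_pmf \<beta>)"
  define \<mu> where "\<mu> t = Pi_pmf ?P None (\<lambda>e. edge_pmf (if t e = None then r else 1) c)" for t :: "nat set \<Rightarrow> bool option"
  \<comment> \<open>On first-round edges the bit \<open>z\<close> is kept. Any other pair is present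
    with probability \<open>r\<close> and then finds an admissible colour with probability at least
    \<open>\<beta>\<close>, whence a fresh bit of density
    \<open>qs \<le> \<beta> * r\<close>.\<close>
  define \<nu> where "\<nu> t z = Pi_pmf ?P False (\<lambda>e. if t e = None then bernoulli_pmf qs else return_pmf (z e))" for t :: "nat set \<Rightarrow> bool option" and z
  define hid where "hid t = ?P - typed_graph.revealed ?V D t" for t
  define Y where "Y t = Pi_pmf ?P False (\<lambda>e. bernoulli_pmf (if t e = None then qs else \<beta>))" for t :: "nat set \<Rightarrow> bool option"
  define Z where "Z t = map_pmf (\<lambda>(G, y'). hybrid ?C (hid t) G y') (pair_pmf (\<mu> t) (Y t))" for t
  define K where "K = (\<lambda>(t, z). do {G \<leftarrow> \<mu> t; y' \<leftarrow> \<nu> t z; return_pmf (hybrid ?C (hid t) G y')})"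
  \<comment> \<open>\<open>K\<close> draws the bits \<open>z\<close> first, so that the analysis can
    condition on a good typed graph. \<open>Z\<close> regroups the same experiment: given
    \<open>t\<close>, colours and all bits are independent, as the coupling requires.\<close>
  define J where "J = bind_pmf (pair_pmf Pt Py) K"
  have Gc: "Gc n c p = bind_pmf Pt \<mu>"
  proof -
    have "edge_pmf p c = bind_pmf (type_pmf p1) (\<lambda>t. edge_pmf (if t = None then r else 1) c)"
      by (rule edge_pmf_mixture[OF p r(1,2) _ r(3) p1]) (simp add: measure_pmf_single pmf_type_pmf[OF p1])
    then show ?thesis unfolding Gc_def pairs Pt_def \<mu>_def by (simp only: Pi_pmf_bind[OF fP, where d' = None])
  qed
  have J: "J = bind_pmf Pt Z"
  proof -
    have "Y t = bind_pmf Py (\<nu> t)" for t :: "nat set \<Rightarrow> bool option"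
    proof -
      have "Y t =
        Pi_pmf ?P False (\<lambda>e. bind_pmf (bernoulli_pmf \<beta>) (\<lambda>b. if t e = None then bernoulli_pmf qs else return_pmf b))"
        unfolding Y_def by (intro Pi_pmf_cong refl) (auto simp: bind_return_pmf')
      also have "\<dots> = bind_pmf Py (\<nu> t)" unfolding Py_def \<nu>_def by (rule Pi_pmf_bind[OF fP])
      finally show ?thesis .
    qed
    then have "Z t =
       do {G \<leftarrow> \<mu> t; z \<leftarrow> Py; y' \<leftarrow> \<nu> t z; return_pmf (hybrid ?C (hid t) G y')}" for t
      unfolding Z_def by (simp add: map_pmf_def pair_pmf_def bind_assoc_pmf bind_return_pmf)
    also have "do {G \<leftarrow> \<mu> t; z \<leftarrow> Py; y' \<leftarrow> \<nu> t z; return_pmf (hybrid ?C (hid t) G y')} = bind_pmf Py (\<lambda>z. K (t, z))" for t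
      unfolding K_def prod.case by (rule bind_commute_pmf)
    finally have "Z = (\<lambda>t. bind_pmf Py (\<lambda>z. K (t, z)))" by (rule ext)
    then show ?thesis unfolding J_def pair_pmf_def by (simp add: bind_assoc_pmf bind_return_pmf)
  qed
  have "prob J {True} \<le> prob (Gc n c p) {G. has_rainbow_ham_cycle n G}"
    unfolding Gc J
  proof (rule prob_bind_mono)
    fix t :: "nat set \<Rightarrow> bool option"
    have "prob (Z t) {True} =
      prob (pair_pmf (\<mu> t) (Y t)) {(G, y'). hybrid ?C (hid t) G y'}"
      unfolding Z_def by (simp add: measure_map_pmf vimage_def case_prod_unfold)
    also have "\<dots> \<le> prob (\<mu> t) {G. hybrid ?C {} G (\<lambda>_. False)}"
      unfolding \<mu>_def Y_def
    proof (rule hybrid_mono_hidden[OF fP _ _ _ c, where N = n])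
      show "finite (hid t)" "hid t \<subseteq> ?P" unfolding hid_def using fP by auto
      show "finite C \<and> card C \<le> n" if "C \<in> ?C" for C using ham_cycles_card[OF that] V(3) by simp
      show "0 \<le> (if t e = None then r else 1) \<and> (if t e = None then r else 1) \<le> 1" for e using r by auto
      have "\<beta> * r \<le> r * (1 - (real n - 1) / c)" using mult_left_mono[OF \<beta>(3) r(1)] by (simp add: mult.commute)
      then show "0 \<le> (if t e = None then qs else \<beta>) \<and> (if t e = None then qs else \<beta>) \<le> 1 \<and>
         (if t e = None then qs else \<beta>) \<le> (if t e = None then r else 1) * (1 - (real n - 1) / c)" for e
        using qs \<beta> by auto
    qed
    also have "\<dots> \<le> prob (\<mu> t) {G. has_rainbow_ham_cycle n G}"
      using rainbow_of_hybrid by (intro measure_pmf.finite_measure_mono) auto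
    finally show "prob (Z t) {True}
      \<le> prob (\<mu> t) {G. has_rainbow_ham_cycle n G}" .
  qed
  moreover have "prob J {True} = 1 - prob J {False}"
  proof -
    have "UNIV - {False} = {True}" by auto
    then show ?thesis using measure_pmf.prob_compl[of "{False}" J] by simp
  qed
  moreover have "prob J {False} \<le>
      \<rho>1 + (a0 * (D * (N / c)) + n * (2 ^ D * (N / c) ^ (D - 30)) + exp (qs * ys * (real n)\<^sup>2) / ys ^ n * exp (- qs * b))"
    (is "_ \<le> _ + (?colour + ?sprinkle)")
  proof -
    have N0: "0 \<le> N" unfolding N_def using a by simp
    then have col0: "0 \<le> ?colour" using a c by (intro add_nonneg_nonneg mult_nonneg_nonneg) auto
    have spr0: "0 \<le> ?sprinkle" using ys by simp
    have "prob J {False} \<le> prob (pair_pmf Pt Py) {(t, z). bad_types ?V D \<Delta> w0 x0 a0 a1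
      (typed_graph.T ?V t) (typed_graph.U ?V t) (typed_graph.H ?V t z)} + (?colour + ?sprinkle)"
      unfolding J_def
    proof (rule prob_bind_le_add)
      fix tz assume nb: "tz \<notin> {(t, z). bad_types ?V D \<Delta> w0 x0 a0 a1 (typed_graph.T ?V t) (typed_graph.U ?V t) (typed_graph.H ?V t z)}"
      obtain t z where tz: "tz = (t, z)" by (cases tz)
      interpret typed_graph ?V D t z by (rule tg)
      have good: "\<not> bad_types ?V D \<Delta> w0 x0 a0 a1 T U H" using nb tz by simp
      note g = good[unfolded bad_types_def de_Morgan_disj]
      have maxdeg: "deg ?V T v \<le> \<Delta>" if "v \<in> ?V" for v using g that by (meson not_le less_imp_le)
      have l0: "real (card low0) \<le> a0" and l1a: "real (card low1) \<le> a1" and l2a: "real (card {v \<in> ?V. deg ?V H v < 31}) \<le> a1"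
        using g unfolding low0_def low1_def by auto
      have cl: "real (card low) \<le> a1 * (2 + \<Delta>)"
      proof -
        have "real (card low) \<le> real (card {v \<in> ?V. deg ?V H v < 31}) + real (card low1) * (1 + real \<Delta>)"
          using card_low_le[OF maxdeg] by (metis (mono_tags, lifting) of_nat_1 of_nat_add of_nat_le_iff of_nat_mult)
        also have "\<dots> \<le> a1 + a1 * (1 + real \<Delta>)" by (intro add_mono l2a mult_right_mono l1a) auto
        finally show ?thesis by (simp add: algebra_simps)
      qed
      have cc: "real (card cands) \<le> N"
      proof -
        have "real (card cands) \<le> real (card low) * real \<Delta>"
          using card_cands_le[OF maxdeg] by (metis of_nat_le_iff of_nat_mult)
        also have "\<dots> \<le> a1 * (2 + \<Delta>) * \<Delta>" by (intro mult_right_mono cl) auto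
        finally show ?thesis unfolding N_def .
      qed
      have cT: "card T \<le> n * \<Delta>" using card_T_le[OF maxdeg] V(3) by simp
      have "prob (K tz) {False} \<le> prob (\<mu> t) {G. \<not> colours_ok G} + ?sprinkle"
        unfolding tz K_def prod.case
      proof (rule prob_bind_le_add[OF _ spr0])
        fix G assume G: "G \<in> set_pmf (\<mu> t)" "G \<notin> {G. \<not> colours_ok G}"
        have GT: "G e \<noteq> None" if "e \<in> T" for e
        proof -
          have e: "e \<in> ?P" "t e \<noteq> None" using that unfolding T_def by auto
          have "G e \<in> set_pmf (edge_pmf (if t e = None then r else 1) c)"
            using set_Pi_pmf_component[OF fP G(1)[unfolded \<mu>_def] e(1)] .
          then have "G e \<in> set_pmf (edge_pmf 1 c)" using e(2) by simp
          then show ?thesis using edge_pmf_1_not_None[OF c] by metis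
        qed
        have ex: "expander ?V (skeleton G) (n div 5)"
        proof (rule skeleton_expander[where ?w0.0 = w0 and ?x0.0 = x0 and ?l1.0 = l1])
          show "2 \<le> deg ?V T v" if "v \<in> ?V" for v using g that by (meson not_le)
          show "colours_ok G" using G by simp
          show "card (T \<inter> all_pairs W) + card {v \<in> W. deg ?V T v < D} \<le> card W" if "W \<subseteq> ?V" "card W \<le> 5" for W
            using g that by (meson not_le)
          show "card (T \<inter> all_pairs W) < 3 * card W" if "W \<subseteq> ?V" "1 \<le> card W" "card W \<le> w0" for W
            using g that by (meson not_le)
          show "H \<inter> cut S (?V - A) \<noteq> {}" if "S \<subseteq> A" "A \<subseteq> ?V" "x0 \<le> card S" "card A \<le> 8 * card S" "4 * card A \<le> 3 * card ?V" for S A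
            using g that by blast
          show "card low1 \<le> l1" using l1a l1(1) by linarith
          show "4 * (3 * (n div 5) + l1) \<le> 3 * card ?V" using l1 V(3) by simp
        qed (use l1 in auto)
        have "prob (\<nu> t z \<bind> (\<lambda>y'. return_pmf (hybrid ?C (hid t) G y'))) {False} =
            prob (\<nu> t z) ({y'. \<not> hybrid ?C (hid t) G y'} \<inter> set_pmf (\<nu> t z))"
          by (simp add: map_pmf_def[symmetric] measure_map_pmf vimage_def measure_Int_set_pmf)
        also have "\<dots> \<le> prob (\<nu> t z) {y'. \<not> ham ?V (skeleton G \<union> {e \<in> ?P - T. y' e})}"
        proof (intro measure_pmf.finite_measure_mono subsetI)
          fix y' assume y': "y' \<in> {y'. \<not> hybrid ?C (hid t) G y'} \<inter> set_pmf (\<nu> t z)"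
          have "y' e = z e" if "e \<in> T" for e
          proof -
            have e: "e \<in> ?P" "t e \<noteq> None" using that unfolding T_def by auto
            have "y' e \<in> set_pmf (if t e = None then bernoulli_pmf qs else return_pmf (z e))"
              using set_Pi_pmf_component[OF fP _ e(1), of y'] y' unfolding \<nu>_def by blast
            then show ?thesis using e(2) by simp
          qed
          then show "y' \<in> {y'. \<not> ham ?V (skeleton G \<union> {e \<in> ?P - T. y' e})}"
            using hybrid_of_ham[of G y'] GT y' unfolding hid_def by blast
        qed simp
        also have "\<dots> = prob (map_pmf (\<lambda>y'. {e \<in> ?P - T. y' e}) (\<nu> t z)) {X. \<not> ham ?V (skeleton G \<union> X)}"
          by (simp add: measure_map_pmf vimage_def)
        also have "map_pmf (\<lambda>y'. {e \<in> ?P - T. y' e}) (\<nu> t z) = rsub (?P - T) qs"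
        proof -
          have tN: "t e = None" if "e \<in> ?P - T" for e using that unfolding T_def by blast
          have "rsub (?P - T) qs = map_pmf (\<lambda>y'. {e \<in> ?P - T. y' e}) (Pi_pmf (?P - T) False (\<lambda>e. if t e = None then bernoulli_pmf qs else return_pmf (z e)))"
            unfolding rsub_def by (intro arg_cong[where f = "map_pmf _"] Pi_pmf_cong refl) (simp add: tN)
          also have "Pi_pmf (?P - T) False (\<lambda>e. if t e = None then bernoulli_pmf qs else return_pmf (z e)) =
              map_pmf (\<lambda>f x. if x \<in> ?P - T then f x else False) (\<nu> t z)"
            unfolding \<nu>_def by (rule Pi_pmf_subset[OF fP]) auto
          finally show ?thesis by (simp add: map_pmf_comp cong: conj_cong)
        qed
        also have "prob (rsub (?P - T) qs) {X. \<not> ham ?V (skeleton G \<union> X)} \<le>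
            exp (qs * ys * real ((card ?V)\<^sup>2)) / ys ^ card ?V * exp (- qs * b)"
        proof (rule sprinkle_boosters[OF V(1,2) _ _ _ ex T_sub(1) qs(1,2) ys])
          \<comment> \<open>From \<open>n \<ge> 30\<close> follows \<open>n div 5 > n mod 5\<close>,
            so expansion up to \<open>n div 5\<close> meets the requirement
            \<open>card V < 6 * k\<close> for connectivity and boosters.\<close>
          have "5 * (n div 5) + n mod 5 = n" "n mod 5 < 5" by simp_all
          then show "card ?V < 6 * (n div 5)" "2 \<le> n div 5" unfolding V(3) using n by linarith+
          show "skeleton G \<subseteq> ?P" using skeleton_T T_sub(1) by blast
          have "2 * (b + card T) \<le> 2 * (b + n * \<Delta>)" using cT by simp
          then show "2 * (b + card T) \<le> (Suc (n div 5))\<^sup>2" using b by (rule order_trans)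
        qed
        finally show "prob (\<nu> t z \<bind> (\<lambda>y'. return_pmf (hybrid ?C (hid t) G y'))) {False} \<le> ?sprinkle"
          using V(3) by simp
      qed
      also have "prob (\<mu> t) {G. \<not> colours_ok G} \<le> ?colour"
      proof -
        have "prob (\<mu> t) {G. \<not> colours_ok G} \<le>
            card low0 * (D * (card cands / c)) + card ?V * (2 ^ D * (card cands / c) ^ (D - 30))"
          unfolding \<mu>_def 
        proof (rule prob_colours_bad[OF c _ D])
          show "(if t e = None then r else 1) = 1" if "e \<in> T" for e
            using that unfolding T_def by auto
        qed
        also have "\<dots> \<le> ?colour"
        proof -
          have "card cands / c \<le> N / c" using cc by (simp add: divide_right_mono)
          then show ?thesis using l0 a N0 unfolding V(3)
            by (intro add_mono mult_mono mult_left_mono power_mono) auto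
        qed
        finally show ?thesis .
      qed
      finally show "prob (K tz) {False} \<le> ?colour + ?sprinkle" by simp
    qed (use col0 spr0 in simp)
    then show ?thesis using bad unfolding Pt_def Py_def by linarith
  qed
  ultimately show ?thesis by linarith
qed

section \<open>Asymptotics\<close>

text \<open>Here \<open>x\<close> is \<open>n\<close> times the density. Taking
  \<open>y = 1 / L\<close> costs \<open>x / L \<le> 2\<close> in the exponent, and
  \<open>n - 1\<close> in place of \<open>n\<close> costs at most 1; together this is the 3.\<close>

lemma exp_low_degree_le:
  fixes n :: nat and x L \<kappa> :: real
  assumes n: "1 \<le> n" and L: "1 \<le> L" and x: "L \<le> x" "x \<le> 2 * L" "x \<le> n" and \<kappa>: "0 \<le> \<kappa>" "\<kappa> \<le> 1"
  shows "exp (- (\<kappa> * (x / n)) * (1 - 1 / L) * real (n - 1)) \<le> exp (3 - \<kappa> * L)"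
proof -
  have "x / n * (1 - 1 / L) * real (n - 1) = x - x / L - x / n * (1 - 1 / L)"
    using n L by (simp add: of_nat_diff field_simps)
  also have "\<dots> \<ge> L - 3"
  proof -
    have "x / L \<le> 2" using x L by (simp add: divide_simps)
    moreover have "x / n * (1 - 1 / L) \<le> 1 * 1" using x L n by (intro mult_mono) (auto simp: divide_simps)
    ultimately show ?thesis using x by linarith
  qed
  finally have "\<kappa> * (L - 3) \<le> \<kappa> * (x / n * (1 - 1 / L) * real (n - 1))" using \<kappa> by (intro mult_left_mono) auto
  moreover have "\<kappa> * (L - 3) = \<kappa> * L - 3 * \<kappa>" by (simp add: algebra_simps)
  moreover have "- (\<kappa> * (x / n)) * (1 - 1 / L) * real (n - 1) = - (\<kappa> * (x / n * (1 - 1 / L) * real (n - 1)))" by simp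
  moreover have "3 * \<kappa> \<le> 3" using \<kappa> by simp
  ultimately have "- (\<kappa> * (x / n)) * (1 - 1 / L) * real (n - 1) \<le> 3 - \<kappa> * L" by linarith
  then show ?thesis by simp
qed

text \<open>At most \<open>n powr (1 - \<beta> / 4)\<close> vertices have low degree, so the edges kept for them use only a
  fraction \<open>n powr (- \<beta> / 8)\<close> of the colours; \<open>D\<close> is chosen so that the power \<open>D - 30\<close> of this fraction
  beats the number of vertices.  The second round has density \<open>2000 / n\<close> after thinning, where 2000
  is large enough to beat the entropy of the set of added boosters.\<close>
lemma prob_rainbow_ge_explicit:
  fixes \<epsilon> p p1 L \<beta> :: real and n D :: nat
  assumes \<epsilon>: "\<epsilon> > 0" and p: "0 \<le> p" "p \<le> 1"
  defines "L \<equiv> ln n" and "\<beta> \<equiv> \<epsilon> / (1 + \<epsilon>)"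
  defines "p1 \<equiv> min p (2 * L / n) - 2000 / \<beta> / n"
  assumes D: "31 + 8 / \<beta> \<le> D" and n: "2000 \<le> n" and L: "1 \<le> L" "4 * L \<le> n"
    and w: "0 \<le> n * p1 - L - ln L"
    and h2: "16 * exp 2 / L ^ 3 \<le> 1" and h3: "exp 2 * L ^ 36 * n powr (- \<beta> / 8) \<le> 1 / 2"
    and h4: "10 * (n powr (1 - \<beta> / 4) + 1) \<le> n / L ^ 3 - 1" and h5: "10 * (n / L ^ 4 + 1) \<le> n / L ^ 3 - 1"
    and h6: "12 * real n / 5 + 4 * (n powr (1 - \<beta> / 4) + 1) \<le> 3 * real n"
    and h7: "(real n)\<^sup>2 / 50 + 2 * real n * (L\<^sup>2 + 1) \<le> (real n)\<^sup>2 / 25"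
    and h8: "(L\<^sup>2 + 3)\<^sup>2 \<le> n powr (\<beta> / 8)"
  shows "1 - (3 * exp 2 * exp (- (n * p1 - L - ln L)) +
      2 ^ 37 * (exp 8 * L ^ D / n) * (exp 1 * (exp 8 * L ^ D) ^ 5) +
      16 * exp 2 / L ^ 3 + n * exp (6 * L - L\<^sup>2) + exp 3 * L ^ D * n powr (- \<beta> / 16) +
      exp 3 * L ^ D * n powr (- 1 / 4) + exp 3 * L ^ 31 * n powr (- \<beta> / 4) +
      2 * (exp 2 * L ^ 36 * n powr (- \<beta> / 8)) +
      D * n powr (- \<beta> / 16) + 2 ^ D * n powr (- \<beta> / 8) + exp (2000 - 8 * real n))
    \<le> prob (Gc n (nat \<lceil>(1 + \<epsilon>) * real n\<rceil>) p) {G. has_rainbow_ham_cycle n G}"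
proof -
  define c where "c = nat \<lceil>(1 + \<epsilon>) * real n\<rceil>"
  define x where "x = n * p1"
  define r where "r = (p - p1) / (1 - p1)"
  \<comment> \<open>Markov thresholds. Up to powers of \<open>L\<close>, the expected numbers of
    vertices of low degree in \<open>T\<close>, \<open>U\<close> and \<open>H\<close> are at most 1,
    \<open>n powr (1 / 2)\<close> and \<open>n powr (1 - \<beta> / 2)\<close>. The gap to the
    thresholds is a power of \<open>n\<close>, and \<open>a0\<close> times the repetition
    probability \<open>n powr (- \<beta> / 8)\<close> still tends to 0.\<close>
  define a0 a1 where "a0 = n powr (\<beta> / 16)" and "a1 = n powr (1 - \<beta> / 4)"
  define \<Delta> where "\<Delta> = nat \<lceil>L\<^sup>2\<rceil>"
  \<comment> \<open>With \<open>w0 = n / L ^ 3\<close> the quantity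
    \<open>n * p1 ^ 3 * w0\<^sup>2\<close> is at most \<open>8 / L ^ 3\<close>. The smaller
    \<open>x0\<close> fits below \<open>w0 / 10\<close> and costs only
    \<open>(L ^ 4) ^ 9 = L ^ 36\<close> in the bound on cuts. Of the at least
    \<open>n\<^sup>2 / 50\<close> boosters about half are counted in \<open>b\<close>, the other
    half leaves room for those lying in \<open>T\<close>.\<close>
  define w0 x0 l1 b where "w0 = nat \<lfloor>n / L ^ 3\<rfloor>" and "x0 = nat \<lceil>n / L ^ 4\<rceil>" and "l1 = nat \<lceil>a1\<rceil>"
    and "b = nat \<lfloor>(real n)\<^sup>2 / 100\<rfloor>"
  \<comment> \<open>The exponents of the sprinkling bound become \<open>n\<close> from
    \<open>qs * ys * n\<^sup>2\<close>, at most \<open>11 * n\<close> from \<open>1 / ys ^ n\<close>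
    because \<open>2000 \<le> exp 11\<close>, and about \<open>- 20 * n\<close> from
    \<open>- qs * b\<close>; in total about \<open>- 8 * n\<close>.\<close>
  define qs ys where "qs = 2000 / real n" and "ys = (1 / 2000 :: real)"
  \<comment> \<open>Dominates both the edge density and the probability of low degree at one vertex.
    The factor \<open>exp 8\<close> absorbs the losses from \<open>y = 1 / L\<close> and from
    leaving out up to five vertices.\<close>
  define \<rho> where "\<rho> = exp 8 * L ^ D / n"
  have \<beta>: "0 < \<beta>" "\<beta> < 1" unfolding \<beta>_def using \<epsilon> by auto
  have n0: "real n > 0" "real n \<ge> 1" using n by auto
  have lnL: "0 \<le> ln L" using L by simp
  have expL: "exp L = n" unfolding L_def using n0 by simp
  have pw: "exp (a * L) = n powr a" for a unfolding L_def powr_def using n0 by simp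
  have xp1: "p1 = x / n" unfolding x_def using n0 by simp
  have xL: "L \<le> x" using w lnL unfolding x_def by linarith
  have x2L: "x \<le> 2 * L"
  proof -
    have "0 < 2000 / \<beta> / n" using \<beta> n0 by simp
    then have "p1 \<le> 2 * L / n" unfolding p1_def using min.cobounded2[of p "2 * L / n"] by linarith
    then have "n * p1 \<le> n * (2 * L / n)" using n0 by (intro mult_left_mono) auto
    then show ?thesis unfolding x_def using n0 by simp
  qed
  have xn: "2 * x \<le> n" using x2L L by linarith
  have p1: "0 < p1" "p1 \<le> 1 / 2" unfolding xp1 using xL L xn n0 by (auto simp: divide_simps)
  have pp1: "2000 / \<beta> / n \<le> p - p1" unfolding p1_def by simp
  have gap: "0 < 2000 / \<beta> / n" using \<beta> n0 by simp
  have r: "0 \<le> r" "r \<le> 1" "(1 - p1) * (1 - r) = 1 - p" "2000 / \<beta> / n \<le> r"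
  proof -
    have d: "0 \<le> p - p1" using pp1 gap by linarith
    show "0 \<le> r" unfolding r_def by (rule divide_nonneg_nonneg[OF d]) (use p1 in simp)
    show "r \<le> 1" unfolding r_def using p p1 by (simp add: divide_simps)
    show "(1 - p1) * (1 - r) = 1 - p" unfolding r_def using p1 by (simp add: field_simps)
    have "p - p1 \<le> r"
      unfolding r_def using p1 mult_left_le[OF _ d, of "1 - p1"] by (simp add: pos_le_divide_eq)
    then show "2000 / \<beta> / n \<le> r" using pp1 by linarith
  qed
  have c: "real c \<ge> (1 + \<epsilon>) * n" unfolding c_def by linarith
  have cn: "real c \<ge> n" using c mult_right_mono[of 1 "1 + \<epsilon>" "real n"] \<epsilon> n0 by linarith
  have c0: "c > 0" using cn n0 by linarith
  have \<beta>c: "\<beta> \<le> 1 - (real n - 1) / c"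
  proof -
    have "(real n - 1) / c \<le> n / ((1 + \<epsilon>) * n)" using c n0 \<epsilon> by (intro frac_le) auto
    also have "\<dots> = 1 / (1 + \<epsilon>)" using n0 by simp
    also have "\<dots> = 1 - \<beta>" unfolding \<beta>_def using \<epsilon> by (simp add: field_simps)
    finally show ?thesis by simp
  qed
  have qs: "0 \<le> qs" "qs \<le> 1" "qs \<le> \<beta> * r"
  proof -
    show "0 \<le> qs" "qs \<le> 1" unfolding qs_def using n by auto
    have "\<beta> * (2000 / \<beta> / n) \<le> \<beta> * r" using r(4) \<beta> by (intro mult_left_mono) auto
    then show "qs \<le> \<beta> * r" unfolding qs_def using \<beta> by simp
  qed
  have a: "0 < a0" "0 < a1" unfolding a0_def a1_def using n0 by auto
  have \<Delta>: "L\<^sup>2 \<le> \<Delta>" "\<Delta> \<le> L\<^sup>2 + 1"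
  proof -
    have "0 \<le> L\<^sup>2" by simp
    then show "L\<^sup>2 \<le> \<Delta>" "\<Delta> \<le> L\<^sup>2 + 1" unfolding \<Delta>_def by linarith+
  qed
  have w0: "real w0 \<le> n / L ^ 3" "n / L ^ 3 - 1 \<le> real w0"
  proof -
    have "0 \<le> n / L ^ 3" using L by simp
    then show "real w0 \<le> n / L ^ 3" "n / L ^ 3 - 1 \<le> real w0" unfolding w0_def by linarith+
  qed
  have x0: "n / L ^ 4 \<le> x0" "x0 \<le> n / L ^ 4 + 1"
  proof -
    have "0 \<le> n / L ^ 4" using L by simp
    then show "n / L ^ 4 \<le> x0" "x0 \<le> n / L ^ 4 + 1" unfolding x0_def by linarith+
  qed
  have x01: "1 \<le> x0"
  proof -
    have "0 < n / L ^ 4" using L n0 by simp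
    then show ?thesis using x0(1) by linarith
  qed
  have l1: "a1 \<le> l1" "l1 \<le> a1 + 1" unfolding l1_def using a by linarith+
  have b: "real b \<le> (real n)\<^sup>2 / 100" "(real n)\<^sup>2 / 100 - 1 \<le> real b"
  proof -
    have "0 \<le> (real n)\<^sup>2 / 100" by simp
    then show "real b \<le> (real n)\<^sup>2 / 100" "(real n)\<^sup>2 / 100 - 1 \<le> real b" unfolding b_def by linarith+
  qed
  have LD: "1 \<le> L ^ k" for k using L by (simp add: one_le_power)
  have n\<rho>: "n * \<rho> = exp 8 * L ^ D" unfolding \<rho>_def using n0 by simp
  have \<rho>1: "p1 \<le> \<rho>"
  proof -
    have "D \<ge> 1" using D \<beta> by (smt (verit) divide_pos_pos less_one not_le of_nat_0 of_nat_less_iff of_nat_1)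
    then have "L ^ 1 \<le> L ^ D" using L by (intro power_increasing) auto
    moreover have "2 \<le> exp (8::real)" using exp_ge_add_one_self[of 8] by linarith
    ultimately have "2 * L \<le> exp 8 * L ^ D" using L by (intro mult_mono) auto
    then show ?thesis unfolding xp1 \<rho>_def using x2L n0 by (intro divide_right_mono) auto
  qed
  have \<rho>2: "(1 / (1 / L)) ^ D * exp (- p1 * (1 - 1 / L) * real (n - 5)) \<le> \<rho>"
  proof -
    have "p1 * (1 - 1 / L) * (real n - 5) = x - x / L - 5 * (p1 * (1 - 1 / L))"
      unfolding x_def by (simp add: algebra_simps)
    also have "\<dots> \<ge> L - 8"
    proof -
      have "x / L \<le> 2" using x2L L by (simp add: divide_simps)
      moreover have "p1 * (1 - 1 / L) \<le> 1 / 2 * 1" using p1 L by (intro mult_mono) (auto simp: divide_simps)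
      ultimately show ?thesis using xL by linarith
    qed
    finally have "exp (- (p1 * (1 - 1 / L) * (real n - 5))) \<le> exp (8 - L)" by simp
    also have "exp (8 - L) = exp 8 / n" using expL by (simp add: exp_diff)
    finally have e: "exp (- p1 * (1 - 1 / L) * real (n - 5)) \<le> exp 8 / n" using n by (simp add: of_nat_diff)
    have "(1 / (1 / L)) ^ D * exp (- p1 * (1 - 1 / L) * real (n - 5)) \<le> L ^ D * (exp 8 / n)"
      using e L by (intro mult_mono) auto
    then show ?thesis unfolding \<rho>_def by (simp add: mult_ac)
  qed
  have \<rho>3: "1 \<le> n * \<rho>"
  proof -
    have "1 * 1 \<le> exp 8 * L ^ D" using LD by (intro mult_mono) auto
    then show ?thesis unfolding n\<rho> by simp
  qed
  have E3: "exp 2 * n * p1 ^ 3 * (real w0)\<^sup>2 \<le> 8 * exp 2 / L ^ 3"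
  proof -
    have "exp 2 * n * p1 ^ 3 * (real w0)\<^sup>2 \<le> exp 2 * n * (2 * L / n) ^ 3 * (n / L ^ 3)\<^sup>2"
      using p1 x2L n0 w0 L unfolding xp1 by (intro mult_mono power_mono divide_right_mono) (auto intro!: mult_nonneg_nonneg)
    also have "\<dots> = 8 * exp 2 / L ^ 3" using n0 L by (simp add: field_simps power2_eq_square power3_eq_cube)
    finally show ?thesis .
  qed
  have E8: "exp 2 * (1 / (1 / L ^ 4)) ^ 9 * exp (- (p1 * \<beta> / 2) * n / 4) \<le> exp 2 * L ^ 36 * n powr (- \<beta> / 8)"
  proof -
    have "(1 / (1 / L ^ 4)) ^ 9 = L ^ 36" by (simp flip: power_mult)
    moreover have "exp (- (p1 * \<beta> / 2) * n / 4) \<le> n powr (- \<beta> / 8)"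
    proof -
      have "- (p1 * \<beta> / 2) * n / 4 = - \<beta> / 8 * x" unfolding x_def by simp
      also have "\<dots> \<le> - \<beta> / 8 * L" using xL \<beta> by (intro mult_left_mono_neg) auto
      finally have "exp (- (p1 * \<beta> / 2) * n / 4) \<le> exp (- \<beta> / 8 * L)" by simp
      then show ?thesis unfolding pw .
    qed
    ultimately show ?thesis using L by (simp add: mult_left_mono)
  qed
  have w0p: "p1 * w0 \<le> 1" "w0 \<le> n"
  proof -
    have "p1 * w0 \<le> (2 * L / n) * (n / L ^ 3)" unfolding xp1 using x2L xL L w0 n0 by (intro mult_mono divide_right_mono) auto
    also have "\<dots> = 2 / L\<^sup>2" using n0 L by (simp add: power2_eq_square power3_eq_cube)
    also have "\<dots> \<le> 1"
    proof -
      have "16 * 1 \<le> 16 * exp (2::real)" by simp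
      also have "\<dots> \<le> L ^ 3" using h2 L LD[of 3] by (simp add: divide_simps)
      finally have "2 ^ 3 \<le> L ^ 3" by simp
      then have "2 \<le> L" using L power_mono_iff[of 2 L 3] by simp
      then have "2\<^sup>2 \<le> L\<^sup>2" by (intro power_mono) auto
      then show ?thesis using L by (simp add: divide_simps)
    qed
    finally show "p1 * w0 \<le> 1" .
    have "n / L ^ 3 \<le> n / 1" using LD[of 3] n0 L by (intro divide_left_mono) auto
    then show "w0 \<le> n" using w0(1) by linarith
  qed
  have ldeg: "exp (- (\<kappa> * p1) * (1 - 1 / L) * real (n - 1)) \<le> exp 3 * n powr (- \<kappa>)" if "0 \<le> \<kappa>" "\<kappa> \<le> 1" for \<kappa>
  proof -
    have "exp (- (\<kappa> * p1) * (1 - 1 / L) * real (n - 1)) \<le> exp (3 - \<kappa> * L)"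
      unfolding xp1 using exp_low_degree_le[of n L x \<kappa>] n L xL x2L xn that by simp
    also have "\<dots> = exp 3 * exp (- \<kappa> * L)" by (simp flip: exp_add)
    finally show ?thesis unfolding pw .
  qed
  have cnt: "n * ((1 / (1 / L)) ^ k * exp (- (\<kappa> * p1) * (1 - 1 / L) * real (n - 1))) / n powr s \<le> exp 3 * L ^ k * n powr (1 - \<kappa> - s)"
    if "0 \<le> \<kappa>" "\<kappa> \<le> 1" for \<kappa> s k
  proof -
    have "n * ((1 / (1 / L)) ^ k * exp (- (\<kappa> * p1) * (1 - 1 / L) * real (n - 1))) / n powr s \<le>
        n * (L ^ k * (exp 3 * n powr (- \<kappa>))) / n powr s"
      using ldeg[OF that] L by (intro divide_right_mono mult_left_mono) auto
    also have "\<dots> = exp 3 * L ^ k * (n powr 1 * n powr (- \<kappa>) / n powr s)" using n0 by (simp add: mult_ac)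
    also have "n powr 1 * n powr (- \<kappa>) / n powr s = n powr (1 - \<kappa> - s)"
      by (simp only: powr_add[symmetric] powr_diff[symmetric] add_uminus_conv_diff)
    finally show ?thesis .
  qed
  have powm: "n powr s \<le> n powr s'" if "s \<le> s'" for s s' using that n0 by (simp add: powr_mono)
  let ?E1 = "n * ((1 + n * p1) * exp (2 - p1 * n))"
  let ?E2 = "2 ^ 37 * \<rho> * (exp 1 * (n * \<rho>) ^ 5)"
  let ?E3 = "2 * (exp 2 * n * p1 ^ 3 * (real w0)\<^sup>2)"
  let ?E4 = "n * exp (3 * p1 * n - \<Delta>)"
  let ?E5 = "n * ((1 / (1 / L)) ^ D * exp (- p1 * (1 - 1 / L) * real (n - 1))) / a0"
  let ?E6 = "n * ((1 / (1 / L)) ^ D * exp (- (p1 / 2) * (1 - 1 / L) * real (n - 1))) / a1"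
  let ?E7 = "n * ((1 / (1 / L)) ^ 31 * exp (- (p1 * \<beta> / 2) * (1 - 1 / L) * real (n - 1))) / a1"
  let ?E8 = "2 * (exp 2 * (1 / (1 / L ^ 4)) ^ 9 * exp (- (p1 * \<beta> / 2) * n / 4))"
  have types: "prob (pair_pmf (Pi_pmf (all_pairs {1..n}) None (\<lambda>_. type_pmf p1)) (Pi_pmf (all_pairs {1..n}) False (\<lambda>_. bernoulli_pmf \<beta>)))
      {(t, z). bad_types {1..n} D \<Delta> w0 x0 a0 a1 (typed_graph.T {1..n} t) (typed_graph.U {1..n} t) (typed_graph.H {1..n} t z)} \<le>
    ?E1 + (?E2 + (?E3 + (?E4 + (?E5 + (?E6 + (?E7 + ?E8))))))"
  proof (rule prob_bad_types[where \<rho> = \<rho>])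
    show "1 \<le> n" "0 < p1" "p1 \<le> 1" "0 \<le> \<beta>" "\<beta> \<le> 1" using n p1 \<beta> by auto
    show "0 < 1 / L" "1 / L \<le> 1" "0 < 1 / L ^ 4" "1 / L ^ 4 \<le> 1" using L LD by (auto simp: divide_simps)
    show "1 / L ^ 4 * n \<le> x0" using x0 by simp
    show "1 \<le> x0" by (fact x01)
    show "exp 2 * n * p1 ^ 3 * (real w0)\<^sup>2 \<le> 1 / 2" using E3 h2 by linarith
    show "exp 2 * (1 / (1 / L ^ 4)) ^ 9 * exp (- (p1 * \<beta> / 2) * n / 4) \<le> 1 / 2" using E8 h3 by linarith
  qed (use a \<rho>1 \<rho>2 \<rho>3 w0p in auto)
  define N where "N = a1 * real (2 + \<Delta>) * real \<Delta>"
  have main: "1 - ((?E1 + (?E2 + (?E3 + (?E4 + (?E5 + (?E6 + (?E7 + ?E8))))))) +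
     (a0 * (D * (N / c)) + n * (2 ^ D * (N / c) ^ (D - 30)) + exp (qs * ys * (real n)\<^sup>2) / ys ^ n * exp (- qs * b)))
    \<le> prob (Gc n c p) {G. has_rainbow_ham_cycle n G}"
    unfolding N_def
  proof (rule prob_rainbow_ge[OF _ c0 _ p _ _ r(1-3) _ _ \<beta>c qs _ _ a l1(1) _ _ _ _ types])
    show "30 \<le> n" using n by simp
    have "0 < 8 / \<beta>" using \<beta> by simp
    then show "31 \<le> D" using D by linarith
    have "10 * real l1 \<le> real w0" using h4 l1(2) w0(2) unfolding a1_def by argo
    then have "real (10 * l1) \<le> real w0" by simp
    then show "10 * l1 \<le> w0" by (simp only: of_nat_le_iff)
    have "10 * real x0 \<le> real w0" using h5 x0(2) w0(2) by argo
    then have "real (10 * x0) \<le> real w0" by simp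
    then show "10 * x0 \<le> w0" by (simp only: of_nat_le_iff)
    have "real (n div 5) \<le> n / 5" by linarith
    then have "4 * (3 * real (n div 5) + real l1) \<le> 3 * real n" using h6 l1(2) unfolding a1_def by argo
    then have "real (4 * (3 * (n div 5) + l1)) \<le> real (3 * n)" by simp
    then show "4 * (3 * (n div 5) + l1) \<le> 3 * n" by (simp only: of_nat_le_iff)
    show "2 * (b + n * \<Delta>) \<le> (Suc (n div 5))\<^sup>2"
    proof -
      have "real n * real \<Delta> \<le> real n * (L\<^sup>2 + 1)" using \<Delta> by (intro mult_left_mono) auto
      moreover have "2 * (b' + W) \<le> N / 50 + 2 * Z" if "W \<le> Z" "b' \<le> N / 100" for b' W Z N :: real
        using that by argo
      ultimately have "2 * (real b + real n * real \<Delta>) \<le> (real n)\<^sup>2 / 50 + 2 * (real n * (L\<^sup>2 + 1))"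
        using b(1) by blast
      also have "\<dots> = (real n)\<^sup>2 / 50 + 2 * real n * (L\<^sup>2 + 1)" by simp
      also have "\<dots> \<le> (real n)\<^sup>2 / 25" by (rule h7)
      also have "\<dots> = (n / 5)\<^sup>2" by (simp add: power_divide)
      also have "\<dots> \<le> (real (Suc (n div 5)))\<^sup>2"
      proof (rule power_mono)
        have "5 * (n div 5) + n mod 5 = n" "n mod 5 < 5" by simp_all
        then show "n / 5 \<le> real (Suc (n div 5))" by linarith
      qed simp
      finally have "real (2 * (b + n * \<Delta>)) \<le> real ((Suc (n div 5))\<^sup>2)" by (simp only: of_nat_mult of_nat_add of_nat_power of_nat_numeral)
      then show ?thesis by (simp only: of_nat_le_iff)
    qed
  qed (use p1 \<beta> in \<open>auto simp: ys_def\<close>)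
  \<comment> \<open>This is where \<open>ln L\<close> enters the threshold:
    \<open>exp (- L - ln L) = 1 / (n * L)\<close>, so the \<open>n\<close> choices of a vertex and
    the factor \<open>1 + n * p1\<close> coming from degree 1 are both paid for.\<close>
  have B1: "?E1 \<le> 3 * exp 2 * exp (- (n * p1 - L - ln L))"
  proof -
    have "exp (2 - p1 * n) = exp 2 * exp (- L) * exp (- ln L) * exp (- (n * p1 - L - ln L))"
      by (simp add: mult.commute flip: exp_add)
    also have "exp (- L) = 1 / n" using expL by (simp add: exp_minus divide_simps)
    also have "exp (- ln L) = 1 / L" using L by (simp add: exp_minus divide_simps)
    finally have e: "?E1 = (1 + x) / L * (exp 2 * exp (- (n * p1 - L - ln L)))"
      unfolding x_def using n0 by simp
    have "(1 + x) / L \<le> 3" using x2L L by (simp add: divide_simps)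
    then have "(1 + x) / L * (exp 2 * exp (- (n * p1 - L - ln L))) \<le> 3 * (exp 2 * exp (- (n * p1 - L - ln L)))"
      by (intro mult_right_mono) auto
    then show ?thesis unfolding e by simp
  qed
  have B4: "?E4 \<le> n * exp (6 * L - L\<^sup>2)"
  proof -
    have "3 * p1 * n = 3 * x" unfolding x_def by simp
    then have "3 * p1 * n - \<Delta> \<le> 6 * L - L\<^sup>2" using x2L \<Delta>(1) by linarith
    then show ?thesis using n0 by (intro mult_left_mono) auto
  qed
  have B5: "?E5 \<le> exp 3 * L ^ D * n powr (- \<beta> / 16)"
    using cnt[of 1 D "\<beta> / 16"] unfolding a0_def by simp
  have B6: "?E6 \<le> exp 3 * L ^ D * n powr (- 1 / 4)"
  proof -
    have "?E6 \<le> exp 3 * L ^ D * n powr (1 - 1 / 2 - (1 - \<beta> / 4))"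
      using cnt[of "1 / 2" D "1 - \<beta> / 4"] unfolding a1_def by simp
    also have "\<dots> \<le> exp 3 * L ^ D * n powr (- 1 / 4)"
      using \<beta> L by (intro mult_left_mono powm) auto
    finally show ?thesis .
  qed
  have B7: "?E7 \<le> exp 3 * L ^ 31 * n powr (- \<beta> / 4)"
  proof -
    have e: "1 - \<beta> / 2 - (1 - \<beta> / 4) = - \<beta> / 4" "\<beta> / 2 * p1 = p1 * \<beta> / 2" by simp_all
    show ?thesis using cnt[of "\<beta> / 2" 31 "1 - \<beta> / 4"] \<beta> unfolding a1_def e by simp
  qed
  have Nc: "0 \<le> N / c" "N / c \<le> n powr (- \<beta> / 8)"
  proof -
    show "0 \<le> N / c" unfolding N_def using a by simp
    have "N \<le> n powr (1 - \<beta> / 4) * n powr (\<beta> / 8)"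
    proof -
      have "real (2 + \<Delta>) * real \<Delta> \<le> (L\<^sup>2 + 3) * (L\<^sup>2 + 3)" using \<Delta> by (intro mult_mono) auto
      also have "\<dots> \<le> n powr (\<beta> / 8)" using h8 by (simp add: power2_eq_square)
      finally show ?thesis unfolding N_def a1_def mult.assoc by (intro mult_left_mono) auto
    qed
    also have "\<dots> = n * n powr (- \<beta> / 8)"
    proof -
      have "n powr (1 - \<beta> / 4) * n powr (\<beta> / 8) = n powr (1 - \<beta> / 4 + \<beta> / 8)" by (rule powr_add[symmetric])
      also have "1 - \<beta> / 4 + \<beta> / 8 = 1 + - \<beta> / 8" by simp
      also have "n powr (1 + - \<beta> / 8) = n powr 1 * n powr (- \<beta> / 8)" by (rule powr_add)
      finally show ?thesis using n0 by simp
    qed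
    finally have "N / c \<le> n * n powr (- \<beta> / 8) / c" by (simp add: divide_right_mono)
    also have "\<dots> \<le> n powr (- \<beta> / 8)"
    proof -
      have "n * n powr (- \<beta> / 8) \<le> c * n powr (- \<beta> / 8)" using cn by (intro mult_right_mono) auto
      then show ?thesis using c0 by (simp add: divide_simps mult.commute)
    qed
    finally show "N / c \<le> n powr (- \<beta> / 8)" .
  qed
  have B9: "a0 * (D * (N / c)) \<le> D * n powr (- \<beta> / 16)"
  proof -
    have "a0 * (D * (N / c)) \<le> a0 * (D * n powr (- \<beta> / 8))" using Nc a by (intro mult_left_mono) auto
    also have "\<dots> = D * (n powr (\<beta> / 16) * n powr (- \<beta> / 8))" unfolding a0_def by simp
    also have "n powr (\<beta> / 16) * n powr (- \<beta> / 8) = n powr (- \<beta> / 16)" by (simp flip: powr_add)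
    finally show ?thesis .
  qed
  have B9': "n * (2 ^ D * (N / c) ^ (D - 30)) \<le> 2 ^ D * n powr (- \<beta> / 8)"
  proof -
    have "(N / c) ^ (D - 30) \<le> (n powr (- \<beta> / 8)) ^ (D - 30)" using Nc by (intro power_mono) auto
    also have "\<dots> = n powr (- \<beta> / 8 * real (D - 30))" using n0 by (simp add: powr_powr powr_realpow[symmetric])
    also have "\<dots> \<le> n powr (- 1 - \<beta> / 8)"
    proof (rule powm)
      have "1 + 8 / \<beta> \<le> real (D - 30)" using D by linarith
      then have "\<beta> / 8 * (1 + 8 / \<beta>) \<le> \<beta> / 8 * real (D - 30)" using \<beta> by (intro mult_left_mono) auto
      moreover have "\<beta> / 8 * (1 + 8 / \<beta>) = \<beta> / 8 + 1" using \<beta> by (simp add: field_simps)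
      ultimately show "- \<beta> / 8 * real (D - 30) \<le> - 1 - \<beta> / 8" by linarith
    qed
    finally have "n * (2 ^ D * (N / c) ^ (D - 30)) \<le> n * (2 ^ D * n powr (- 1 - \<beta> / 8))" using n0 by (intro mult_left_mono) auto
    also have "\<dots> = 2 ^ D * (n powr 1 * n powr (- 1 - \<beta> / 8))" using n0 by simp
    also have "n powr 1 * n powr (- 1 - \<beta> / 8) = n powr (- \<beta> / 8)" by (simp only: powr_add[symmetric]) simp
    finally show ?thesis .
  qed
  have B10: "exp (qs * ys * (real n)\<^sup>2) / ys ^ n * exp (- qs * b) \<le> exp (2000 - 8 * real n)"
  proof -
    have e1: "qs * ys * (real n)\<^sup>2 = n" unfolding qs_def ys_def using n0 by (simp add: power2_eq_square)
    have "(2000::real) \<le> 2 ^ 11" by simp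
    also have "\<dots> \<le> exp 1 ^ 11" using exp_ge_add_one_self[of 1] by (intro power_mono) auto
    also have "\<dots> = exp 11" using exp_of_nat_mult[of 11 "1::real"] by simp
    finally have "(2000::real) ^ n \<le> exp 11 ^ n" by (intro power_mono) auto
    also have "\<dots> = exp (11 * n)" by (simp add: exp_of_nat_mult[symmetric] mult.commute)
    finally have e2: "1 / ys ^ n \<le> exp (11 * n)" unfolding ys_def by (simp add: power_one_over)
    have "qs * ((real n)\<^sup>2 / 100 - 1) \<le> qs * b" using b(2) qs by (intro mult_left_mono) auto
    moreover have "qs * ((real n)\<^sup>2 / 100 - 1) = 20 * n - 2000 / n"
      unfolding qs_def using n0 by (simp add: field_simps power2_eq_square)
    moreover have "2000 / n \<le> (2000::real)" using n0 by (simp add: divide_simps)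
    ultimately have "- qs * b \<le> 2000 - 20 * real n" by linarith
    then have e3: "exp (- qs * b) \<le> exp (2000 - 20 * real n)" by simp
    have "exp (qs * ys * (real n)\<^sup>2) / ys ^ n * exp (- qs * b) = exp n * (1 / ys ^ n) * exp (- qs * b)" unfolding e1 by simp
    also have "\<dots> \<le> exp n * exp (11 * n) * exp (2000 - 20 * real n)" by (intro mult_mono e2 e3) (auto simp: ys_def)
    also have "\<dots> = exp (2000 - 8 * real n)" by (simp flip: exp_add)
    finally show ?thesis .
  qed
  have B2: "?E2 = 2 ^ 37 * (exp 8 * L ^ D / n) * (exp 1 * (exp 8 * L ^ D) ^ 5)"
    unfolding n\<rho> \<rho>_def by simp
  have B3: "?E3 \<le> 16 * exp 2 / L ^ 3" using E3 by linarith
  show ?thesis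
    using main B1 B2 B3 B4 B5 B6 B7 E8 B9 B9' B10 unfolding c_def by linarith
qed

theorem theorem1:
  fixes \<epsilon> :: real and p :: "nat \<Rightarrow> real"
  assumes "\<epsilon> > 0"
    and "\<And>n. 0 \<le> p n \<and> p n \<le> 1"
    and "filterlim (\<lambda>n. real n * p n - ln (real n) - ln (ln (real n))) at_top sequentially"
  shows "(\<lambda>n. measure_pmf.prob (Gc n (nat \<lceil>(1 + \<epsilon>) * real n\<rceil>) (p n))
                 {G. has_rainbow_ham_cycle n G}) \<longlonglongrightarrow> 1"
proof -
  define \<beta> where "\<beta> = \<epsilon> / (1 + \<epsilon>)"
  have \<beta>: "0 < \<beta>" "\<beta> < 1" unfolding \<beta>_def using assms(1) by auto
  define D where "D = nat \<lceil>31 + 8 / \<beta>\<rceil>"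
  have D: "31 + 8 / \<beta> \<le> D" unfolding D_def by linarith
  define w where "w n = n * (min (p n) (2 * ln n / n) - 2000 / \<beta> / n) - ln n - ln (ln n)" for n :: nat
  \<comment> \<open>If \<open>p n\<close> is below the cap, its own excess over the threshold
    diverges and loses only the constant \<open>2000 / \<beta>\<close>; at the cap the excess is
    \<open>ln n - ln (ln n)\<close> minus that constant.\<close>
  have w: "filterlim w at_top sequentially"
  proof -
    have f: "filterlim (\<lambda>n::nat. ln (real n) - ln (ln (real n)) - 2000 / \<beta>) at_top sequentially"
      by real_asymp
    have g: "filterlim (\<lambda>n. (real n * p n - ln (real n) - ln (ln (real n))) - 2000 / \<beta>) at_top sequentially"
      using filterlim_tendsto_add_at_top[OF tendsto_const[of "- 2000 / \<beta>"] assms(3)] by simp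
    show ?thesis unfolding filterlim_at_top
    proof
      fix Z
      have "\<forall>\<^sub>F n in sequentially. Z \<le> ln (real n) - ln (ln (real n)) - 2000 / \<beta>"
        "\<forall>\<^sub>F n in sequentially. Z \<le> (real n * p n - ln (real n) - ln (ln (real n))) - 2000 / \<beta>"
        using f g unfolding filterlim_at_top by auto
      then show "\<forall>\<^sub>F n in sequentially. Z \<le> w n" using eventually_gt_at_top[of 0]
      proof eventually_elim
        case (elim n)
        then show ?case unfolding w_def by (cases "p n \<le> 2 * ln n / n") (auto simp: min_def algebra_simps)
      qed
    qed
  qed
  define err where "err n = 3 * exp 2 * exp (- w n) +
      2 ^ 37 * (exp 8 * ln n ^ D / n) * (exp 1 * (exp 8 * ln n ^ D) ^ 5) +
      16 * exp 2 / ln n ^ 3 + n * exp (6 * ln n - (ln n)\<^sup>2) + exp 3 * ln n ^ D * n powr (- \<beta> / 16) +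
      exp 3 * ln n ^ D * n powr (- 1 / 4) + exp 3 * ln n ^ 31 * n powr (- \<beta> / 4) +
      2 * (exp 2 * ln n ^ 36 * n powr (- \<beta> / 8)) +
      D * n powr (- \<beta> / 16) + 2 ^ D * n powr (- \<beta> / 8) + exp (2000 - 8 * real n)" for n :: nat
  have "(\<lambda>n. exp (- w n)) \<longlonglongrightarrow> 0"
    using filterlim_compose[OF exp_at_bot] w by (simp add: filterlim_uminus_at_top)
  then have l1: "(\<lambda>n. 3 * exp 2 * exp (- w n)) \<longlonglongrightarrow> 0" by (rule tendsto_mult_right_zero)
  have l2: "(\<lambda>n::nat. 2 ^ 37 * (exp 8 * ln n ^ D / n) * (exp 1 * (exp 8 * ln n ^ D) ^ 5)) \<longlonglongrightarrow> 0"
    by real_asymp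
  have l3: "(\<lambda>n::nat. 16 * exp 2 / ln n ^ 3) \<longlonglongrightarrow> 0" by real_asymp
  have l4: "(\<lambda>n::nat. n * exp (6 * ln n - (ln n)\<^sup>2)) \<longlonglongrightarrow> 0" by real_asymp
  have l5: "(\<lambda>n::nat. exp 3 * ln n ^ D * n powr (- \<beta> / 16)) \<longlonglongrightarrow> 0" using \<beta> by real_asymp
  have l6: "(\<lambda>n::nat. exp 3 * ln n ^ D * n powr (- 1 / 4)) \<longlonglongrightarrow> 0" by real_asymp
  have l7: "(\<lambda>n::nat. exp 3 * ln n ^ 31 * n powr (- \<beta> / 4)) \<longlonglongrightarrow> 0" using \<beta> by real_asymp
  have l8: "(\<lambda>n::nat. 2 * (exp 2 * ln n ^ 36 * n powr (- \<beta> / 8))) \<longlonglongrightarrow> 0" using \<beta> by real_asymp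
  have l9: "(\<lambda>n::nat. D * n powr (- \<beta> / 16)) \<longlonglongrightarrow> 0" using \<beta> by real_asymp
  have l10: "(\<lambda>n::nat. 2 ^ D * n powr (- \<beta> / 8)) \<longlonglongrightarrow> 0" using \<beta> by real_asymp
  have l11: "(\<lambda>n::nat. exp (2000 - 8 * real n)) \<longlonglongrightarrow> 0" by real_asymp
  have "err \<longlonglongrightarrow> 0 + 0 + 0 + 0 + 0 + 0 + 0 + 0 + 0 + 0 + 0"
    unfolding err_def by (intro tendsto_add l1 l2 l3 l4 l5 l6 l7 l8 l9 l10 l11)
  then have "(\<lambda>n. 1 - err n) \<longlonglongrightarrow> 1 - 0" by (intro tendsto_diff tendsto_const) simp
  then have lower: "(\<lambda>n. 1 - err n) \<longlonglongrightarrow> 1" by simp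
  have "\<forall>\<^sub>F n in sequentially. 0 \<le> w n" using w unfolding filterlim_at_top by blast
  moreover have "\<forall>\<^sub>F n::nat in sequentially. 1 \<le> ln n" by real_asymp
  moreover have "\<forall>\<^sub>F n::nat in sequentially. 4 * ln n \<le> n" by real_asymp
  moreover have "\<forall>\<^sub>F n::nat in sequentially. 16 * exp 2 / ln n ^ 3 \<le> 1"
    using order_tendstoD(2)[OF l3, of 1] by (auto elim: eventually_mono)
  moreover have "\<forall>\<^sub>F n::nat in sequentially. exp 2 * ln n ^ 36 * n powr (- \<beta> / 8) \<le> 1 / 2"
    using order_tendstoD(2)[OF l8, of 1] by (auto elim: eventually_mono)
  moreover have "\<forall>\<^sub>F n::nat in sequentially. 10 * (n powr (1 - \<beta> / 4) + 1) \<le> n / ln n ^ 3 - 1"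
    using \<beta> by real_asymp
  moreover have "\<forall>\<^sub>F n::nat in sequentially. 10 * (n / ln n ^ 4 + 1) \<le> n / ln n ^ 3 - 1" by real_asymp
  moreover have "\<forall>\<^sub>F n::nat in sequentially. 12 * real n / 5 + 4 * (n powr (1 - \<beta> / 4) + 1) \<le> 3 * real n"
    using \<beta> by real_asymp
  moreover have "\<forall>\<^sub>F n::nat in sequentially. (real n)\<^sup>2 / 50 + 2 * real n * ((ln n)\<^sup>2 + 1) \<le> (real n)\<^sup>2 / 25" by real_asymp
  moreover have "\<forall>\<^sub>F n::nat in sequentially. ((ln n)\<^sup>2 + 3)\<^sup>2 \<le> n powr (\<beta> / 8)" using \<beta> by real_asymp
  moreover note eventually_ge_at_top[of "2000 :: nat"]
  ultimately have ev: "\<forall>\<^sub>F n in sequentially. 1 - err n \<le> prob (Gc n (nat \<lceil>(1 + \<epsilon>) * real n\<rceil>) (p n)) {G. has_rainbow_ham_cycle n G}"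
  proof eventually_elim
    case (elim n)
    show ?case
      using prob_rainbow_ge_explicit[OF assms(1), of "p n" D n, folded \<beta>_def] assms(2)[of n] D elim
      unfolding err_def w_def by simp
  qed
  show ?thesis
    by (rule tendsto_sandwich[OF ev _ lower tendsto_const]) simp
qed

end
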